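(* Let $d\in\{2,3\}$, $\kappa>0$, let $\Omega\subset\mathbb R^d$ be a bounded polytopic Lipschitz domain, let $\mathcal L$ be the Dirichlet realisation of $-\Delta+\kappa^2$ in $L^2(\Omega)$ with $L^2(\Omega)$-orthonormal eigensystem $(\lambda_j,\phi_j)_{j\ge1}$, and let $Y=\sum_{j\ge1}\lambda_j^{-1}\mathcal W(\phi_j)\phi_j$ be the solution of $\mathcal LY=\mathcal W$ driven by spatial Gaussian white noise $\mathcal W$. Let $S_N\subset L^2(\Omega)$ be any deterministic subspace with $\dim S_N=N$, and let $Z_N\in L^2(\Xi;S_N)$ be arbitrary. Then $$\mathbb E\,\|Y-Z_N\|_{L^2(\Omega)}^2\;\ge\;\sum_{j>N}\lambda_j^{-2}.$$ Equality is attained when $S_N=\operatorname{span}\{\phi_1,\dots,\phi_N\}$ and $Z_N$ is the $L^2(\Omega)$-orthogonal projection of $Y$ onto $S_N$. In particular, let $k\ge1$ be fixed, let $\{\mathcal T_h\}_h$ be a family of polytopic meshes of $\Omega$ satisfying the polytopic mesh regularity assumption (see context), and let $V_h$ be the associated space of discontinuous piecewise polynomials of degree at most $k$. Then there is a constant $c>0$, independent of $h$, such that $$\|Y-Z_h\|_{L^2(\Xi;L^2(\Omega))}\;\ge\;c\,h^{2-d/2}\qquad\forall Z_h\in L^2(\Xi;V_h).$$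
   Context: $\mathcal L$ is the positive self-adjoint operator in $L^2(\Omega)$ associated with $a(u,v)=(\nabla u,\nabla v)_{L^2(\Omega)}+\kappa^2(u,v)_{L^2(\Omega)}$ on $H^1_0(\Omega)$. Its eigenvalues are ordered $0<\lambda_1\le\lambda_2\le\dots$ and, by Weyl's law, $c_\lambda j^{2/d}\le\lambda_j\le C_\lambda j^{2/d}$ for all $j\ge1$, with constants $c_\lambda,C_\lambda>0$. $(\Xi,\mathcal F,\mathbb P)$ is a complete probability space and $\mathcal W:L^2(\Omega)\to L^2(\Xi)$ is an isonormal Gaussian process: a centred Gaussian linear map with $\mathbb E[\mathcal W(v)\mathcal W(w)]=(v,w)_{L^2(\Omega)}$. The series defining $Y$ converges in $L^2(\Xi;L^2(\Omega))$. Here $\|Z\|_{L^2(\Xi;L^2(\Omega))}=(\mathbb E\|Z\|_{L^2(\Omega)}^2)^{1/2}$, and $L^2(\Xi;S)$ denotes square-integrable $S$-valued random variables. Meshes. $\mathcal T_h$ is a finite partition of $\Omega$ into non-overlapping open polytopes $K$, $\overline\Omega=\bigcup_K\overline K$; $h_K=\operatorname{diam}(K)$, $h=\max_Kh_K$. Polytopic mesh regularity assumption: (a) there is $\vartheta_\ast\in(0,1]$, independent of $h$, such that every $K\in\mathcal T_h$ contains a ball $B(x_K,\rho_K)\subset K$ with $\rho_K\ge\vartheta_\ast h_K$ and such that the segment $[x,y]\subset K$ for all $x\in B(x_K,\rho_K)$, $y\in K$; (b) there is $c_{\mathrm{qu}}>0$, independent of $h$, with $c_{\mathrm{qu}}h\le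 h_K\le h$ for all $K\in\mathcal T_h$. Finally $V_h=\{v_h\in L^2(\Omega):v_h|_K\in\mathbb P_k(K)\ \forall K\in\mathcal T_h\}$. *)

theory Defs
  imports "HOL-Probability.Probability"
begin

text \<open>
  Elements of \<open>L\<^sup>2(\<Omega>)\<close> are represented by real functions on the whole space, of which only
  the values on \<open>\<Omega>\<close> matter, up to Lebesgue-null sets: equality in \<open>L\<^sup>2(\<Omega>)\<close> is always
  rendered as equality almost everywhere with respect to \<open>lebesgue_on \<Omega>\<close>.
\<close>

definition L2 :: "(real^'n::finite) set \<Rightarrow> (real^'n \<Rightarrow> real) set" where
  "L2 \<Omega> = {f \<in> borel_measurable (lebesgue_on \<Omega>). integrable (lebesgue_on \<Omega>) (\<lambda>x. (f x)\<^sup>2)}"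

definition L2_inner :: "(real^'n::finite) set \<Rightarrow> (real^'n \<Rightarrow> real) \<Rightarrow> (real^'n \<Rightarrow> real) \<Rightarrow> real" where
  "L2_inner \<Omega> f g = (\<integral>x. f x * g x \<partial>lebesgue_on \<Omega>)"

definition L2_norm :: "(real^'n::finite) set \<Rightarrow> (real^'n \<Rightarrow> real) \<Rightarrow> real" where
  "L2_norm \<Omega> f = sqrt (L2_inner \<Omega> f f)"

text \<open>
  The span in \<open>L\<^sup>2(\<Omega>)\<close> of \<open>e 0, \<dots>, e (N - 1)\<close>; it contains every representative of
  each of its classes.
\<close>

definition L2_span :: "(real^'n::finite) set \<Rightarrow> (nat \<Rightarrow> real^'n \<Rightarrow> real) \<Rightarrow> nat \<Rightarrow> (real^'n \<Rightarrow> real) set" where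
  "L2_span \<Omega> e N =
     {f \<in> L2 \<Omega>. \<exists>c :: nat \<Rightarrow> real. AE x in lebesgue_on \<Omega>. f x = (\<Sum>i<N. c i * e i x)}"

definition L2_subspace_of_dim :: "(real^'n::finite) set \<Rightarrow> (real^'n \<Rightarrow> real) set \<Rightarrow> nat \<Rightarrow> bool" where
  "L2_subspace_of_dim \<Omega> S N \<longleftrightarrow>
     (\<exists>e. (\<forall>i<N. e i \<in> L2 \<Omega>) \<and>
          (\<forall>c :: nat \<Rightarrow> real. (AE x in lebesgue_on \<Omega>. (\<Sum>i<N. c i * e i x) = 0) \<longrightarrow> (\<forall>i<N. c i = 0)) \<and>
          S = L2_span \<Omega> e N)"

definition L2_orth_proj ::
  "(real^'n::finite) set \<Rightarrow> (real^'n \<Rightarrow> real) set \<Rightarrow> (real^'n \<Rightarrow> real) \<Rightarrow> (real^'n \<Rightarrow> real) \<Rightarrow> bool" where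
  "L2_orth_proj \<Omega> S f g \<longleftrightarrow> g \<in> S \<and> (\<forall>s\<in>S. L2_inner \<Omega> (\<lambda>x. f x - g x) s = 0)"


text \<open>Domains: near each boundary point the domain is, up to a rotation (encoded by the direction
  \<open>\<nu>\<close>), the strict epigraph of a Lipschitz function defined on the hyperplane orthogonal to \<open>\<nu>\<close>.\<close>

definition lipschitz_domain :: "(real^'n::finite) set \<Rightarrow> bool" where
  "lipschitz_domain \<Omega> \<longleftrightarrow> open \<Omega> \<and> connected \<Omega> \<and> \<Omega> \<noteq> {} \<and>
     (\<forall>p \<in> frontier \<Omega>. \<exists>U \<nu> \<gamma> L. open U \<and> p \<in> U \<and> norm \<nu> = 1 \<and>
        L-lipschitz_on {y. y \<bullet> \<nu> = 0} (\<gamma> :: real^'n \<Rightarrow> real) \<and>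
        (\<forall>x\<in>U. x \<in> \<Omega> \<longleftrightarrow> \<gamma> (x - (x \<bullet> \<nu>) *\<^sub>R \<nu>) < x \<bullet> \<nu>))"

text \<open>Not necessarily convex open polytopes; the library's \<open>polytope\<close> is the convex hull of a
  finite set. The condition on the interior excludes slits.\<close>

definition open_polytope :: "(real^'n::finite) set \<Rightarrow> bool" where
  "open_polytope U \<longleftrightarrow> open U \<and> U \<noteq> {} \<and> interior (closure U) = U \<and>
     (\<exists>F. finite F \<and> (\<forall>p\<in>F. polytope p) \<and> closure U = \<Union>F)"


definition partial_deriv :: "'n::finite \<Rightarrow> (real^'n \<Rightarrow> real) \<Rightarrow> real^'n \<Rightarrow> real" where
  "partial_deriv i f x = frechet_derivative f (at x) (axis i 1)"

text \<open>All iterated partial derivatives exist and are (Frechet) differentiable everywhere, hence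
  continuous.\<close>

definition smooth :: "(real^'n::finite \<Rightarrow> real) \<Rightarrow> bool" where
  "smooth f \<longleftrightarrow> (\<forall>is. fold partial_deriv is f differentiable_on UNIV)"

definition test_functions :: "(real^'n::finite) set \<Rightarrow> (real^'n \<Rightarrow> real) set" where
  "test_functions \<Omega> =
     {\<psi>. smooth \<psi> \<and> compact (closure {x. \<psi> x \<noteq> 0}) \<and> closure {x. \<psi> x \<noteq> 0} \<subseteq> \<Omega>}"

definition is_weak_gradient :: "(real^'n::finite) set \<Rightarrow> (real^'n \<Rightarrow> real) \<Rightarrow> (real^'n \<Rightarrow> real^'n) \<Rightarrow> bool" where
  "is_weak_gradient \<Omega> u g \<longleftrightarrow>
     (\<forall>i. (\<lambda>x. g x $ i) \<in> L2 \<Omega> \<and>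
          (\<forall>\<psi>\<in>test_functions \<Omega>.
             L2_inner \<Omega> u (partial_deriv i \<psi>) = - L2_inner \<Omega> (\<lambda>x. g x $ i) \<psi>))"

definition H1 :: "(real^'n::finite) set \<Rightarrow> (real^'n \<Rightarrow> real) set" where
  "H1 \<Omega> = {u \<in> L2 \<Omega>. \<exists>g. is_weak_gradient \<Omega> u g}"

text \<open>The weak gradient is unique up to null sets in \<open>\<Omega>\<close>; the choice does not affect integrals.\<close>

definition weak_gradient :: "(real^'n::finite) set \<Rightarrow> (real^'n \<Rightarrow> real) \<Rightarrow> real^'n \<Rightarrow> real^'n" where
  "weak_gradient \<Omega> u = (SOME g. is_weak_gradient \<Omega> u g)"

definition grad_inner :: "(real^'n::finite) set \<Rightarrow> (real^'n \<Rightarrow> real) \<Rightarrow> (real^'n \<Rightarrow> real) \<Rightarrow> real" where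
  "grad_inner \<Omega> u v = (\<integral>x. weak_gradient \<Omega> u x \<bullet> weak_gradient \<Omega> v x \<partial>lebesgue_on \<Omega>)"

definition H1_norm :: "(real^'n::finite) set \<Rightarrow> (real^'n \<Rightarrow> real) \<Rightarrow> real" where
  "H1_norm \<Omega> u = sqrt (L2_inner \<Omega> u u + grad_inner \<Omega> u u)"

definition H10 :: "(real^'n::finite) set \<Rightarrow> (real^'n \<Rightarrow> real) set" where
  "H10 \<Omega> = {u \<in> H1 \<Omega>. \<exists>\<psi> :: nat \<Rightarrow> real^'n \<Rightarrow> real. (\<forall>n. \<psi> n \<in> test_functions \<Omega>) \<and>
                 (\<lambda>n. H1_norm \<Omega> (\<lambda>x. u x - \<psi> n x)) \<longlonglongrightarrow> 0}"

definition energy_form :: "real \<Rightarrow> (real^'n::finite) set \<Rightarrow> (real^'n \<Rightarrow> real) \<Rightarrow> (real^'n \<Rightarrow> real) \<Rightarrow> real" where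
  "energy_form \<kappa> \<Omega> u v = grad_inner \<Omega> u v + \<kappa>\<^sup>2 * L2_inner \<Omega> u v"

text \<open>The graph of the self-adjoint operator \<open>\<L>\<close> associated with the form: \<open>u\<close> lies in the
  domain of \<open>\<L>\<close> and \<open>\<L> u = f\<close>.\<close>

definition dirichlet_operator :: "real \<Rightarrow> (real^'n::finite) set \<Rightarrow> (real^'n \<Rightarrow> real) \<Rightarrow> (real^'n \<Rightarrow> real) \<Rightarrow> bool" where
  "dirichlet_operator \<kappa> \<Omega> u f \<longleftrightarrow> u \<in> H10 \<Omega> \<and> f \<in> L2 \<Omega> \<and>
     (\<forall>v\<in>H10 \<Omega>. energy_form \<kappa> \<Omega> u v = L2_inner \<Omega> f v)"

text \<open>Enumeration from 0: \<open>lam j\<close> and \<open>\<phi> j\<close> stand for \<open>\<lambda>\<close> and \<open>\<phi>\<close> with index \<open>j + 1\<close>.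
  The last clause says that the eigenfunctions form an orthonormal basis of \<open>L\<^sup>2(\<Omega>)\<close>, so that
  all eigenvalues are listed, with multiplicity.\<close>

definition dirichlet_eigensystem ::
  "real \<Rightarrow> (real^'n::finite) set \<Rightarrow> (nat \<Rightarrow> real) \<Rightarrow> (nat \<Rightarrow> real^'n \<Rightarrow> real) \<Rightarrow> bool" where
  "dirichlet_eigensystem \<kappa> \<Omega> lam \<phi> \<longleftrightarrow>
     (\<forall>j. 0 < lam j) \<and> mono lam \<and>
     (\<forall>j. dirichlet_operator \<kappa> \<Omega> (\<phi> j) (\<lambda>x. lam j * \<phi> j x)) \<and>
     (\<forall>i j. L2_inner \<Omega> (\<phi> i) (\<phi> j) = (if i = j then 1 else 0)) \<and>
     (\<forall>f\<in>L2 \<Omega>. (\<lambda>n. L2_norm \<Omega> (\<lambda>x. f x - (\<Sum>j<n. L2_inner \<Omega> f (\<phi> j) * \<phi> j x))) \<longlonglongrightarrow> 0)"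


text \<open>The Borel \<open>\<sigma>\<close>-algebra of the norm topology of \<open>L\<^sup>2(\<Omega>)\<close>. A set of functions that is open
  in this sense is automatically invariant under modification on null sets.\<close>

definition L2_open :: "(real^'n::finite) set \<Rightarrow> (real^'n \<Rightarrow> real) set \<Rightarrow> bool" where
  "L2_open \<Omega> U \<longleftrightarrow> U \<subseteq> L2 \<Omega> \<and>
     (\<forall>f\<in>U. \<exists>\<epsilon>>0. \<forall>g\<in>L2 \<Omega>. L2_norm \<Omega> (\<lambda>x. g x - f x) < \<epsilon> \<longrightarrow> g \<in> U)"

definition L2_borel :: "(real^'n::finite) set \<Rightarrow> (real^'n \<Rightarrow> real) measure" where
  "L2_borel \<Omega> = sigma (L2 \<Omega>) {U. L2_open \<Omega> U}"

text \<open>Square-integrable random variables with values in \<open>S \<subseteq> L\<^sup>2(\<Omega>)\<close>.\<close>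

definition L2_rv :: "'w measure \<Rightarrow> (real^'n::finite) set \<Rightarrow> (real^'n \<Rightarrow> real) set \<Rightarrow> ('w \<Rightarrow> real^'n \<Rightarrow> real) set" where
  "L2_rv P \<Omega> S = {Z \<in> P \<rightarrow>\<^sub>M L2_borel \<Omega>. (\<forall>\<omega>\<in>space P. Z \<omega> \<in> S) \<and>
                    integrable P (\<lambda>\<omega>. (L2_norm \<Omega> (Z \<omega>))\<^sup>2)}"

definition mean_sq_dist ::
  "'w measure \<Rightarrow> (real^'n::finite) set \<Rightarrow> ('w \<Rightarrow> real^'n \<Rightarrow> real) \<Rightarrow> ('w \<Rightarrow> real^'n \<Rightarrow> real) \<Rightarrow> real" where
  "mean_sq_dist P \<Omega> Y Z = (\<integral>\<omega>. (L2_norm \<Omega> (\<lambda>x. Y \<omega> x - Z \<omega> x))\<^sup>2 \<partial>P)"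

text \<open>Centred Gaussian random variables, including the degenerate one.\<close>

definition centred_gaussian :: "'w measure \<Rightarrow> ('w \<Rightarrow> real) \<Rightarrow> bool" where
  "centred_gaussian P X \<longleftrightarrow> X \<in> borel_measurable P \<and>
     ((\<exists>\<sigma>>0. distributed P lborel X (\<lambda>x. ennreal (normal_density 0 \<sigma> x))) \<or> (AE \<omega> in P. X \<omega> = 0))"

text \<open>By linearity all finite linear combinations of the \<open>W v\<close> are Gaussian, i.e. the process
  is jointly Gaussian. Linearity and the covariance identity also imply that \<open>W v\<close> depends, up to
  null sets, only on the class of \<open>v\<close> in \<open>L\<^sup>2(\<Omega>)\<close>.\<close>

definition isonormal_process ::
  "'w measure \<Rightarrow> (real^'n::finite) set \<Rightarrow> ((real^'n \<Rightarrow> real) \<Rightarrow> 'w \<Rightarrow> real) \<Rightarrow> bool" where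
  "isonormal_process P \<Omega> W \<longleftrightarrow>
     (\<forall>v\<in>L2 \<Omega>. centred_gaussian P (W v)) \<and>
     (\<forall>v\<in>L2 \<Omega>. \<forall>w\<in>L2 \<Omega>. \<forall>a b. AE \<omega> in P. W (\<lambda>x. a * v x + b * w x) \<omega> = a * W v \<omega> + b * W w \<omega>) \<and>
     (\<forall>v\<in>L2 \<Omega>. \<forall>w\<in>L2 \<Omega>. (\<integral>\<omega>. W v \<omega> * W w \<omega> \<partial>P) = L2_inner \<Omega> v w)"

text \<open>\<open>Y\<close> is the sum of the series of \<open>(1 / lam j) * W (\<phi> j) * \<phi> j\<close>, with convergence in
  \<open>L\<^sup>2(\<Xi>; L\<^sup>2(\<Omega>))\<close>.\<close>

definition white_noise_solution ::
  "'w measure \<Rightarrow> (real^'n::finite) set \<Rightarrow> (nat \<Rightarrow> real) \<Rightarrow> (nat \<Rightarrow> real^'n \<Rightarrow> real) \<Rightarrow>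
   ((real^'n \<Rightarrow> real) \<Rightarrow> 'w \<Rightarrow> real) \<Rightarrow> ('w \<Rightarrow> real^'n \<Rightarrow> real) \<Rightarrow> bool" where
  "white_noise_solution P \<Omega> lam \<phi> W Y \<longleftrightarrow> Y \<in> L2_rv P \<Omega> (L2 \<Omega>) \<and>
     (\<lambda>n. mean_sq_dist P \<Omega> Y (\<lambda>\<omega> x. \<Sum>j<n. (1 / lam j) * W (\<phi> j) \<omega> * \<phi> j x)) \<longlonglongrightarrow> 0"


definition polytopic_mesh :: "(real^'n::finite) set \<Rightarrow> (real^'n) set set \<Rightarrow> bool" where
  "polytopic_mesh \<Omega> \<T> \<longleftrightarrow> finite \<T> \<and> (\<forall>K\<in>\<T>. open_polytope K \<and> K \<subseteq> \<Omega>) \<and>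
     pairwise disjnt \<T> \<and> closure \<Omega> = (\<Union>K\<in>\<T>. closure K)"

definition mesh_size :: "(real^'n::finite) set set \<Rightarrow> real" where
  "mesh_size \<T> = Max (diameter ` \<T>)"

definition regular_mesh :: "real \<Rightarrow> real \<Rightarrow> (real^'n::finite) set set \<Rightarrow> bool" where
  "regular_mesh \<theta> c_qu \<T> \<longleftrightarrow>
     (\<forall>K\<in>\<T>.
        (\<exists>x\<^sub>K \<rho>\<^sub>K. \<theta> * diameter K \<le> \<rho>\<^sub>K \<and> ball x\<^sub>K \<rho>\<^sub>K \<subseteq> K \<and>
                  (\<forall>x\<in>ball x\<^sub>K \<rho>\<^sub>K. \<forall>y\<in>K. closed_segment x y \<subseteq> K)) \<and>
        c_qu * mesh_size \<T> \<le> diameter K \<and> diameter K \<le> mesh_size \<T>)"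

definition regular_mesh_family :: "(real^'n::finite) set \<Rightarrow> (real^'n) set set set \<Rightarrow> bool" where
  "regular_mesh_family \<Omega> \<M> \<longleftrightarrow> (\<forall>\<T>\<in>\<M>. polytopic_mesh \<Omega> \<T>) \<and>
     (\<exists>\<theta> c_qu. 0 < \<theta> \<and> \<theta> \<le> 1 \<and> 0 < c_qu \<and> (\<forall>\<T>\<in>\<M>. regular_mesh \<theta> c_qu \<T>))"

text \<open>Polynomials of total degree at most \<open>k\<close>; \<open>\<alpha>\<close> ranges over multi-indices.\<close>

definition poly_le :: "nat \<Rightarrow> (real^'n::finite \<Rightarrow> real) \<Rightarrow> bool" where
  "poly_le k p \<longleftrightarrow>
     (\<exists>c :: ('n \<Rightarrow> nat) \<Rightarrow> real.
        \<forall>x. p x = (\<Sum>\<alpha> | (\<Sum>i\<in>UNIV. \<alpha> i) \<le> k. c \<alpha> * (\<Prod>i\<in>UNIV. (x $ i) ^ \<alpha> i)))"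

definition dg_space :: "(real^'n::finite) set \<Rightarrow> nat \<Rightarrow> (real^'n) set set \<Rightarrow> (real^'n \<Rightarrow> real) set" where
  "dg_space \<Omega> k \<T> =
     {v \<in> L2 \<Omega>. \<forall>K\<in>\<T>. \<exists>p. poly_le k p \<and> (AE x in lebesgue_on K. v x = p x)}"

end

theory Submission
  imports Defs
begin

text \<open>
  The coefficients of \<open>Y\<close> with respect to \<open>\<phi>\<close> are uncorrelated with variances
  \<open>\<mu>\<^sub>j = \<lambda>\<^sub>j\<^sup>-\<^sup>2\<close>. If \<open>e\<^sub>1, \<dots>, e\<^sub>M\<close>, \<open>M \<le> N\<close>, is an orthonormal basis of \<open>S\<^sub>N\<close>, Bessel's inequality bounds the
  error of any \<open>S\<^sub>N\<close>-valued approximation below by \<open>\<Sum>\<^sub>j \<mu>\<^sub>j (1 - w\<^sub>j)\<close> with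
  \<open>w\<^sub>j = \<Sum>\<^sub>k (\<phi>\<^sub>j, e\<^sub>k)\<^sup>2 \<in> [0, 1]\<close> and \<open>\<Sum>\<^sub>j w\<^sub>j \<le> N\<close>, and as \<open>\<mu>\<close> decreases this is at least the tail
  \<open>\<Sum>\<^sub>j\<^sub>>\<^sub>N \<mu>\<^sub>j\<close>.

  For the mesh bound, volume comparison of the disjoint inscribed balls gives \<open>dim V\<^sub>h \<le> C h\<^sup>-\<^sup>d\<close>. The
  upper half of Weyl's law, \<open>\<lambda>\<^sub>j \<le> C j\<^sup>2\<^sup>/\<^sup>d\<close>, follows from the min-max principle applied to
  disjointly supported bump functions in \<open>m\<^sup>d\<close> congruent cubes; with \<open>m\<close> of order \<open>1/h\<close>, the
  eigenvalues with index between \<open>dim V\<^sub>h\<close> and \<open>m\<^sup>d\<close> alone contribute order \<open>h\<^sup>4\<^sup>-\<^sup>d\<close> to the tail.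
\<close>


section \<open>Orthonormal families in \<open>L\<^sup>2\<close>\<close>

text \<open>\<open>Y\<close> is known only as a mean square limit, so every estimate is made for
  finite partial sums and then transferred. L^2(Xi; L^2(\<Omega>)) is not built as a normed space;
  the transfer rests on Young's inequality for squared distances with factors 1 + \<epsilon> and 1 +
  1/\<epsilon>: for fixed \<epsilon> the second term tends to 0, and afterwards \<epsilon> does.
  Elements of L^2(\<Omega>) are functions, not classes. Linear relations therefore hold only almost
  everywhere, and \<open>weak_gradient\<close> is an arbitrary choice: its uniqueness must be proved
  before the energy of a bump function can be computed at all. Smooth bumps are built by hand and
  serve twice, as approximate indicators of boxes in that uniqueness proof and as trial functions
  for the eigenvalues. The rate comes from counting: eigenvalues with index up to m^d are at most of
  order m^2, so each of these indices contributes at least order m^(-4) to the tail. It suffices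
  that m^d is at least twice the number of functions spanning the discrete space; the root of
  m^(d-4), with m of order 1/h, is h^(2-d/2).\<close>

lemma L2_measurable: "f \<in> L2 \<Omega> \<Longrightarrow> f \<in> borel_measurable (lebesgue_on \<Omega>)"
  by (simp add: L2_def)

lemma abs_mult_le_sum_squares: "\<bar>a * b\<bar> \<le> a\<^sup>2 + b\<^sup>2" for a b :: real
proof -
  have "0 \<le> (\<bar>a\<bar> - \<bar>b\<bar>)\<^sup>2" by simp
  then have "2 * \<bar>a * b\<bar> \<le> a\<^sup>2 + b\<^sup>2"
    by (simp add: power2_eq_square algebra_simps abs_mult)
  then show ?thesis using abs_ge_zero[of "a*b"] by linarith
qed

lemma L2_mult_integrable:
  assumes "f \<in> L2 \<Omega>" "g \<in> L2 \<Omega>"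
  shows "integrable (lebesgue_on \<Omega>) (\<lambda>x. f x * g x)"
proof (rule Bochner_Integration.integrable_bound)
  show "integrable (lebesgue_on \<Omega>) (\<lambda>x. (f x)\<^sup>2 + (g x)\<^sup>2)"
    using assms by (auto simp: L2_def)
  show "(\<lambda>x. f x * g x) \<in> borel_measurable (lebesgue_on \<Omega>)"
    using assms by (auto simp: L2_def)
  show "AE x in lebesgue_on \<Omega>. norm (f x * g x) \<le> norm ((f x)\<^sup>2 + (g x)\<^sup>2)"
    using abs_mult_le_sum_squares by simp
qed

lemma L2_add: 
  assumes "f \<in> L2 \<Omega>" "g \<in> L2 \<Omega>"
  shows "(\<lambda>x. f x + g x) \<in> L2 \<Omega>"
proof -
  have "(\<lambda>x. (f x + g x)\<^sup>2) = (\<lambda>x. (f x)\<^sup>2 + 2 * (f x * g x) + (g x)\<^sup>2)"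
    by (auto simp: power2_eq_square algebra_simps)
  then show ?thesis
    using assms L2_mult_integrable[OF assms] by (auto simp: L2_def)
qed

lemma L2_cmult: "f \<in> L2 \<Omega> \<Longrightarrow> (\<lambda>x. c * f x) \<in> L2 \<Omega>"
  by (auto simp: L2_def power_mult_distrib)

lemma L2_zero [simp]: "(\<lambda>x. 0) \<in> L2 \<Omega>"
  by (auto simp: L2_def)

lemma L2_diff:
  assumes "f \<in> L2 \<Omega>" "g \<in> L2 \<Omega>"
  shows "(\<lambda>x. f x - g x) \<in> L2 \<Omega>"
  using L2_add[OF assms(1) L2_cmult[OF assms(2), of "-1"]] by simp

lemma L2_sum: "(\<And>i. i \<in> I \<Longrightarrow> f i \<in> L2 \<Omega>) \<Longrightarrow> (\<lambda>x. \<Sum>i\<in>I. f i x) \<in> L2 \<Omega>"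
  by (induction I rule: infinite_finite_induct) (auto intro: L2_add)

lemma L2_lincomb: "(\<And>i. i \<in> I \<Longrightarrow> f i \<in> L2 \<Omega>) \<Longrightarrow> (\<lambda>x. \<Sum>i\<in>I. c i * f i x) \<in> L2 \<Omega>"
  by (intro L2_sum L2_cmult)

lemma L2_inner_commute: "L2_inner \<Omega> f g = L2_inner \<Omega> g f"
  by (simp add: L2_inner_def mult.commute)

lemma L2_inner_add_left:
  assumes "f \<in> L2 \<Omega>" "g \<in> L2 \<Omega>" "h \<in> L2 \<Omega>"
  shows "L2_inner \<Omega> (\<lambda>x. f x + g x) h = L2_inner \<Omega> f h + L2_inner \<Omega> g h"
  unfolding L2_inner_def distrib_right
  by (intro Bochner_Integration.integral_add L2_mult_integrable assms)

lemma L2_inner_diff_left: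
  assumes "f \<in> L2 \<Omega>" "g \<in> L2 \<Omega>" "h \<in> L2 \<Omega>"
  shows "L2_inner \<Omega> (\<lambda>x. f x - g x) h = L2_inner \<Omega> f h - L2_inner \<Omega> g h"
  unfolding L2_inner_def left_diff_distrib
  by (intro Bochner_Integration.integral_diff L2_mult_integrable assms)

lemma L2_inner_diff_right:
  assumes "f \<in> L2 \<Omega>" "g \<in> L2 \<Omega>" "h \<in> L2 \<Omega>"
  shows "L2_inner \<Omega> h (\<lambda>x. f x - g x) = L2_inner \<Omega> h f - L2_inner \<Omega> h g"
  using L2_inner_diff_left[OF assms] by (simp add: L2_inner_commute)

lemma L2_inner_cmult_left: "L2_inner \<Omega> (\<lambda>x. c * f x) h = c * L2_inner \<Omega> f h"
  unfolding L2_inner_def by (simp add: mult.assoc)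

lemma L2_inner_cmult_right: "L2_inner \<Omega> h (\<lambda>x. c * f x) = c * L2_inner \<Omega> h f"
  by (simp add: L2_inner_commute[of _ h] L2_inner_cmult_left)

lemma L2_inner_lincomb_left:
  assumes "\<And>i. i \<in> I \<Longrightarrow> f i \<in> L2 \<Omega>" "h \<in> L2 \<Omega>"
  shows "L2_inner \<Omega> (\<lambda>x. \<Sum>i\<in>I. c i * f i x) h = (\<Sum>i\<in>I. c i * L2_inner \<Omega> (f i) h)"
  using assms
  by (induction I rule: infinite_finite_induct)
     (auto simp: L2_inner_add_left L2_lincomb L2_cmult L2_inner_cmult_left L2_inner_def[of _ "\<lambda>x. 0"])

lemma L2_inner_lincomb_right:
  assumes "\<And>i. i \<in> I \<Longrightarrow> f i \<in> L2 \<Omega>" "h \<in> L2 \<Omega>"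
  shows "L2_inner \<Omega> h (\<lambda>x. \<Sum>i\<in>I. c i * f i x) = (\<Sum>i\<in>I. c i * L2_inner \<Omega> h (f i))"
  using L2_inner_lincomb_left[OF assms] by (simp add: L2_inner_commute)

lemma L2_inner_self_nonneg: "0 \<le> L2_inner \<Omega> f f"
  unfolding L2_inner_def by (rule integral_nonneg_AE) simp

lemma L2_norm_power2: "(L2_norm \<Omega> f)\<^sup>2 = L2_inner \<Omega> f f"
  by (simp add: L2_norm_def L2_inner_self_nonneg)

lemma L2_inner_cong_AE:
  assumes "AE x in lebesgue_on \<Omega>. f x = f' x" "AE x in lebesgue_on \<Omega>. g x = g' x"
    and "f \<in> L2 \<Omega>" "g \<in> L2 \<Omega>" "f' \<in> L2 \<Omega>" "g' \<in> L2 \<Omega>"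
  shows "L2_inner \<Omega> f g = L2_inner \<Omega> f' g'"
  unfolding L2_inner_def using assms
  by (intro integral_cong_AE) (auto simp: L2_def)

lemma L2_inner_self_diff:
  assumes "f \<in> L2 \<Omega>" "g \<in> L2 \<Omega>"
  shows "L2_inner \<Omega> (\<lambda>x. f x - g x) (\<lambda>x. f x - g x) =
    L2_inner \<Omega> f f - 2 * L2_inner \<Omega> f g + L2_inner \<Omega> g g"
  using assms by (simp add: L2_inner_diff_left L2_inner_diff_right L2_diff L2_inner_commute[of _ g f])

text \<open>Pointwise Young inequality, integrated. It replaces the triangle inequality, since all
  distances here are squared; the weight \<epsilon> is kept free so that one of the two terms can be
  given a factor close to 1.\<close>

lemma L2_inner_self_add_le:
  assumes "f \<in> L2 \<Omega>" "g \<in> L2 \<Omega>" "h \<in> L2 \<Omega>" and "\<epsilon> > 0"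
  shows "L2_inner \<Omega> (\<lambda>x. f x - h x) (\<lambda>x. f x - h x) \<le>
    (1 + \<epsilon>) * L2_inner \<Omega> (\<lambda>x. f x - g x) (\<lambda>x. f x - g x) +
    (1 + 1 / \<epsilon>) * L2_inner \<Omega> (\<lambda>x. g x - h x) (\<lambda>x. g x - h x)"
proof -
  have *: "(a - c)\<^sup>2 \<le> (1 + \<epsilon>) * (a - b)\<^sup>2 + (1 + 1 / \<epsilon>) * (b - c)\<^sup>2" for a b c :: real
  proof -
    \<comment> \<open>The difference of the two sides is exactly this square.\<close>
    have "0 \<le> (\<epsilon> * (a - b) - (b - c))\<^sup>2 / \<epsilon>" using \<open>\<epsilon> > 0\<close> by simp
    also have "\<dots> = (1 + \<epsilon>) * (a - b)\<^sup>2 + (1 + 1 / \<epsilon>) * (b - c)\<^sup>2 - (a - c)\<^sup>2"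
      using \<open>\<epsilon> > 0\<close> by (simp add: field_simps power2_eq_square)
    finally show ?thesis by simp
  qed
  let ?M = "lebesgue_on \<Omega>"
  have i: "integrable ?M (\<lambda>x. (f x - h x)\<^sup>2)" "integrable ?M (\<lambda>x. (f x - g x)\<^sup>2)"
    "integrable ?M (\<lambda>x. (g x - h x)\<^sup>2)"
    using L2_diff[OF assms(1,3)] L2_diff[OF assms(1,2)] L2_diff[OF assms(2,3)] by (auto simp: L2_def)
  have "(\<integral>x. (f x - h x)\<^sup>2 \<partial>?M) \<le> (\<integral>x. (1 + \<epsilon>) * (f x - g x)\<^sup>2 + (1 + 1 / \<epsilon>) * (g x - h x)\<^sup>2 \<partial>?M)"
    by (rule integral_mono) (use i * in auto)
  also have "\<dots> = (1 + \<epsilon>) * (\<integral>x. (f x - g x)\<^sup>2 \<partial>?M) + (1 + 1 / \<epsilon>) * (\<integral>x. (g x - h x)\<^sup>2 \<partial>?M)"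
    using i by simp
  finally show ?thesis by (simp add: L2_inner_def power2_eq_square)
qed

section \<open>Bessel, Parseval and Gram-Schmidt\<close>

definition orthonormal_on :: "(real^'n::finite) set \<Rightarrow> ('i \<Rightarrow> real^'n \<Rightarrow> real) \<Rightarrow> 'i set \<Rightarrow> bool" where
  "orthonormal_on \<Omega> e I \<longleftrightarrow> (\<forall>i\<in>I. e i \<in> L2 \<Omega>) \<and>
     (\<forall>i\<in>I. \<forall>j\<in>I. L2_inner \<Omega> (e i) (e j) = (if i = j then 1 else 0))"

lemma orthonormal_onD:
  assumes "orthonormal_on \<Omega> e I"
  shows "i \<in> I \<Longrightarrow> e i \<in> L2 \<Omega>"
    and "i \<in> I \<Longrightarrow> j \<in> I \<Longrightarrow> L2_inner \<Omega> (e i) (e j) = (if i = j then 1 else 0)"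
  using assms by (auto simp: orthonormal_on_def)

lemma orthonormal_on_subset: "orthonormal_on \<Omega> e I \<Longrightarrow> J \<subseteq> I \<Longrightarrow> orthonormal_on \<Omega> e J"
  unfolding orthonormal_on_def by blast

lemma orthonormal_inner_lincomb:
  assumes "orthonormal_on \<Omega> e I" "finite I" "i \<in> I"
  shows "L2_inner \<Omega> (\<lambda>x. \<Sum>j\<in>I. c j * e j x) (e i) = c i"
proof -
  have "L2_inner \<Omega> (\<lambda>x. \<Sum>j\<in>I. c j * e j x) (e i) = (\<Sum>j\<in>I. c j * L2_inner \<Omega> (e j) (e i))"
    using assms by (intro L2_inner_lincomb_left) (auto simp: orthonormal_on_def)
  also have "\<dots> = (\<Sum>j\<in>I. if j = i then c j else 0)"
    using assms by (intro sum.cong) (auto simp: orthonormal_on_def)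
  finally show ?thesis using assms by simp
qed

lemma orthonormal_self_lincomb:
  assumes "orthonormal_on \<Omega> e I" "finite I"
  shows "L2_inner \<Omega> (\<lambda>x. \<Sum>j\<in>I. c j * e j x) (\<lambda>x. \<Sum>j\<in>I. c j * e j x) = (\<Sum>j\<in>I. (c j)\<^sup>2)"
proof -
  have "L2_inner \<Omega> (\<lambda>x. \<Sum>j\<in>I. c j * e j x) (\<lambda>x. \<Sum>j\<in>I. c j * e j x) =
      (\<Sum>i\<in>I. c i * L2_inner \<Omega> (\<lambda>x. \<Sum>j\<in>I. c j * e j x) (e i))"
    using assms by (intro L2_inner_lincomb_right L2_lincomb) (auto simp: orthonormal_on_def)
  also have "\<dots> = (\<Sum>j\<in>I. (c j)\<^sup>2)"
    using assms by (intro sum.cong) (auto simp: orthonormal_inner_lincomb power2_eq_square)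
  finally show ?thesis .
qed

text \<open>Completing the square in each coefficient. Dropping the last sum bounds the distance to
  a span from below, Fourier coefficients for \<open>c\<close> give Bessel's inequality, and their
  limit gives Parseval's identity.\<close>

lemma orthonormal_dist_lincomb:
  assumes "orthonormal_on \<Omega> e I" "finite I" "f \<in> L2 \<Omega>"
  shows "L2_inner \<Omega> (\<lambda>x. f x - (\<Sum>j\<in>I. c j * e j x)) (\<lambda>x. f x - (\<Sum>j\<in>I. c j * e j x)) =
    L2_inner \<Omega> f f - (\<Sum>j\<in>I. (L2_inner \<Omega> f (e j))\<^sup>2) + (\<Sum>j\<in>I. (c j - L2_inner \<Omega> f (e j))\<^sup>2)"
proof -
  have e: "\<And>i. i \<in> I \<Longrightarrow> e i \<in> L2 \<Omega>" using assms by (auto simp: orthonormal_on_def)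
  have "L2_inner \<Omega> (\<lambda>x. f x - (\<Sum>j\<in>I. c j * e j x)) (\<lambda>x. f x - (\<Sum>j\<in>I. c j * e j x)) =
    L2_inner \<Omega> f f - 2 * (\<Sum>j\<in>I. c j * L2_inner \<Omega> f (e j)) + (\<Sum>j\<in>I. (c j)\<^sup>2)"
    using assms e by (simp add: L2_inner_self_diff L2_lincomb orthonormal_self_lincomb L2_inner_lincomb_right)
  also have "\<dots> = L2_inner \<Omega> f f - (\<Sum>j\<in>I. (L2_inner \<Omega> f (e j))\<^sup>2) + (\<Sum>j\<in>I. (c j - L2_inner \<Omega> f (e j))\<^sup>2)"
    by (simp add: power2_diff sum.distrib sum_subtractf sum_distrib_left mult_ac)
  finally show ?thesis .
qed

lemma bessel_lincomb:
  assumes "orthonormal_on \<Omega> e I" "finite I" "f \<in> L2 \<Omega>"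
  shows "L2_inner \<Omega> f f - (\<Sum>j\<in>I. (L2_inner \<Omega> f (e j))\<^sup>2) \<le>
    L2_inner \<Omega> (\<lambda>x. f x - (\<Sum>j\<in>I. c j * e j x)) (\<lambda>x. f x - (\<Sum>j\<in>I. c j * e j x))"
  unfolding orthonormal_dist_lincomb[OF assms] by (simp add: sum_nonneg)

lemma bessel:
  assumes "orthonormal_on \<Omega> e I" "finite I" "f \<in> L2 \<Omega>"
  shows "(\<Sum>j\<in>I. (L2_inner \<Omega> f (e j))\<^sup>2) \<le> L2_inner \<Omega> f f"
  using orthonormal_dist_lincomb[OF assms, of "\<lambda>j. L2_inner \<Omega> f (e j)"]
    L2_inner_self_nonneg[of \<Omega> "\<lambda>x. f x - (\<Sum>j\<in>I. L2_inner \<Omega> f (e j) * e j x)"] by simp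

lemma parseval:
  assumes e: "orthonormal_on \<Omega> e UNIV" and f: "f \<in> L2 \<Omega>"
    and lim: "(\<lambda>n. L2_norm \<Omega> (\<lambda>x. f x - (\<Sum>j<n. L2_inner \<Omega> f (e j) * e j x))) \<longlonglongrightarrow> 0"
  shows "(\<lambda>j. (L2_inner \<Omega> f (e j))\<^sup>2) sums L2_inner \<Omega> f f"
proof -
  have "(\<lambda>n. (L2_norm \<Omega> (\<lambda>x. f x - (\<Sum>j<n. L2_inner \<Omega> f (e j) * e j x)))\<^sup>2) \<longlonglongrightarrow> 0\<^sup>2"
    by (intro tendsto_power lim)
  then have "(\<lambda>n. L2_inner \<Omega> f f - (\<Sum>j<n. (L2_inner \<Omega> f (e j))\<^sup>2)) \<longlonglongrightarrow> 0"
    by (simp add: L2_norm_power2 orthonormal_dist_lincomb[OF orthonormal_on_subset[OF e] _ f])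
  then have "(\<lambda>n. L2_inner \<Omega> f f - (L2_inner \<Omega> f f - (\<Sum>j<n. (L2_inner \<Omega> f (e j))\<^sup>2)))
      \<longlonglongrightarrow> L2_inner \<Omega> f f - 0"
    by (intro tendsto_intros)
  then show ?thesis by (simp add: sums_def)
qed

lemma L2_inner_self_eq_0:
  assumes "f \<in> L2 \<Omega>" "L2_inner \<Omega> f f = 0"
  shows "AE x in lebesgue_on \<Omega>. f x = 0"
proof -
  have "AE x in lebesgue_on \<Omega>. (f x)\<^sup>2 = 0"
    using integral_nonneg_eq_0_iff_AE[of "lebesgue_on \<Omega>" "\<lambda>x. (f x)\<^sup>2"] assms
    by (auto simp: L2_def L2_inner_def power2_eq_square)
  then show ?thesis by simp
qed

text \<open>Linear independence is not assumed, hence only \<open>M \<le> card I\<close>. Any finite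
  spanning family can be fed in, in particular the piecewise monomials, without a discussion of
  their independence.\<close>

lemma gram_schmidt:
  assumes "finite I" "\<And>i. i \<in> I \<Longrightarrow> e i \<in> L2 \<Omega>"
  obtains u :: "nat \<Rightarrow> real^'n::finite \<Rightarrow> real" and M where "M \<le> card I" "orthonormal_on \<Omega> u {..<M}"
    "\<And>i. i \<in> I \<Longrightarrow> \<exists>c. AE x in lebesgue_on \<Omega>. e i x = (\<Sum>k<M. c k * u k x)"
proof -
  have "\<exists>(u :: nat \<Rightarrow> real^'n \<Rightarrow> real) M. M \<le> card I \<and> orthonormal_on \<Omega> u {..<M} \<and>
    (\<forall>i\<in>I. \<exists>c. AE x in lebesgue_on \<Omega>. e i x = (\<Sum>k<M. c k * u k x))"
    using assms
  proof (induction I)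
    case empty
    then show ?case by (auto simp: orthonormal_on_def)
  next
    case (insert a I)
    then obtain u :: "nat \<Rightarrow> real^'n \<Rightarrow> real" and M where u: "M \<le> card I" "orthonormal_on \<Omega> u {..<M}"
      "\<And>i. i \<in> I \<Longrightarrow> \<exists>c. AE x in lebesgue_on \<Omega>. e i x = (\<Sum>k<M. c k * u k x)"
      by auto
    have a: "e a \<in> L2 \<Omega>" using insert by simp
    have uL: "\<And>i. i < M \<Longrightarrow> u i \<in> L2 \<Omega>" using u by (auto simp: orthonormal_on_def)
    define b where "b k = L2_inner \<Omega> (e a) (u k)" for k
    define r where "r = (\<lambda>x. e a x - (\<Sum>k<M. b k * u k x))"
    have r: "r \<in> L2 \<Omega>" unfolding r_def by (intro L2_diff a L2_lincomb uL) auto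
    have r_orth: "L2_inner \<Omega> r (u k) = 0" if "k < M" for k
      unfolding r_def using a uL that
      by (subst L2_inner_diff_left)
         (auto intro!: L2_lincomb simp: orthonormal_inner_lincomb[OF u(2)] b_def)
    show ?case
    proof (cases "L2_inner \<Omega> r r = 0")
      case True
      \<comment> \<open>The residual vanishes almost everywhere: \<open>e a\<close> adds no
        direction and the family stays as it is.\<close>
      then have "AE x in lebesgue_on \<Omega>. r x = 0" using L2_inner_self_eq_0 r by blast
      then have "AE x in lebesgue_on \<Omega>. e a x = (\<Sum>k<M. b k * u k x)"
        by (simp add: r_def)
      then show ?thesis using u insert.hyps by (intro exI[of _ u] exI[of _ M]) auto
    next
      case False
      define s where "s = sqrt (L2_inner \<Omega> r r)"
      have s: "s > 0" "s * s = L2_inner \<Omega> r r"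
        using False L2_inner_self_nonneg[of \<Omega> r] by (auto simp: s_def less_le)
      define v where "v = (\<lambda>k. if k < M then u k else (\<lambda>x. (1 / s) * r x))"
      have "orthonormal_on \<Omega> v {..<Suc M}"
        unfolding orthonormal_on_def
      proof (intro conjI ballI)
        fix i assume "i \<in> {..<Suc M}"
        then show "v i \<in> L2 \<Omega>" using uL L2_cmult[OF r, of "1/s"] by (auto simp: v_def)
      next
        fix i j assume ij: "i \<in> {..<Suc M}" "j \<in> {..<Suc M}"
        have "L2_inner \<Omega> (\<lambda>x. (1/s) * r x) (\<lambda>x. (1/s) * r x) = 1"
          unfolding L2_inner_cmult_left L2_inner_cmult_right s(2)[symmetric] using s(1) by simp
        moreover have "L2_inner \<Omega> (\<lambda>x. (1/s) * r x) (u k) = 0" "L2_inner \<Omega> (u k) (\<lambda>x. (1/s) * r x) = 0"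
          if "k < M" for k
          using r_orth[OF that] unfolding L2_inner_cmult_left L2_inner_cmult_right
          by (auto simp: L2_inner_commute)
        ultimately show "L2_inner \<Omega> (v i) (v j) = (if i = j then 1 else 0)"
          using ij orthonormal_onD(2)[OF u(2)]
          by (cases "i < M"; cases "j < M") (auto simp: v_def)
      qed
      moreover have "\<exists>c. AE x in lebesgue_on \<Omega>. e i x = (\<Sum>k<Suc M. c k * v k x)"
        if i: "i \<in> insert a I" for i
      proof (cases "i = a")
        case True
        have "e a x = (\<Sum>k<Suc M. (if k < M then b k else s) * v k x)" for x
          using s(1) by (simp add: v_def r_def)
        then show ?thesis using True by (intro exI[of _ "\<lambda>k. if k < M then b k else s"]) auto
      next
        case False
        then obtain c where c: "AE x in lebesgue_on \<Omega>. e i x = (\<Sum>k<M. c k * u k x)"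
          using u(3) i by auto
        have "(\<Sum>k<Suc M. (if k < M then c k else 0) * v k x) = (\<Sum>k<M. c k * u k x)" for x
          by (simp add: v_def)
        then show ?thesis using c by (intro exI[of _ "\<lambda>k. if k < M then c k else 0"]) simp
      qed
      ultimately show ?thesis using u(1) insert.hyps
        by (intro exI[of _ v] exI[of _ "Suc M"]) auto
    qed
  qed
  then show thesis using that by blast
qed

text \<open>Finitely many exceptional null sets unite to one; the new coefficients are a product of
  a row vector with the matrix \<open>c\<close>.\<close>

lemma AE_lincomb_of_lincombs:
  assumes "finite I" "\<And>i. i \<in> I \<Longrightarrow> \<exists>c. AE x in A. e i x = (\<Sum>k\<in>K. c k * (u k x :: real))"
  shows "\<exists>c. AE x in A. (\<Sum>i\<in>I. a i * e i x) = (\<Sum>k\<in>K. c k * u k x)"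
proof -
  obtain c where c: "\<And>i. i \<in> I \<Longrightarrow> AE x in A. e i x = (\<Sum>k\<in>K. c i k * u k x)"
    using assms(2) by metis
  have "AE x in A. \<forall>i\<in>I. e i x = (\<Sum>k\<in>K. c i k * u k x)"
    using assms(1) c by (simp add: AE_finite_all)
  then have "AE x in A. (\<Sum>i\<in>I. a i * e i x) = (\<Sum>k\<in>K. (\<Sum>i\<in>I. a i * c i k) * u k x)"
    apply eventually_elim
    apply (simp add: sum_distrib_left sum_distrib_right mult.assoc)
    apply (rule sum.swap)
    done
  then show ?thesis by (rule exI[of _ "\<lambda>k. \<Sum>i\<in>I. a i * c i k"])
qed


section \<open>Approximation of the white noise series\<close>

lemma space_L2_borel: "space (L2_borel \<Omega>) = L2 \<Omega>"
  unfolding L2_borel_def by (rule space_measure_of) (auto simp: L2_open_def)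

lemma L2_open_sets: "L2_open \<Omega> U \<Longrightarrow> U \<in> sets (L2_borel \<Omega>)"
  unfolding L2_borel_def by (subst sets_measure_of) (auto simp: L2_open_def)

text \<open>Pairing with a unit vector is nonexpansive, hence continuous: Bessel's inequality for
  the one-element family indexed by \<open>()\<close> is the required case of
  Cauchy-Schwarz.\<close>

lemma L2_inner_measurable:
  assumes "e \<in> L2 \<Omega>" "L2_inner \<Omega> e e = 1"
  shows "(\<lambda>f. L2_inner \<Omega> f e) \<in> borel_measurable (L2_borel \<Omega>)"
proof (rule borel_measurableI)
  fix V :: "real set" assume V: "open V"
  have "L2_open \<Omega> ((\<lambda>f. L2_inner \<Omega> f e) -` V \<inter> L2 \<Omega>)"
    unfolding L2_open_def
  proof (intro conjI ballI)
    fix f assume f: "f \<in> (\<lambda>f. L2_inner \<Omega> f e) -` V \<inter> L2 \<Omega>"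
    then obtain \<epsilon> where \<epsilon>: "\<epsilon> > 0" "ball (L2_inner \<Omega> f e) \<epsilon> \<subseteq> V"
      using V open_contains_ball by blast
    have "g \<in> (\<lambda>f. L2_inner \<Omega> f e) -` V \<inter> L2 \<Omega>"
      if g: "g \<in> L2 \<Omega>" "L2_norm \<Omega> (\<lambda>x. g x - f x) < \<epsilon>" for g
    proof -
      have "(L2_inner \<Omega> (\<lambda>x. g x - f x) e)\<^sup>2 \<le> L2_inner \<Omega> (\<lambda>x. g x - f x) (\<lambda>x. g x - f x)"
        using bessel[of \<Omega> "\<lambda>_. e" "{()}" "\<lambda>x. g x - f x"] assms g f
        by (auto simp: orthonormal_on_def intro: L2_diff)
      then have "\<bar>L2_inner \<Omega> (\<lambda>x. g x - f x) e\<bar> \<le> L2_norm \<Omega> (\<lambda>x. g x - f x)"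
        by (simp add: L2_norm_def real_le_rsqrt)
      then have "\<bar>L2_inner \<Omega> g e - L2_inner \<Omega> f e\<bar> < \<epsilon>"
        using g f assms by (auto simp: L2_inner_diff_left)
      then have "L2_inner \<Omega> g e \<in> ball (L2_inner \<Omega> f e) \<epsilon>" by (simp add: dist_real_def abs_minus_commute)
      then show ?thesis using \<epsilon> g by auto
    qed
    then show "\<exists>\<epsilon>>0. \<forall>g\<in>L2 \<Omega>. L2_norm \<Omega> (\<lambda>x. g x - f x) < \<epsilon> \<longrightarrow>
        g \<in> (\<lambda>f. L2_inner \<Omega> f e) -` V \<inter> L2 \<Omega>"
      using \<epsilon>(1) by blast
  qed auto
  then show "(\<lambda>f. L2_inner \<Omega> f e) -` V \<inter> space (L2_borel \<Omega>) \<in> sets (L2_borel \<Omega>)"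
    by (simp add: space_L2_borel L2_open_sets)
qed

text \<open>Such a map is continuous, so it pulls the open generators of \<open>L2_borel\<close>
  back to open sets. The intended map is the projection onto a span of eigenfunctions.\<close>

lemma L2_nonexpansive_measurable:
  assumes "\<And>f. f \<in> L2 \<Omega> \<Longrightarrow> T f \<in> L2 \<Omega>"
    and "\<And>f g. f \<in> L2 \<Omega> \<Longrightarrow> g \<in> L2 \<Omega> \<Longrightarrow>
      L2_norm \<Omega> (\<lambda>x. T f x - T g x) \<le> L2_norm \<Omega> (\<lambda>x. f x - g x)"
  shows "T \<in> L2_borel \<Omega> \<rightarrow>\<^sub>M L2_borel \<Omega>"
proof -
  have "T \<in> L2_borel \<Omega> \<rightarrow>\<^sub>M sigma (L2 \<Omega>) {U. L2_open \<Omega> U}"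
  proof (rule measurable_measure_of)
    show "{U. L2_open \<Omega> U} \<subseteq> Pow (L2 \<Omega>)" by (auto simp: L2_open_def)
    show "T \<in> space (L2_borel \<Omega>) \<rightarrow> L2 \<Omega>" using assms(1) by (auto simp: space_L2_borel)
    fix U assume "U \<in> {U. L2_open \<Omega> U}"
    then have U: "L2_open \<Omega> U" by simp
    have "L2_open \<Omega> (T -` U \<inter> L2 \<Omega>)"
      unfolding L2_open_def
    proof (intro conjI ballI)
      fix f assume "f \<in> T -` U \<inter> L2 \<Omega>"
      then obtain \<epsilon> where "\<epsilon> > 0" "\<And>g. g \<in> L2 \<Omega> \<Longrightarrow> L2_norm \<Omega> (\<lambda>x. g x - T f x) < \<epsilon> \<Longrightarrow> g \<in> U"
        using U unfolding L2_open_def by blast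
      then show "\<exists>\<epsilon>>0. \<forall>g\<in>L2 \<Omega>. L2_norm \<Omega> (\<lambda>x. g x - f x) < \<epsilon> \<longrightarrow> g \<in> T -` U \<inter> L2 \<Omega>"
        using assms \<open>f \<in> T -` U \<inter> L2 \<Omega>\<close>
        by (intro exI[of _ \<epsilon>]) (auto intro!: le_less_trans[OF assms(2)])
    qed auto
    then show "T -` U \<inter> space (L2_borel \<Omega>) \<in> sets (L2_borel \<Omega>)"
      by (simp add: space_L2_borel L2_open_sets)
  qed
  then show ?thesis by (simp add: L2_borel_def)
qed

section \<open>Squared distances in mean and two inequalities for real sequences\<close>

lemma mean_sq_dist_eq:
  "mean_sq_dist P \<Omega> Y Z = (\<integral>\<omega>. L2_inner \<Omega> (\<lambda>x. Y \<omega> x - Z \<omega> x) (\<lambda>x. Y \<omega> x - Z \<omega> x) \<partial>P)"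
  by (simp add: mean_sq_dist_def L2_norm_power2)

lemma mean_sq_dist_commute: "mean_sq_dist P \<Omega> Y Z = mean_sq_dist P \<Omega> Z Y"
  unfolding mean_sq_dist_eq L2_inner_def by (simp add: algebra_simps)

text \<open>A bathtub argument: with weights in [0, 1] of total at most \<open>N\<close>, the
  largest reduction of the sum is achieved by spending all weight on the \<open>N\<close> largest
  \<open>\<mu> j\<close>. The proof compares both sides of the threshold with the single value
  \<open>\<mu> N\<close>.\<close>

lemma antimono_weighted_sum_ge:
  fixes \<mu> w :: "nat \<Rightarrow> real"
  assumes "antimono \<mu>" "\<And>j. 0 \<le> \<mu> j" "\<And>j. 0 \<le> w j" "\<And>j. w j \<le> 1" "(\<Sum>j<n. w j) \<le> real N"
  shows "(\<Sum>j=N..<n. \<mu> j) \<le> (\<Sum>j<n. \<mu> j * (1 - w j))"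
proof (cases "N < n")
  case False
  then show ?thesis using assms by (auto intro!: sum_nonneg mult_nonneg_nonneg)
next
  case True
  have split: "(\<Sum>j<n. f j) = (\<Sum>j<N. f j) + (\<Sum>j=N..<n. f j)" for f :: "nat \<Rightarrow> real"
    using True by (metis atLeast0LessThan less_or_eq_imp_le sum.atLeastLessThan_concat zero_le)
  have "(\<Sum>j=N..<n. \<mu> j * w j) \<le> (\<Sum>j=N..<n. \<mu> N * w j)"
    using assms by (intro sum_mono mult_right_mono) (auto dest: antimonoD)
  also have "\<dots> = \<mu> N * (\<Sum>j=N..<n. w j)" by (simp add: sum_distrib_left)
  \<comment> \<open>As the total weight is at most \<open>N\<close>, the weight lying beyond
    \<open>N\<close> is at most what the first \<open>N\<close> weights lack to 1.\<close>
  also have "\<dots> \<le> \<mu> N * (\<Sum>j<N. 1 - w j)"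
    using assms split[of w] by (intro mult_left_mono) (auto simp: sum_subtractf)
  also have "\<dots> = (\<Sum>j<N. \<mu> N * (1 - w j))" by (simp add: sum_distrib_left)
  also have "\<dots> \<le> (\<Sum>j<N. \<mu> j * (1 - w j))"
    using assms by (intro sum_mono mult_right_mono) (auto simp: antimonoD)
  finally show ?thesis
    unfolding split[of "\<lambda>j. \<mu> j * (1 - w j)"] by (simp add: right_diff_distrib sum_subtractf)
qed

lemma le_of_le_one_plus_mult:
  fixes a b :: real
  assumes "\<And>\<epsilon>. 0 < \<epsilon> \<Longrightarrow> a \<le> (1 + \<epsilon>) * b"
  shows "a \<le> b"
proof -
  have "((\<lambda>\<epsilon>. (1 + \<epsilon>) * b) \<longlongrightarrow> (1 + 0) * b) (at_right 0)"
    by (intro tendsto_intros)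
  then show ?thesis
    using tendsto_lowerbound[of "\<lambda>\<epsilon>. (1 + \<epsilon>) * b" "(1 + 0) * b" "at_right 0" a] assms
    by (auto simp: eventually_at_right_field gt_ex)
qed

text \<open>The probabilistic part sees the operator only through an orthonormal basis and a
  positive increasing sequence; the differential equation returns later, when the sequence has to be
  bounded.\<close>

locale white_noise_series =
  fixes P :: "'w measure" and \<Omega> :: "(real^'n::finite) set" and lam :: "nat \<Rightarrow> real"
    and \<phi> :: "nat \<Rightarrow> real^'n \<Rightarrow> real" and W :: "(real^'n \<Rightarrow> real) \<Rightarrow> 'w \<Rightarrow> real"
    and Y :: "'w \<Rightarrow> real^'n \<Rightarrow> real"
  assumes orthonormal: "orthonormal_on \<Omega> \<phi> UNIV"
    and total: "f \<in> L2 \<Omega> \<Longrightarrow>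
      (\<lambda>n. L2_norm \<Omega> (\<lambda>x. f x - (\<Sum>j<n. L2_inner \<Omega> f (\<phi> j) * \<phi> j x))) \<longlonglongrightarrow> 0"
    and lam_pos: "0 < lam j"
    and lam_mono: "mono lam"
    and isonormal: "isonormal_process P \<Omega> W"
    and solution: "white_noise_solution P \<Omega> lam \<phi> W Y"
begin

lemma \<phi>_L2: "\<phi> j \<in> L2 \<Omega>"
  using orthonormal by (auto simp: orthonormal_on_def)

lemma \<phi>_orthonormal: "orthonormal_on \<Omega> \<phi> I"
  by (rule orthonormal_on_subset[OF orthonormal]) simp

definition y :: "nat \<Rightarrow> 'w \<Rightarrow> real" where
  "y j \<omega> = (1 / lam j) * W (\<phi> j) \<omega>"

definition Y_part :: "nat \<Rightarrow> 'w \<Rightarrow> real^'n \<Rightarrow> real" where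
  "Y_part n \<omega> x = (\<Sum>j<n. y j \<omega> * \<phi> j x)"

lemma y_measurable [measurable]: "y j \<in> borel_measurable P"
proof -
  have "W (\<phi> j) \<in> borel_measurable P"
    using isonormal \<phi>_L2[of j] by (auto simp: isonormal_process_def centred_gaussian_def)
  then show ?thesis unfolding y_def[abs_def] by simp
qed

lemma y_prod_integral: "(\<integral>\<omega>. y i \<omega> * y j \<omega> \<partial>P) = (if i = j then 1 / (lam j)\<^sup>2 else 0)"
proof -
  have "(\<integral>\<omega>. y i \<omega> * y j \<omega> \<partial>P) = (\<integral>\<omega>. (1 / (lam i * lam j)) * (W (\<phi> i) \<omega> * W (\<phi> j) \<omega>) \<partial>P)"
    by (simp add: y_def mult_ac)
  also have "\<dots> = (1 / (lam i * lam j)) * L2_inner \<Omega> (\<phi> i) (\<phi> j)"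
    using isonormal \<phi>_L2 by (simp add: isonormal_process_def)
  finally show ?thesis
    using orthonormal by (auto simp: orthonormal_on_def power2_eq_square)
qed

text \<open>The Bochner integral of a non-integrable function is 0 by convention, whereas the
  covariance identity gives a positive value; so integrability can be read off from that
  identity.\<close>

lemma y_sq_integrable: "integrable P (\<lambda>\<omega>. (y j \<omega>)\<^sup>2)"
proof (rule ccontr)
  assume "\<not> ?thesis"
  then have "(\<integral>\<omega>. (y j \<omega>)\<^sup>2 \<partial>P) = 0" by (rule not_integrable_integral_eq)
  then show False using y_prod_integral[of j j] lam_pos[of j] by (simp add: power2_eq_square)
qed

lemma y_prod_integrable: "integrable P (\<lambda>\<omega>. y i \<omega> * y j \<omega>)"
proof (rule Bochner_Integration.integrable_bound)
  show "integrable P (\<lambda>\<omega>. (y i \<omega>)\<^sup>2 + (y j \<omega>)\<^sup>2)" using y_sq_integrable by simp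
  show "AE \<omega> in P. norm (y i \<omega> * y j \<omega>) \<le> norm ((y i \<omega>)\<^sup>2 + (y j \<omega>)\<^sup>2)"
    using abs_mult_le_sum_squares by simp
qed simp

lemma lincomb_y_sq:
  assumes "finite J"
  shows "integrable P (\<lambda>\<omega>. (\<Sum>j\<in>J. y j \<omega> * a j)\<^sup>2)"
    and "(\<integral>\<omega>. (\<Sum>j\<in>J. y j \<omega> * a j)\<^sup>2 \<partial>P) = (\<Sum>j\<in>J. 1 / (lam j)\<^sup>2 * (a j)\<^sup>2)"
proof -
  have eq: "(\<lambda>\<omega>. (\<Sum>j\<in>J. y j \<omega> * a j)\<^sup>2) = (\<lambda>\<omega>. \<Sum>i\<in>J. \<Sum>j\<in>J. (a i * a j) * (y i \<omega> * y j \<omega>))"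
    by (simp add: power2_eq_square sum_product mult_ac)
  show "integrable P (\<lambda>\<omega>. (\<Sum>j\<in>J. y j \<omega> * a j)\<^sup>2)"
    unfolding eq using y_prod_integrable by simp
  have "(\<integral>\<omega>. (\<Sum>j\<in>J. y j \<omega> * a j)\<^sup>2 \<partial>P) =
      (\<Sum>i\<in>J. \<Sum>j\<in>J. (a i * a j) * (if i = j then 1 / (lam j)\<^sup>2 else 0))"
    unfolding eq by (simp add: y_prod_integrable y_prod_integral)
  also have "\<dots> = (\<Sum>j\<in>J. 1 / (lam j)\<^sup>2 * (a j)\<^sup>2)"
    using assms by (intro sum.cong) (auto simp: if_distrib power2_eq_square cong: if_cong)
  finally show "(\<integral>\<omega>. (\<Sum>j\<in>J. y j \<omega> * a j)\<^sup>2 \<partial>P) = (\<Sum>j\<in>J. 1 / (lam j)\<^sup>2 * (a j)\<^sup>2)" .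
qed

text \<open>A weak form of measurability, by coefficients. It passes to differences at once and is
  evident for partial sums of the series, while for \<open>L2_borel\<close> one would have to argue
  through separability.\<close>

definition L2_process :: "('w \<Rightarrow> real^'n \<Rightarrow> real) \<Rightarrow> bool" where
  "L2_process F \<longleftrightarrow> (\<forall>\<omega>\<in>space P. F \<omega> \<in> L2 \<Omega>) \<and>
     (\<forall>j. (\<lambda>\<omega>. L2_inner \<Omega> (F \<omega>) (\<phi> j)) \<in> borel_measurable P) \<and>
     integrable P (\<lambda>\<omega>. L2_inner \<Omega> (F \<omega>) (F \<omega>))"

lemma L2_rv_process:
  assumes "Z \<in> L2_rv P \<Omega> S"
  shows "L2_process Z"
  unfolding L2_process_def
proof (intro conjI allI ballI)
  have Z: "Z \<in> P \<rightarrow>\<^sub>M L2_borel \<Omega>" using assms by (simp add: L2_rv_def)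
  show "Z \<omega> \<in> L2 \<Omega>" if "\<omega> \<in> space P" for \<omega>
    using measurable_space[OF Z that] by (simp add: space_L2_borel)
  show "(\<lambda>\<omega>. L2_inner \<Omega> (Z \<omega>) (\<phi> j)) \<in> borel_measurable P" for j
    using orthonormal by (intro measurable_compose[OF Z] L2_inner_measurable)
      (auto simp: orthonormal_on_def)
  show "integrable P (\<lambda>\<omega>. L2_inner \<Omega> (Z \<omega>) (Z \<omega>))"
    using assms by (simp add: L2_rv_def L2_norm_power2)
qed

lemma Y_process: "L2_process Y"
  using solution by (auto simp: white_noise_solution_def intro: L2_rv_process)

lemma L2_process_in_L2: "L2_process F \<Longrightarrow> \<omega> \<in> space P \<Longrightarrow> F \<omega> \<in> L2 \<Omega>"
  by (simp add: L2_process_def)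

text \<open>By Parseval the squared norm of the difference is a pointwise limit of sums of squared
  coefficients, hence measurable; integrability follows by domination.\<close>

lemma L2_process_diff:
  assumes F: "L2_process F" and G: "L2_process G"
  shows "L2_process (\<lambda>\<omega> x. F \<omega> x - G \<omega> x)"
proof -
  have L: "(\<lambda>x. F \<omega> x - G \<omega> x) \<in> L2 \<Omega>" if "\<omega> \<in> space P" for \<omega>
    using that F G by (auto simp: L2_process_def intro: L2_diff)
  have [measurable]: "(\<lambda>\<omega>. L2_inner \<Omega> (F \<omega>) (\<phi> j)) \<in> borel_measurable P"
    "(\<lambda>\<omega>. L2_inner \<Omega> (G \<omega>) (\<phi> j)) \<in> borel_measurable P" for j
    using F G by (auto simp: L2_process_def)
  have eq: "L2_inner \<Omega> (\<lambda>x. F \<omega> x - G \<omega> x) (\<phi> j) = L2_inner \<Omega> (F \<omega>) (\<phi> j) - L2_inner \<Omega> (G \<omega>) (\<phi> j)"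
    if "\<omega> \<in> space P" for \<omega> j
    using that F G \<phi>_L2 by (auto simp: L2_process_def L2_inner_diff_left)
  have m: "(\<lambda>\<omega>. L2_inner \<Omega> (\<lambda>x. F \<omega> x - G \<omega> x) (\<phi> j)) \<in> borel_measurable P" for j
    by (subst measurable_cong[OF eq]) auto
  let ?d = "\<lambda>\<omega>. L2_inner \<Omega> (\<lambda>x. F \<omega> x - G \<omega> x) (\<lambda>x. F \<omega> x - G \<omega> x)"
  have "?d \<in> borel_measurable P"
  proof (rule borel_measurable_LIMSEQ_real)
    show "(\<lambda>n. \<Sum>j<n. (L2_inner \<Omega> (\<lambda>x. F \<omega> x - G \<omega> x) (\<phi> j))\<^sup>2) \<longlonglongrightarrow> ?d \<omega>" if "\<omega> \<in> space P" for \<omega>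
      using parseval[OF orthonormal L[OF that] total[OF L[OF that]]] by (simp add: sums_def)
  qed (use m in measurable)
  moreover have "?d \<omega> \<le> 2 * L2_inner \<Omega> (F \<omega>) (F \<omega>) + 2 * L2_inner \<Omega> (G \<omega>) (G \<omega>)"
    if "\<omega> \<in> space P" for \<omega>
    \<comment> \<open>Middle function 0 and \<epsilon> = 1 give the bound by twice the sum of the
      squared norms.\<close>
    using L2_inner_self_add_le[of "F \<omega>" \<Omega> "\<lambda>_. 0" "G \<omega>" 1] that F G
    by (simp add: L2_process_def L2_inner_def)
  then have "norm (?d \<omega>) \<le> norm (2 * L2_inner \<Omega> (F \<omega>) (F \<omega>) + 2 * L2_inner \<Omega> (G \<omega>) (G \<omega>))"
    if "\<omega> \<in> space P" for \<omega>
    using that by (simp add: L2_inner_self_nonneg)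
  ultimately have "integrable P ?d"
    using F G
    by (intro Bochner_Integration.integrable_bound
        [of P "\<lambda>\<omega>. 2 * L2_inner \<Omega> (F \<omega>) (F \<omega>) + 2 * L2_inner \<Omega> (G \<omega>) (G \<omega>)" ?d])
       (auto simp: L2_process_def intro!: AE_I2)
  then show ?thesis using L m by (auto simp: L2_process_def)
qed

lemma mean_sq_dist_triangle:
  assumes F: "L2_process F" and G: "L2_process G" and H: "L2_process H" and "\<epsilon> > 0"
  shows "mean_sq_dist P \<Omega> F H \<le> (1 + \<epsilon>) * mean_sq_dist P \<Omega> F G + (1 + 1 / \<epsilon>) * mean_sq_dist P \<Omega> G H"
proof -
  have i: "integrable P (\<lambda>\<omega>. L2_inner \<Omega> (\<lambda>x. A \<omega> x - B \<omega> x) (\<lambda>x. A \<omega> x - B \<omega> x))"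
    if "L2_process A" "L2_process B" for A B
    using L2_process_diff[OF that] by (simp add: L2_process_def)
  have "mean_sq_dist P \<Omega> F H \<le> (\<integral>\<omega>. (1 + \<epsilon>) * L2_inner \<Omega> (\<lambda>x. F \<omega> x - G \<omega> x) (\<lambda>x. F \<omega> x - G \<omega> x) +
    (1 + 1 / \<epsilon>) * L2_inner \<Omega> (\<lambda>x. G \<omega> x - H \<omega> x) (\<lambda>x. G \<omega> x - H \<omega> x) \<partial>P)"
    unfolding mean_sq_dist_eq
    using i[OF F H] i[OF F G] i[OF G H] assms
    by (intro integral_mono L2_inner_self_add_le) (auto simp: L2_process_def)
  also have "\<dots> = (1 + \<epsilon>) * mean_sq_dist P \<Omega> F G + (1 + 1 / \<epsilon>) * mean_sq_dist P \<Omega> G H"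
    unfolding mean_sq_dist_eq using i[OF F G] i[OF G H] by simp
  finally show ?thesis .
qed

lemma Y_part_L2: "Y_part n \<omega> \<in> L2 \<Omega>"
  unfolding Y_part_def[abs_def] by (intro L2_lincomb \<phi>_L2)

lemma Y_part_inner: "e \<in> L2 \<Omega> \<Longrightarrow> L2_inner \<Omega> (Y_part n \<omega>) e = (\<Sum>j<n. y j \<omega> * L2_inner \<Omega> (\<phi> j) e)"
  unfolding Y_part_def[abs_def] by (intro L2_inner_lincomb_left \<phi>_L2)

lemma Y_part_self: "L2_inner \<Omega> (Y_part n \<omega>) (Y_part n \<omega>) = (\<Sum>j<n. (y j \<omega>)\<^sup>2)"
  unfolding Y_part_def[abs_def] by (intro orthonormal_self_lincomb \<phi>_orthonormal) auto

lemma Y_part_process: "L2_process (Y_part n)"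
  unfolding L2_process_def Y_part_self
  using y_sq_integrable by (auto simp: Y_part_L2 Y_part_inner \<phi>_L2)

lemma Y_part_tendsto: "(\<lambda>n. mean_sq_dist P \<Omega> (Y_part n) Y) \<longlonglongrightarrow> 0"
  using solution unfolding mean_sq_dist_commute[of P \<Omega> _ Y]
  by (simp add: white_noise_solution_def Y_part_def[abs_def] y_def[abs_def])

text \<open>Two limits in this order: \<open>m\<close> to infinity with \<epsilon> fixed, which
  removes the term with the factor 1 + 1/\<epsilon>, and then \<epsilon> to 0.\<close>

lemma le_limit_mean_sq_dist:
  assumes F: "L2_process F" and le: "\<And>m. m \<ge> n \<Longrightarrow> a \<le> mean_sq_dist P \<Omega> F (Y_part m)"
  shows "a \<le> mean_sq_dist P \<Omega> F Y"
proof (rule le_of_le_one_plus_mult)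
  fix \<epsilon> :: real assume \<epsilon>: "\<epsilon> > 0"
  have "a \<le> (1 + \<epsilon>) * mean_sq_dist P \<Omega> F Y + (1 + 1 / \<epsilon>) * mean_sq_dist P \<Omega> (Y_part m) Y"
    if "m \<ge> n" for m
    using le[OF that] mean_sq_dist_triangle[OF F Y_process Y_part_process \<epsilon>, of m]
    by (simp add: mean_sq_dist_commute)
  moreover have "(\<lambda>m. (1 + \<epsilon>) * mean_sq_dist P \<Omega> F Y + (1 + 1 / \<epsilon>) * mean_sq_dist P \<Omega> (Y_part m) Y)
      \<longlonglongrightarrow> (1 + \<epsilon>) * mean_sq_dist P \<Omega> F Y + (1 + 1 / \<epsilon>) * 0"
    by (intro tendsto_intros Y_part_tendsto)
  ultimately show "a \<le> (1 + \<epsilon>) * mean_sq_dist P \<Omega> F Y"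
    by (intro tendsto_lowerbound[where F = sequentially and
        f = "\<lambda>m. (1 + \<epsilon>) * mean_sq_dist P \<Omega> F Y + (1 + 1 / \<epsilon>) * mean_sq_dist P \<Omega> (Y_part m) Y"])
       (auto simp: eventually_sequentially)
qed

lemma limit_mean_sq_dist_le:
  assumes F: "L2_process F" and le: "\<And>m. m \<ge> n \<Longrightarrow> mean_sq_dist P \<Omega> F (Y_part m) \<le> a"
  shows "mean_sq_dist P \<Omega> F Y \<le> a"
proof (rule le_of_le_one_plus_mult)
  fix \<epsilon> :: real assume \<epsilon>: "\<epsilon> > 0"
  have "mean_sq_dist P \<Omega> F Y \<le> (1 + \<epsilon>) * a + (1 + 1 / \<epsilon>) * mean_sq_dist P \<Omega> (Y_part m) Y"
    if "m \<ge> n" for m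
  proof -
    have "mean_sq_dist P \<Omega> F Y \<le> (1 + \<epsilon>) * mean_sq_dist P \<Omega> F (Y_part m) +
        (1 + 1 / \<epsilon>) * mean_sq_dist P \<Omega> (Y_part m) Y"
      by (rule mean_sq_dist_triangle[OF F Y_part_process Y_process \<epsilon>])
    moreover have "(1 + \<epsilon>) * mean_sq_dist P \<Omega> F (Y_part m) \<le> (1 + \<epsilon>) * a"
      using le[OF that] \<epsilon> by (intro mult_left_mono) auto
    ultimately show ?thesis by linarith
  qed
  moreover have "(\<lambda>m. (1 + \<epsilon>) * a + (1 + 1 / \<epsilon>) * mean_sq_dist P \<Omega> (Y_part m) Y)
      \<longlonglongrightarrow> (1 + \<epsilon>) * a + (1 + 1 / \<epsilon>) * 0"
    by (intro tendsto_intros Y_part_tendsto)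
  ultimately show "mean_sq_dist P \<Omega> F Y \<le> (1 + \<epsilon>) * a"
    by (intro tendsto_lowerbound[where F = sequentially and
        f = "\<lambda>m. (1 + \<epsilon>) * a + (1 + 1 / \<epsilon>) * mean_sq_dist P \<Omega> (Y_part m) Y"])
       (auto simp: eventually_sequentially)
qed

text \<open>For each \<omega> the squared distance to \<open>Z \<omega>\<close> is at least the
  squared distance to the span of \<open>u\<close>, in which \<open>Z\<close> no longer occurs. So
  nothing is required of the joint law of \<open>Z\<close> and the noise.\<close>

lemma mean_sq_dist_Y_part_ge:
  assumes u: "orthonormal_on \<Omega> u {..<M}" "M \<le> N" and Z: "L2_process Z"
    and span: "\<And>\<omega>. \<omega> \<in> space P \<Longrightarrow> \<exists>c. AE x in lebesgue_on \<Omega>. Z \<omega> x = (\<Sum>k<M. c k * u k x)"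
  shows "(\<Sum>j=N..<n. 1 / (lam j)\<^sup>2) \<le> mean_sq_dist P \<Omega> Z (Y_part n)"
proof -
  have uL: "\<And>k. k < M \<Longrightarrow> u k \<in> L2 \<Omega>" using u by (auto simp: orthonormal_on_def)
  define w where "w j = (\<Sum>k<M. (L2_inner \<Omega> (\<phi> j) (u k))\<^sup>2)" for j
  have w0: "0 \<le> w j" for j by (simp add: w_def sum_nonneg)
  have w1: "w j \<le> 1" for j
    using bessel[OF u(1) _ \<phi>_L2[of j]] orthonormal by (simp add: w_def orthonormal_on_def)
  \<comment> \<open>Bessel with exchanged roles: now \<open>u k\<close> is expanded in
    \<open>\<phi>\<close>. Summation over \<open>k\<close> bounds the total weight by
    \<open>M\<close>, hence by \<open>N\<close>.\<close>
  have "(\<Sum>j<n. (L2_inner \<Omega> (\<phi> j) (u k))\<^sup>2) \<le> 1" if "k < M" for k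
    using bessel[OF \<phi>_orthonormal, of "{..<n}" "u k"] uL[OF that] orthonormal_onD(2)[OF u(1), of k k] that
    unfolding L2_inner_commute[of \<Omega> "\<phi> j" "u k" for j] by simp
  then have "(\<Sum>k<M. \<Sum>j<n. (L2_inner \<Omega> (\<phi> j) (u k))\<^sup>2) \<le> (\<Sum>k<M. 1)" by (intro sum_mono) auto
  then have ws: "(\<Sum>j<n. w j) \<le> real N"
    unfolding w_def using u(2) by (subst sum.swap) simp
  have "(\<Sum>j=N..<n. 1 / (lam j)\<^sup>2) \<le> (\<Sum>j<n. 1 / (lam j)\<^sup>2 * (1 - w j))"
  proof (rule antimono_weighted_sum_ge[OF _ _ w0 w1 ws])
    show "antimono (\<lambda>j. 1 / (lam j)\<^sup>2)"
      using lam_pos lam_mono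
      by (auto intro!: antimonoI divide_left_mono power_mono mult_pos_pos zero_less_power
          simp: monoD less_imp_le)
  qed auto
  \<comment> \<open>The integrand is the squared norm of \<open>Y_part n \<omega>\<close> minus that
    of its projection onto the span of \<open>u\<close>; mixed products of the \<open>y j\<close>
    have mean 0.\<close>
  also have "\<dots> = (\<integral>\<omega>. (\<Sum>j<n. (y j \<omega>)\<^sup>2) - (\<Sum>k<M. (\<Sum>j<n. y j \<omega> * L2_inner \<Omega> (\<phi> j) (u k))\<^sup>2) \<partial>P)"
  proof -
    have "(\<integral>\<omega>. (y j \<omega>)\<^sup>2 \<partial>P) = 1 / (lam j)\<^sup>2" for j
      using y_prod_integral[of j j] by (simp add: power2_eq_square)
    moreover have "(\<Sum>j<n. 1 / (lam j)\<^sup>2 * w j) =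
        (\<Sum>k<M. \<Sum>j<n. 1 / (lam j)\<^sup>2 * (L2_inner \<Omega> (\<phi> j) (u k))\<^sup>2)"
      unfolding w_def sum_distrib_left by (rule sum.swap)
    ultimately show ?thesis
      by (simp add: y_sq_integrable lincomb_y_sq right_diff_distrib sum_subtractf)
  qed
  also have "\<dots> \<le> mean_sq_dist P \<Omega> (Y_part n) Z"
    unfolding mean_sq_dist_eq
  proof (rule integral_mono)
    show "integrable P (\<lambda>\<omega>. (\<Sum>j<n. (y j \<omega>)\<^sup>2) - (\<Sum>k<M. (\<Sum>j<n. y j \<omega> * L2_inner \<Omega> (\<phi> j) (u k))\<^sup>2))"
      using y_sq_integrable lincomb_y_sq(1) by simp
    show "integrable P (\<lambda>\<omega>. L2_inner \<Omega> (\<lambda>x. Y_part n \<omega> x - Z \<omega> x) (\<lambda>x. Y_part n \<omega> x - Z \<omega> x))"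
      using L2_process_diff[OF Y_part_process Z] by (simp add: L2_process_def)
    fix \<omega> assume \<omega>: "\<omega> \<in> space P"
    obtain c where c: "AE x in lebesgue_on \<Omega>. Z \<omega> x = (\<Sum>k<M. c k * u k x)" using span[OF \<omega>] by auto
    have "L2_inner \<Omega> (\<lambda>x. Y_part n \<omega> x - Z \<omega> x) (\<lambda>x. Y_part n \<omega> x - Z \<omega> x) =
      L2_inner \<Omega> (\<lambda>x. Y_part n \<omega> x - (\<Sum>k<M. c k * u k x)) (\<lambda>x. Y_part n \<omega> x - (\<Sum>k<M. c k * u k x))"
      using c L2_process_in_L2[OF Z \<omega>] uL
      by (intro L2_inner_cong_AE L2_diff L2_lincomb Y_part_L2) auto
    also have "\<dots> \<ge> (\<Sum>j<n. (y j \<omega>)\<^sup>2) - (\<Sum>k<M. (\<Sum>j<n. y j \<omega> * L2_inner \<Omega> (\<phi> j) (u k))\<^sup>2)"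
      using bessel_lincomb[OF u(1) _ Y_part_L2, of n \<omega> c] uL by (simp add: Y_part_self Y_part_inner)
    finally show "(\<Sum>j<n. (y j \<omega>)\<^sup>2) - (\<Sum>k<M. (\<Sum>j<n. y j \<omega> * L2_inner \<Omega> (\<phi> j) (u k))\<^sup>2) \<le>
      L2_inner \<Omega> (\<lambda>x. Y_part n \<omega> x - Z \<omega> x) (\<lambda>x. Y_part n \<omega> x - Z \<omega> x)" .
  qed
  finally show ?thesis by (simp add: mean_sq_dist_commute)
qed

text \<open>Phrased with a spanning family of at most \<open>N\<close> functions, so that it covers
  both arbitrary subspaces and \<open>dg_space\<close>, and with finite sums, so that summability of
  the tail can be deduced from it.\<close>

lemma mean_sq_dist_ge_partial_sum:
  assumes I: "finite I" "card I \<le> N" "\<And>i. i \<in> I \<Longrightarrow> e i \<in> L2 \<Omega>" and Z: "L2_process Z"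
    and span: "\<And>\<omega>. \<omega> \<in> space P \<Longrightarrow> \<exists>c. AE x in lebesgue_on \<Omega>. Z \<omega> x = (\<Sum>i\<in>I. c i * e i x)"
  shows "(\<Sum>j=N..<n. 1 / (lam j)\<^sup>2) \<le> mean_sq_dist P \<Omega> Y Z"
proof -
  obtain u M where u: "M \<le> card I" "orthonormal_on \<Omega> u {..<M}"
    "\<And>i. i \<in> I \<Longrightarrow> \<exists>c. AE x in lebesgue_on \<Omega>. e i x = (\<Sum>k<M. c k * u k x)"
    by (rule gram_schmidt[OF I(1,3)]) blast+
  have sp: "\<exists>c. AE x in lebesgue_on \<Omega>. Z \<omega> x = (\<Sum>k<M. c k * u k x)" if "\<omega> \<in> space P" for \<omega>
  proof -
    obtain a where a: "AE x in lebesgue_on \<Omega>. Z \<omega> x = (\<Sum>i\<in>I. a i * e i x)" using span[OF \<open>\<omega> \<in> space P\<close>] by auto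
    obtain c where "AE x in lebesgue_on \<Omega>. (\<Sum>i\<in>I. a i * e i x) = (\<Sum>k<M. c k * u k x)"
      using AE_lincomb_of_lincombs[where e = e and u = u and a = a, OF I(1) u(3)] by auto
    with a have "AE x in lebesgue_on \<Omega>. Z \<omega> x = (\<Sum>k<M. c k * u k x)" by eventually_elim simp
    then show ?thesis by blast
  qed
  have "(\<Sum>j=N..<n. 1 / (lam j)\<^sup>2) \<le> mean_sq_dist P \<Omega> Z Y"
  proof (rule le_limit_mean_sq_dist[OF Z])
    fix m assume "n \<le> m"
    then have "(\<Sum>j=N..<n. 1 / (lam j)\<^sup>2) \<le> (\<Sum>j=N..<m. 1 / (lam j)\<^sup>2)"
      by (intro sum_mono2) auto
    also have "\<dots> \<le> mean_sq_dist P \<Omega> Z (Y_part m)"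
      using u(1) I(2) by (intro mean_sq_dist_Y_part_ge[OF u(2) _ Z sp]) auto
    finally show "(\<Sum>j=N..<n. 1 / (lam j)\<^sup>2) \<le> mean_sq_dist P \<Omega> Z (Y_part m)" .
  qed
  then show ?thesis by (simp add: mean_sq_dist_commute)
qed

text \<open>Approximating by 0, with the empty spanning family and \<open>N = 0\<close>, shows that
  all partial sums are at most the second moment of \<open>Y\<close>. No growth law for
  \<open>lam\<close> enters.\<close>

lemma summable_inverse_sq: "summable (\<lambda>j. 1 / (lam j)\<^sup>2)"
proof (rule summableI_nonneg_bounded)
  have "L2_process (\<lambda>_ _. 0)" by (simp add: L2_process_def L2_inner_def)
  then show "(\<Sum>j<n. 1 / (lam j)\<^sup>2) \<le> mean_sq_dist P \<Omega> Y (\<lambda>_ _. 0)" for n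
    using mean_sq_dist_ge_partial_sum[of "{}" 0 "\<lambda>_. undefined" "\<lambda>_ _. 0" n]
    by (simp add: atLeast0LessThan)
qed auto

lemma mean_sq_dist_ge_tail:
  assumes S: "L2_subspace_of_dim \<Omega> S N" and Z: "Z \<in> L2_rv P \<Omega> S"
  shows "(\<Sum>j. 1 / (lam (N + j))\<^sup>2) \<le> mean_sq_dist P \<Omega> Y Z"
proof (rule suminf_le_const)
  show "summable (\<lambda>j. 1 / (lam (N + j))\<^sup>2)"
    using summable_inverse_sq summable_iff_shift[of "\<lambda>j. 1 / (lam j)\<^sup>2" N] by (simp add: add.commute)
  obtain e where e: "\<And>i. i < N \<Longrightarrow> e i \<in> L2 \<Omega>" "S = L2_span \<Omega> e N"
    using S unfolding L2_subspace_of_dim_def by blast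
  have "(\<Sum>j=N..<N+n. 1 / (lam j)\<^sup>2) \<le> mean_sq_dist P \<Omega> Y Z" for n
    using Z e by (intro mean_sq_dist_ge_partial_sum[of "{..<N}" N e] L2_rv_process[OF Z])
      (auto simp: L2_rv_def L2_span_def)
  moreover have "(\<Sum>j=N..<N+n. 1 / (lam j)\<^sup>2) = (\<Sum>j<n. 1 / (lam (N + j))\<^sup>2)" for n
    by (rule sum.reindex_bij_witness[of _ "\<lambda>j. N + j" "\<lambda>j. j - N"]) auto
  ultimately show "(\<Sum>j<n. 1 / (lam (N + j))\<^sup>2) \<le> mean_sq_dist P \<Omega> Y Z" for n by simp
qed

text \<open>Up to sign, \<open>Y_part N - Y_part m\<close> is the block of the series from
  \<open>N\<close> to \<open>m\<close>; its mean squared norm is the corresponding block of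
  variances, which the tail dominates for every \<open>m\<close>.\<close>

lemma mean_sq_dist_Y_part_le: "mean_sq_dist P \<Omega> (Y_part N) Y \<le> (\<Sum>j. 1 / (lam (N + j))\<^sup>2)"
proof (rule limit_mean_sq_dist_le[OF Y_part_process])
  fix m assume m: "m \<ge> N"
  have "L2_inner \<Omega> (\<lambda>x. Y_part N \<omega> x - Y_part m \<omega> x) (\<lambda>x. Y_part N \<omega> x - Y_part m \<omega> x) =
      (\<Sum>j=N..<m. (y j \<omega>)\<^sup>2)" for \<omega>
  proof -
    have "Y_part m \<omega> x = Y_part N \<omega> x + (\<Sum>j=N..<m. y j \<omega> * \<phi> j x)" for x
      using m sum.atLeastLessThan_concat[of 0 N m "\<lambda>j. y j \<omega> * \<phi> j x"]
      by (simp add: Y_part_def atLeast0LessThan)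
    then have *: "(\<lambda>x. Y_part N \<omega> x - Y_part m \<omega> x) = (\<lambda>x. \<Sum>j=N..<m. (- y j \<omega>) * \<phi> j x)"
      by (simp add: sum_negf)
    show ?thesis
      using orthonormal_self_lincomb[OF \<phi>_orthonormal, of "{N..<m}" "\<lambda>j. - y j \<omega>"] unfolding * by simp
  qed
  then have "mean_sq_dist P \<Omega> (Y_part N) (Y_part m) = (\<Sum>j=N..<m. 1 / (lam j)\<^sup>2)"
    unfolding mean_sq_dist_eq using y_sq_integrable y_prod_integral by (simp add: power2_eq_square)
  also have "\<dots> = (\<Sum>j<m-N. 1 / (lam (N + j))\<^sup>2)"
    by (rule sum.reindex_bij_witness[of _ "\<lambda>j. N + j" "\<lambda>j. j - N"]) auto
  also have "\<dots> \<le> (\<Sum>j. 1 / (lam (N + j))\<^sup>2)"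
    using summable_inverse_sq summable_iff_shift[of "\<lambda>j. 1 / (lam j)\<^sup>2" N]
    by (intro sum_le_suminf) (auto simp: add.commute)
  finally show "mean_sq_dist P \<Omega> (Y_part N) (Y_part m) \<le> (\<Sum>j. 1 / (lam (N + j))\<^sup>2)" .
qed

lemma span_\<phi>_dim: "L2_subspace_of_dim \<Omega> (L2_span \<Omega> \<phi> N) N"
  unfolding L2_subspace_of_dim_def
proof (intro exI[of _ \<phi>] conjI allI impI \<phi>_L2 refl)
  fix c :: "nat \<Rightarrow> real" and i
  assume "AE x in lebesgue_on \<Omega>. (\<Sum>i<N. c i * \<phi> i x) = 0" and i: "i < N"
  then have "L2_inner \<Omega> (\<lambda>x. \<Sum>i<N. c i * \<phi> i x) (\<phi> i) = L2_inner \<Omega> (\<lambda>x. 0) (\<phi> i)"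
    by (intro L2_inner_cong_AE L2_lincomb \<phi>_L2) auto
  then show "c i = 0"
    using orthonormal_inner_lincomb[OF \<phi>_orthonormal, of "{..<N}" i c] i by (simp add: L2_inner_def)
qed

text \<open>\<open>Z\<close> need not be identified with \<open>Y_part N\<close>. The latter is
  another element of the span, with an error already bounded by the tail, and by Pythagoras the
  projection is at least as good; the reverse bound is the general one.\<close>

lemma optimal_projection:
  assumes Z: "Z \<in> L2_rv P \<Omega> (L2_span \<Omega> \<phi> N)"
    and proj: "AE \<omega> in P. L2_orth_proj \<Omega> (L2_span \<Omega> \<phi> N) (Y \<omega>) (Z \<omega>)"
  shows "mean_sq_dist P \<Omega> Y Z = (\<Sum>j. 1 / (lam (N + j))\<^sup>2)"
proof (rule antisym)
  note Zp = L2_rv_process[OF Z]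
  have int: "integrable P (\<lambda>\<omega>. L2_inner \<Omega> (\<lambda>x. A \<omega> x - B \<omega> x) (\<lambda>x. A \<omega> x - B \<omega> x))"
    if "L2_process A" "L2_process B" for A B
    using L2_process_diff[OF that] by (simp add: L2_process_def)
  have "mean_sq_dist P \<Omega> Y Z \<le> mean_sq_dist P \<Omega> Y (Y_part N)"
    unfolding mean_sq_dist_eq
  proof (rule integral_mono_AE[OF int[OF Y_process Zp] int[OF Y_process Y_part_process]])
    show "AE \<omega> in P. L2_inner \<Omega> (\<lambda>x. Y \<omega> x - Z \<omega> x) (\<lambda>x. Y \<omega> x - Z \<omega> x)
      \<le> L2_inner \<Omega> (\<lambda>x. Y \<omega> x - Y_part N \<omega> x) (\<lambda>x. Y \<omega> x - Y_part N \<omega> x)"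
      using proj
    proof (rule AE_mp, intro AE_I2 impI)
      fix \<omega> assume \<omega>: "\<omega> \<in> space P" and "L2_orth_proj \<Omega> (L2_span \<Omega> \<phi> N) (Y \<omega>) (Z \<omega>)"
      then have orth: "\<And>s. s \<in> L2_span \<Omega> \<phi> N \<Longrightarrow> L2_inner \<Omega> (\<lambda>x. Y \<omega> x - Z \<omega> x) s = 0"
        and ZS: "Z \<omega> \<in> L2_span \<Omega> \<phi> N"
        by (auto simp: L2_orth_proj_def)
      have s: "Y_part N \<omega> \<in> L2_span \<Omega> \<phi> N"
        using Y_part_L2[of N \<omega>] by (auto simp: L2_span_def Y_part_def)
      note L = L2_process_in_L2[OF Y_process \<omega>] L2_process_in_L2[OF Zp \<omega>] Y_part_L2[of N \<omega>]
      have "L2_inner \<Omega> (\<lambda>x. Y \<omega> x - Y_part N \<omega> x) (\<lambda>x. Y \<omega> x - Y_part N \<omega> x) =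
        L2_inner \<Omega> (\<lambda>x. (Y \<omega> x - Z \<omega> x) - (Y_part N \<omega> x - Z \<omega> x))
          (\<lambda>x. (Y \<omega> x - Z \<omega> x) - (Y_part N \<omega> x - Z \<omega> x))"
        by simp
      also have "\<dots> = L2_inner \<Omega> (\<lambda>x. Y \<omega> x - Z \<omega> x) (\<lambda>x. Y \<omega> x - Z \<omega> x)
        - 2 * L2_inner \<Omega> (\<lambda>x. Y \<omega> x - Z \<omega> x) (\<lambda>x. Y_part N \<omega> x - Z \<omega> x)
        + L2_inner \<Omega> (\<lambda>x. Y_part N \<omega> x - Z \<omega> x) (\<lambda>x. Y_part N \<omega> x - Z \<omega> x)"
        by (intro L2_inner_self_diff L2_diff L)
      also have "L2_inner \<Omega> (\<lambda>x. Y \<omega> x - Z \<omega> x) (\<lambda>x. Y_part N \<omega> x - Z \<omega> x) = 0"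
        using orth[OF s] orth[OF ZS] L by (simp add: L2_inner_diff_right L2_diff)
      finally show "L2_inner \<Omega> (\<lambda>x. Y \<omega> x - Z \<omega> x) (\<lambda>x. Y \<omega> x - Z \<omega> x)
        \<le> L2_inner \<Omega> (\<lambda>x. Y \<omega> x - Y_part N \<omega> x) (\<lambda>x. Y \<omega> x - Y_part N \<omega> x)"
        using L2_inner_self_nonneg[of \<Omega> "\<lambda>x. Y_part N \<omega> x - Z \<omega> x"] by simp
    qed
  qed
  then show "mean_sq_dist P \<Omega> Y Z \<le> (\<Sum>j. 1 / (lam (N + j))\<^sup>2)"
    using mean_sq_dist_Y_part_le[of N] by (simp add: mean_sq_dist_commute)
  show "(\<Sum>j. 1 / (lam (N + j))\<^sup>2) \<le> mean_sq_dist P \<Omega> Y Z"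
    by (rule mean_sq_dist_ge_tail[OF span_\<phi>_dim Z])
qed

text \<open>The truncated Fourier expansion \<open>T\<close> of \<open>Y \<omega>\<close> itself is
  used. By Bessel \<open>T\<close> is a contraction, which yields measurability into
  \<open>L2_borel\<close> and integrability of the squared norm.\<close>

lemma projection_exists:
  "\<exists>Z \<in> L2_rv P \<Omega> (L2_span \<Omega> \<phi> N). AE \<omega> in P. L2_orth_proj \<Omega> (L2_span \<Omega> \<phi> N) (Y \<omega>) (Z \<omega>)"
proof -
  define T where "T f = (\<lambda>x. \<Sum>j<N. L2_inner \<Omega> f (\<phi> j) * \<phi> j x)" for f
  have TL: "T f \<in> L2 \<Omega>" for f
    unfolding T_def by (intro L2_lincomb \<phi>_L2)
  have T_self: "L2_inner \<Omega> (T f) (T f) \<le> L2_inner \<Omega> f f" if "f \<in> L2 \<Omega>" for f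
    unfolding T_def using bessel[OF \<phi>_orthonormal _ that, of "{..<N}"]
    by (subst orthonormal_self_lincomb[OF \<phi>_orthonormal]) auto
  have T_diff: "(\<lambda>x. T f x - T g x) = T (\<lambda>x. f x - g x)" if "f \<in> L2 \<Omega>" "g \<in> L2 \<Omega>" for f g
    using that by (simp add: T_def L2_inner_diff_left \<phi>_L2 left_diff_distrib sum_subtractf)
  have T: "T \<in> L2_borel \<Omega> \<rightarrow>\<^sub>M L2_borel \<Omega>"
  proof (rule L2_nonexpansive_measurable[OF TL])
    fix f g assume "f \<in> L2 \<Omega>" "g \<in> L2 \<Omega>"
    then show "L2_norm \<Omega> (\<lambda>x. T f x - T g x) \<le> L2_norm \<Omega> (\<lambda>x. f x - g x)"
      by (simp add: T_diff L2_norm_def T_self L2_diff)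
  qed
  have YL: "Y \<omega> \<in> L2 \<Omega>" if "\<omega> \<in> space P" for \<omega>
    using L2_process_in_L2[OF Y_process that] .
  have span: "T f \<in> L2_span \<Omega> \<phi> N" for f
    using TL[of f] by (auto simp: L2_span_def T_def)
  have Ym: "Y \<in> P \<rightarrow>\<^sub>M L2_borel \<Omega>" using solution by (simp add: white_noise_solution_def L2_rv_def)
  have "(\<lambda>\<omega>. L2_inner \<Omega> (T (Y \<omega>)) (T (Y \<omega>))) = (\<lambda>\<omega>. \<Sum>j<N. (L2_inner \<Omega> (Y \<omega>) (\<phi> j))\<^sup>2)"
    by (simp add: T_def orthonormal_self_lincomb[OF \<phi>_orthonormal])
  moreover have "(\<lambda>\<omega>. \<Sum>j<N. (L2_inner \<Omega> (Y \<omega>) (\<phi> j))\<^sup>2) \<in> borel_measurable P"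
    using Y_process unfolding L2_process_def by (intro borel_measurable_sum borel_measurable_power) auto
  ultimately have meas: "(\<lambda>\<omega>. L2_inner \<Omega> (T (Y \<omega>)) (T (Y \<omega>))) \<in> borel_measurable P"
    by (simp only:)
  have "integrable P (\<lambda>\<omega>. L2_inner \<Omega> (T (Y \<omega>)) (T (Y \<omega>)))"
  proof (rule Bochner_Integration.integrable_bound[OF _ meas])
    show "integrable P (\<lambda>\<omega>. L2_inner \<Omega> (Y \<omega>) (Y \<omega>))"
      using Y_process by (simp add: L2_process_def)
    show "AE \<omega> in P. norm (L2_inner \<Omega> (T (Y \<omega>)) (T (Y \<omega>))) \<le> norm (L2_inner \<Omega> (Y \<omega>) (Y \<omega>))"
      using T_self[OF YL] by (intro AE_I2) (simp add: L2_inner_self_nonneg)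
  qed
  then have "(\<lambda>\<omega>. T (Y \<omega>)) \<in> L2_rv P \<Omega> (L2_span \<Omega> \<phi> N)"
    using span measurable_compose[OF Ym T] by (simp add: L2_rv_def L2_norm_power2)
  moreover have "L2_orth_proj \<Omega> (L2_span \<Omega> \<phi> N) (Y \<omega>) (T (Y \<omega>))" if \<omega>: "\<omega> \<in> space P" for \<omega>
    unfolding L2_orth_proj_def
  proof (intro conjI span ballI)
    fix s assume "s \<in> L2_span \<Omega> \<phi> N"
    then obtain c where s: "s \<in> L2 \<Omega>" "AE x in lebesgue_on \<Omega>. s x = (\<Sum>j<N. c j * \<phi> j x)"
      by (auto simp: L2_span_def)
    have d: "(\<lambda>x. Y \<omega> x - T (Y \<omega>) x) \<in> L2 \<Omega>" by (intro L2_diff YL \<omega> TL)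
    have "L2_inner \<Omega> (\<lambda>x. Y \<omega> x - T (Y \<omega>) x) (\<phi> j) = 0" if "j < N" for j
      using that YL[OF \<omega>] TL[of "Y \<omega>"] orthonormal_inner_lincomb[OF \<phi>_orthonormal, of "{..<N}" j]
      by (simp add: L2_inner_diff_left \<phi>_L2 T_def)
    then have "L2_inner \<Omega> (\<lambda>x. Y \<omega> x - T (Y \<omega>) x) (\<lambda>x. \<Sum>j<N. c j * \<phi> j x) = 0"
      using d by (simp add: L2_inner_lincomb_right \<phi>_L2)
    moreover have "L2_inner \<Omega> (\<lambda>x. Y \<omega> x - T (Y \<omega>) x) s =
        L2_inner \<Omega> (\<lambda>x. Y \<omega> x - T (Y \<omega>) x) (\<lambda>x. \<Sum>j<N. c j * \<phi> j x)"
      using s d by (intro L2_inner_cong_AE L2_lincomb \<phi>_L2) auto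
    ultimately show "L2_inner \<Omega> (\<lambda>x. Y \<omega> x - T (Y \<omega>) x) s = 0" by simp
  qed
  ultimately show ?thesis
    by (intro bexI[of _ "\<lambda>\<omega>. T (Y \<omega>)"] AE_I2)
qed

end


section \<open>Smooth bump functions\<close>

text \<open>Existence of \<open>n\<close> successive derivatives everywhere. Continuity of the last
  one is not demanded, which makes no difference once all \<open>n\<close> are taken in
  \<open>Cinf\<close>.\<close>

fun Cdiff :: "nat \<Rightarrow> (real \<Rightarrow> real) \<Rightarrow> bool" where
  "Cdiff 0 f \<longleftrightarrow> True"
| "Cdiff (Suc n) f \<longleftrightarrow> (\<exists>f'. (\<forall>x. (f has_real_derivative f' x) (at x)) \<and> Cdiff n f')"

definition Cinf :: "(real \<Rightarrow> real) \<Rightarrow> bool" where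
  "Cinf f \<longleftrightarrow> (\<forall>n. Cdiff n f)"

text \<open>The product rule pairs a derivative, of order \<open>n\<close>, with an undifferentiated
  factor of order \<open>Suc n\<close>, whose order must be lowered before the induction hypothesis
  applies.\<close>

lemma Cdiff_Suc_imp: "Cdiff (Suc n) f \<Longrightarrow> Cdiff n f"
proof (induction n arbitrary: f)
  case (Suc n)
  then obtain f' where f': "\<forall>x. (f has_real_derivative f' x) (at x)" "Cdiff (Suc n) f'"
    by (auto simp del: Cdiff.simps(2) simp: Cdiff.simps(2)[of "Suc n" f])
  then show ?case using Suc.IH by auto
qed simp

lemma Cdiff_add: "Cdiff n f \<Longrightarrow> Cdiff n g \<Longrightarrow> Cdiff n (\<lambda>x. f x + g x)"
proof (induction n arbitrary: f g)
  case (Suc n)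
  then obtain f' g' where "\<forall>x. (f has_real_derivative f' x) (at x)" "Cdiff n f'"
    "\<forall>x. (g has_real_derivative g' x) (at x)" "Cdiff n g'" by auto
  then show ?case using Suc.IH
    by (auto intro!: exI[of _ "\<lambda>x. f' x + g' x"] derivative_eq_intros)
qed simp

lemma Cdiff_mult: "Cdiff n f \<Longrightarrow> Cdiff n g \<Longrightarrow> Cdiff n (\<lambda>x. f x * g x)"
proof (induction n arbitrary: f g)
  case (Suc n)
  then obtain f' g' where *: "\<forall>x. (f has_real_derivative f' x) (at x)" "Cdiff n f'"
    "\<forall>x. (g has_real_derivative g' x) (at x)" "Cdiff n g'" by auto
  have "Cdiff n (\<lambda>x. f' x * g x + f x * g' x)"
    using * Suc Cdiff_Suc_imp by (intro Cdiff_add Suc.IH) blast+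
  moreover have "\<forall>x. ((\<lambda>x. f x * g x) has_real_derivative f' x * g x + f x * g' x) (at x)"
    using * by (auto intro!: derivative_eq_intros)
  ultimately show ?case by auto
qed simp

lemma Cdiff_const: "Cdiff n (\<lambda>x. c)"
proof (induction n arbitrary: c)
  case (Suc n)
  then show ?case by (auto intro!: exI[of _ "\<lambda>_. 0"])
qed simp

lemma Cdiff_affine: "Cdiff n f \<Longrightarrow> Cdiff n (\<lambda>x. f (a * x + b))"
proof (induction n arbitrary: f)
  case (Suc n)
  then obtain f' where *: "\<forall>x. (f has_real_derivative f' x) (at x)" "Cdiff n f'" by auto
  have "((\<lambda>x. f (a * x + b)) has_real_derivative a * f' (a * x + b)) (at x)" for x
  proof -
    have "((\<lambda>x. a * x + b) has_real_derivative a) (at x)" by (auto intro!: derivative_eq_intros)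
    from DERIV_chain2[OF _ this, of f "f' (a * x + b)"] *(1) show ?thesis by (simp add: mult.commute)
  qed
  moreover have "Cdiff n (\<lambda>x. a * f' (a * x + b))"
    using * Suc by (intro Cdiff_mult Cdiff_const Suc.IH)
  ultimately show ?case
    unfolding Cdiff.simps by (intro exI[of _ "\<lambda>x. a * f' (a * x + b)"]) blast
qed simp

lemma Cinf_mult: "Cinf f \<Longrightarrow> Cinf g \<Longrightarrow> Cinf (\<lambda>x. f x * g x)"
  by (simp add: Cinf_def Cdiff_mult)

lemma Cinf_affine: "Cinf f \<Longrightarrow> Cinf (\<lambda>x. f (a * x + b))"
  by (simp add: Cinf_def Cdiff_affine)

lemma Cinf_derivative:
  assumes "Cinf f"
  shows "(f has_real_derivative deriv f x) (at x)" and "Cinf (deriv f)"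
proof -
  have "\<exists>f'. (\<forall>x. (f has_real_derivative f' x) (at x)) \<and> Cdiff n f'" for n
    using assms by (metis Cinf_def Cdiff.simps(2))
  then have *: "(\<forall>x. (f has_real_derivative deriv f x) (at x)) \<and> Cdiff n (deriv f)" for n
    by (metis DERIV_imp_deriv ext)
  then show "(f has_real_derivative deriv f x) (at x)" by blast
  show "Cinf (deriv f)" using * by (simp add: Cinf_def)
qed

text \<open>The classical function exp(-1/x), extended by 0, with a polynomial in 1/x as prefactor:
  these prefactors make the family closed under differentiation.\<close>

definition flat_exp :: "real poly \<Rightarrow> real \<Rightarrow> real" where
  "flat_exp p x = (if x > 0 then poly p (1 / x) * exp (- (1 / x)) else 0)"

lemma tendsto_poly_mult_exp_minus: "((\<lambda>t. poly p t * exp (- t)) \<longlongrightarrow> (0::real)) at_top"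
proof -
  have "((\<lambda>t. \<Sum>i\<le>degree p. coeff p i * (t ^ i / exp t)) \<longlongrightarrow> (\<Sum>i\<le>degree p. coeff p i * 0)) at_top"
    by (intro tendsto_intros tendsto_power_div_exp_0)
  then show ?thesis
    by (simp add: poly_altdef exp_minus sum_distrib_left field_simps)
qed

text \<open>With t = 1/x the derivative of p(t) exp(-t) in x is t^2 (p - p')(t) exp(-t), which
  explains the new polynomial.\<close>

lemma flat_exp_has_derivative:
  "(flat_exp p has_real_derivative flat_exp (monom 1 2 * (p - pderiv p)) x) (at x)"
proof -
  consider "x > 0" | "x < 0" | "x = 0" by linarith
  then show ?thesis
  proof cases
    case 1
    have "((\<lambda>x. poly p (1 / x) * exp (- (1 / x))) has_real_derivative
        flat_exp (monom 1 2 * (p - pderiv p)) x) (at x)"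
      using 1 by (auto intro!: derivative_eq_intros DERIV_chain2[OF poly_DERIV]
          simp: flat_exp_def poly_monom power2_eq_square field_simps)
    then show ?thesis
      by (rule has_field_derivative_transform_within_open[where S = "{0<..}"])
         (use 1 in \<open>auto simp: flat_exp_def\<close>)
  next
    case 2
    have "((\<lambda>x. 0) has_real_derivative flat_exp (monom 1 2 * (p - pderiv p)) x) (at x)"
      using 2 by (simp add: flat_exp_def)
    then show ?thesis
      by (rule has_field_derivative_transform_within_open[where S = "{..<0}"])
         (use 2 in \<open>auto simp: flat_exp_def\<close>)
  next
    case 3
    have "((\<lambda>h. flat_exp p h / h) \<longlongrightarrow> 0) (at_right 0)"
    proof -
      \<comment> \<open>The right difference quotient at 0 is t p(t) exp(-t) with t = 1/h.\<close>
      have "((\<lambda>h. poly (monom 1 1 * p) (inverse h) * exp (- inverse h)) \<longlongrightarrow> (0::real)) (at_right 0)"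
        by (rule filterlim_compose[OF tendsto_poly_mult_exp_minus filterlim_inverse_at_top_right])
      then show ?thesis
        by (rule Lim_transform_eventually)
           (auto simp: eventually_at_right_field flat_exp_def poly_monom field_simps intro: exI[of _ 1])
    qed
    moreover have "((\<lambda>h. flat_exp p h / h) \<longlongrightarrow> 0) (at_left 0)"
      by (rule tendsto_eventually) (auto simp: eventually_at_left_field flat_exp_def intro: exI[of _ "-1"])
    ultimately have "((\<lambda>h. flat_exp p h / h) \<longlongrightarrow> 0) (at 0)"
      by (intro filterlim_split_at)
    then show ?thesis using 3 by (simp add: DERIV_def flat_exp_def)
  qed
qed

lemma Cinf_flat: "Cinf (flat_exp p)"
proof -
  have "Cdiff n (flat_exp p)" for n
    by (induction n arbitrary: p) (use flat_exp_has_derivative in auto)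
  then show ?thesis by (simp add: Cinf_def)
qed

lemma flat_1_bounds: "0 \<le> flat_exp 1 x" "flat_exp 1 x \<le> 1" "flat_exp 1 x = 0 \<longleftrightarrow> x \<le> 0"
  by (auto simp: flat_exp_def)

text \<open>The parameter \<open>r\<close> is a steepness. Letting it grow gives the indicator of
  the open interval; taking \<open>r = 1 / s\<close> on an interval of length \<open>s\<close> gives
  a rescaled copy of one fixed profile.\<close>

definition bump :: "real \<Rightarrow> real \<Rightarrow> real \<Rightarrow> real \<Rightarrow> real" where
  "bump r a b x = flat_exp 1 (r * (x - a)) * flat_exp 1 (r * (b - x))"

lemma Cinf_bump: "Cinf (bump r a b)"
proof -
  have "Cinf (\<lambda>x. flat_exp 1 (r * x + - (r * a)) * flat_exp 1 (- r * x + r * b))"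
    by (intro Cinf_mult Cinf_affine Cinf_flat)
  then show ?thesis unfolding bump_def[abs_def] by (simp add: algebra_simps)
qed

lemma bump_bounds: "0 \<le> bump r a b x" "bump r a b x \<le> 1"
  by (auto simp: bump_def flat_1_bounds mult_le_one)

lemma bump_eq_0_iff: "r > 0 \<Longrightarrow> bump r a b x = 0 \<longleftrightarrow> x \<le> a \<or> b \<le> x"
  by (auto simp: bump_def flat_1_bounds mult_le_0_iff)

lemma bump_tendsto_indicator: "(\<lambda>n. bump (real (Suc n)) a b x) \<longlonglongrightarrow> indicator {a<..<b} x"
proof (cases "x \<in> {a<..<b}")
  case True
  have 1: "(\<lambda>n. flat_exp 1 (real (Suc n) * y)) \<longlonglongrightarrow> 1" if "y > 0" for y
  proof -
    have "(\<lambda>n. exp (- (inverse (real (Suc n)) * (1 / y)))) \<longlonglongrightarrow> exp (- (0 * (1 / y)))"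
      by (intro tendsto_intros LIMSEQ_inverse_real_of_nat)
    then show ?thesis using that by (simp add: flat_exp_def field_simps del: of_nat_Suc)
  qed
  have "(\<lambda>n. bump (real (Suc n)) a b x) \<longlonglongrightarrow> 1 * 1"
    unfolding bump_def using True by (intro tendsto_mult 1) auto
  then show ?thesis using True by simp
next
  case False
  then have "bump (real (Suc n)) a b x = 0" for n
    by (subst bump_eq_0_iff) auto
  then show ?thesis using False by simp
qed

text \<open>Products of one-variable functions are closed under \<open>partial_deriv\<close>, which
  only replaces one factor by its derivative. Thus the iterated derivatives in \<open>smooth\<close>
  reduce to derivatives on the line.\<close>

definition tensor :: "('n::finite \<Rightarrow> real \<Rightarrow> real) \<Rightarrow> real^'n \<Rightarrow> real" where
  "tensor F x = (\<Prod>i\<in>UNIV. F i (x $ i))"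

lemma tensor_has_derivative:
  assumes "\<And>i. Cinf (F i)"
  shows "(tensor F has_derivative
    (\<lambda>v. \<Sum>i\<in>UNIV. (deriv (F i) (x $ i) * v $ i) * (\<Prod>j\<in>UNIV - {i}. F j (x $ j)))) (at x)"
proof -
  have "((\<lambda>x. F i (x $ i)) has_derivative (\<lambda>v. deriv (F i) (x $ i) * v $ i)) (at x)" for i
    using has_derivative_compose[of "\<lambda>x. x $ i" "\<lambda>v. v $ i" x UNIV "F i" "(*) (deriv (F i) (x $ i))"]
      Cinf_derivative(1)[OF assms, of i "x $ i"]
    by (auto simp: has_field_derivative_def bounded_linear.has_derivative[OF bounded_linear_vec_nth])
  then show ?thesis unfolding tensor_def[abs_def] by (intro has_derivative_prod) auto
qed

lemma partial_deriv_tensor: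
  fixes F :: "'n::finite \<Rightarrow> real \<Rightarrow> real"
  assumes "\<And>i. Cinf (F i)"
  shows "partial_deriv j (tensor F) = tensor (F(j := deriv (F j)))"
proof
  fix x :: "real^'n"
  have "partial_deriv j (tensor F) x =
      (\<Sum>i\<in>UNIV. (deriv (F i) (x $ i) * axis j 1 $ i) * (\<Prod>k\<in>UNIV - {i}. F k (x $ k)))"
    unfolding partial_deriv_def frechet_derivative_at[OF tensor_has_derivative[OF assms], symmetric] ..
  also have "\<dots> = (\<Sum>i\<in>UNIV. if i = j then deriv (F j) (x $ j) * (\<Prod>k\<in>UNIV - {j}. F k (x $ k)) else 0)"
    by (intro sum.cong) (auto simp: axis_def)
  also have "\<dots> = deriv (F j) (x $ j) * (\<Prod>k\<in>UNIV - {j}. F k (x $ k))" by simp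
  also have "\<dots> = (\<Prod>k\<in>UNIV. (F(j := deriv (F j))) k (x $ k))"
    by (subst prod.remove[of UNIV j]) (auto intro!: prod.cong)
  finally show "partial_deriv j (tensor F) x = tensor (F(j := deriv (F j))) x" by (simp add: tensor_def)
qed

lemma smooth_tensor:
  fixes F :: "'n::finite \<Rightarrow> real \<Rightarrow> real"
  assumes "\<And>i. Cinf (F i)"
  shows "smooth (tensor F)"
proof -
  have "fold partial_deriv is (tensor F) differentiable_on UNIV" for "is" :: "'n list"
    using assms
  proof (induction "is" arbitrary: F)
    case Nil
    then show ?case
      using tensor_has_derivative[of F, OF Nil]
      by (auto simp: differentiable_on_def differentiable_def)
  next
    case (Cons j "is")
    have "Cinf ((F(j := deriv (F j))) i)" for i
      using Cons.prems Cinf_derivative(2) by auto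
    then show ?case using Cons.IH[of "F(j := deriv (F j))"] partial_deriv_tensor[of F j] Cons.prems
      by (simp del: fun_upd_apply)
  qed
  then show ?thesis by (simp add: smooth_def)
qed

lemma tensor_nonzero_subset:
  assumes "\<And>i x. x \<notin> {a $ i..b $ i} \<Longrightarrow> F i x = 0" "tensor F x \<noteq> 0"
  shows "x \<in> cbox a b"
proof -
  have "F i (x $ i) \<noteq> 0" for i using assms(2) by (auto simp: tensor_def)
  then have "x $ i \<in> {a $ i..b $ i}" for i using assms(1) by metis
  then show ?thesis by (auto simp: mem_box_cart)
qed

lemma tensor_test_function:
  assumes "\<And>i. Cinf (F i)" "\<And>i x. x \<notin> {a $ i..b $ i} \<Longrightarrow> F i x = 0" "cbox a b \<subseteq> \<Omega>"
  shows "tensor F \<in> test_functions \<Omega>"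
proof -
  have sub: "closure {x. tensor F x \<noteq> 0} \<subseteq> cbox a b"
    using tensor_nonzero_subset[OF assms(2)] by (intro closure_minimal) auto
  have "bounded {x. tensor F x \<noteq> 0}"
    by (rule bounded_subset[OF bounded_cbox[of a b]]) (rule order_trans[OF closure_subset sub])
  then have "compact (closure {x. tensor F x \<noteq> 0})"
    by (simp add: compact_closure)
  then show ?thesis using sub assms(3) smooth_tensor[OF assms(1)] by (auto simp: test_functions_def)
qed


section \<open>Weak gradients\<close>

text \<open>Boxes are stable under intersection and generate the Borel sets, so vanishing integrals
  extend to all Borel sets by Dynkin's argument and to Lebesgue sets by completion.\<close>

lemma AE_zero_of_box_integrals:
  fixes f :: "'a::euclidean_space \<Rightarrow> real"
  assumes int: "integrable lebesgue f" and bdd: "bounded {x. f x \<noteq> 0}"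
    and box: "\<And>a b. (\<integral>x. indicator (box a b) x * f x \<partial>lebesgue) = 0"
  shows "AE x in lebesgue. f x = 0"
proof (rule density_unique_real[OF int])
  have iA: "integrable lebesgue (\<lambda>x. indicator A x * f x)" if "A \<in> sets lebesgue" for A
    using integrable_mult_indicator[OF that int] by simp
  \<comment> \<open>The complement step below needs the whole space, which is not a box; a box
    around the bounded support stands in for it.\<close>
  have all: "(\<integral>x. f x \<partial>lebesgue) = 0"
  proof -
    obtain a b where "{x. f x \<noteq> 0} \<subseteq> box a b" using bounded_subset_box_symmetric[OF bdd] by metis
    then have "(\<lambda>x. indicator (box a b) x * f x) = f"
      by (force simp: indicator_def)
    then show ?thesis using box[of a b] by simp
  qed
  have borel: "(\<integral>x. indicator A x * f x \<partial>lebesgue) = 0" if "A \<in> sets borel" for A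
  proof -
    let ?G = "range (\<lambda>(a, b). box a b :: 'a set)"
    have sets: "sets borel = sigma_sets UNIV ?G" by (simp add: borel_eq_box)
    have "Int_stable ?G"
      unfolding Int_stable_def by (auto simp: box_Int_box)
    moreover have "?G \<subseteq> Pow UNIV" by simp
    moreover have "A \<in> sigma_sets UNIV ?G" using that sets by simp
    ultimately show ?thesis
    proof (induction rule: sigma_sets_induct_disjoint)
      case (basic A)
      then show ?case using box by auto
    next
      case (compl A)
      then have A: "A \<in> sets lebesgue" using sets by auto
      have "(\<lambda>x. indicator (UNIV - A) x * f x) = (\<lambda>x. f x - indicator A x * f x)"
        by (auto simp: indicator_def)
      then show ?case using compl int iA[OF A] all by simp
    next
      case (union A)
      then have "A i \<in> sets borel" for i unfolding sets by blast
      then have A: "A i \<in> sets lebesgue" for i by simp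
      have "(LINT x:(\<Union>i. A i)|lebesgue. f x) = (\<Sum>i. (LINT x:(A i)|lebesgue. f x))"
      proof (rule lebesgue_integral_countable_add)
        show "set_integrable lebesgue (\<Union>i. A i) f"
          unfolding set_integrable_def using A int by (intro integrable_mult_indicator) auto
        show "i \<noteq> j \<Longrightarrow> A i \<inter> A j = {}" for i j
          using union by (auto simp: disjoint_family_on_def)
      qed (use A in auto)
      then show ?case using union by (simp add: set_lebesgue_integral_def)
    qed simp
  qed
  show "set_lebesgue_integral lebesgue A f = set_lebesgue_integral lebesgue A (\<lambda>_. 0)"
    if AL: "A \<in> sets lebesgue" for A
  proof -
    \<comment> \<open>A Lebesgue set is a Borel set up to a part of a Borel null set.\<close>
    obtain S N N' where A: "A = S \<union> N" "N \<subseteq> N'" "N' \<in> null_sets lborel" "S \<in> sets lborel"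
      by (rule sets_completionE[OF AL])
    have "AE x in lborel. x \<notin> N'" using A(3) by (rule AE_not_in)
    then have "AE x in lebesgue. x \<notin> N'" by (rule AE_completion)
    then have "AE x in lebesgue. indicator A x * f x = indicator S x * f x"
      by eventually_elim (use A in \<open>auto simp: indicator_def\<close>)
    then have "(\<integral>x. indicator A x * f x \<partial>lebesgue) = (\<integral>x. indicator S x * f x \<partial>lebesgue)"
      using iA[OF AL] iA[of S] A(4) by (intro integral_cong_AE) auto
    then show ?thesis using borel[of S] A(4) by (simp add: set_lebesgue_integral_def)
  qed
qed simp

section \<open>Integrals over open sets and membership of bump functions in L^2\<close>

lemma integral_lebesgue_on_open:
  fixes f :: "real^'n::finite \<Rightarrow> real"
  assumes "open \<Omega>"
  shows "(\<integral>x. f x \<partial>lebesgue_on \<Omega>) = (\<integral>x. indicator \<Omega> x * f x \<partial>lebesgue)"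
  using assms by (subst integral_restrict_space) auto

lemma integrable_lebesgue_on_open:
  fixes f :: "real^'n::finite \<Rightarrow> real"
  assumes "open \<Omega>"
  shows "integrable (lebesgue_on \<Omega>) f \<longleftrightarrow> integrable lebesgue (\<lambda>x. indicator \<Omega> x * f x)"
  using assms by (subst integrable_restrict_space) auto

lemma continuous_compact_support_integrable:
  fixes f :: "'a::euclidean_space \<Rightarrow> real"
  assumes "continuous_on UNIV f" "compact C" "\<And>x. x \<notin> C \<Longrightarrow> f x = 0"
  shows "integrable lborel f"
proof -
  have "(\<lambda>x. indicator C x *\<^sub>R f x) = f" using assms(3) by (force simp: indicator_def)
  then show ?thesis
    using borel_integrable_compact[OF assms(2) continuous_on_subset[OF assms(1)]] by simp
qed

lemma L2_continuous_compact_support: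
  fixes f :: "real^'n::finite \<Rightarrow> real"
  assumes "continuous_on UNIV f" "compact C" "\<And>x. x \<notin> C \<Longrightarrow> f x = 0" "open \<Omega>"
  shows "f \<in> L2 \<Omega>"
proof -
  have "integrable lborel (\<lambda>x. (f x)\<^sup>2)"
    using assms by (intro continuous_compact_support_integrable[of _ C] continuous_intros) auto
  moreover have "f \<in> borel_measurable borel" using assms(1) by (rule borel_measurable_continuous_onI)
  ultimately have m: "f \<in> borel_measurable lebesgue" "integrable lebesgue (\<lambda>x. (f x)\<^sup>2)"
    by (auto simp: integrable_completion intro: measurable_completion)
  then show ?thesis
    using assms(4) integrable_mult_indicator[OF _ m(2), of \<Omega>]
    by (auto simp: L2_def integrable_lebesgue_on_open measurable_restrict_space1)
qed

lemma L2_bounded_support: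
  fixes f :: "real^'n::finite \<Rightarrow> real"
  assumes "f \<in> borel_measurable borel" "\<And>x. \<bar>f x\<bar> \<le> B" "bounded \<Omega>" "open \<Omega>"
  shows "f \<in> L2 \<Omega>"
proof -
  have m: "f \<in> borel_measurable (lebesgue_on \<Omega>)"
    using assms(1) by (intro measurable_restrict_space1 measurable_completion) simp
  have fin: "finite_measure (lebesgue_on \<Omega>)"
    using assms(3,4) by (intro finite_measure_lebesgue_on) (auto intro: lmeasurable_open)
  have "integrable (lebesgue_on \<Omega>) (\<lambda>x. (f x)\<^sup>2)"
  proof (rule finite_measure.integrable_const_bound[OF fin])
    have "(f x)\<^sup>2 \<le> B\<^sup>2" for x using assms(2)[of x] by (metis abs_ge_zero power2_abs power_mono)
    then show "AE x in lebesgue_on \<Omega>. norm ((f x)\<^sup>2) \<le> B\<^sup>2" by simp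
  qed (use m in measurable)
  then show ?thesis using m by (simp add: L2_def)
qed

lemma tensor_bump_nonzero:
  assumes "r > 0" "tensor (\<lambda>i. bump r (a $ i) (b $ i)) x \<noteq> 0"
  shows "x \<in> box a b"
  using assms by (auto simp: tensor_def bump_eq_0_iff mem_box_cart not_le)

lemma tensor_bump_test_function:
  assumes "r > 0" "cbox a b \<subseteq> \<Omega>"
  shows "tensor (\<lambda>i. bump r (a $ i) (b $ i)) \<in> test_functions \<Omega>"
proof (rule tensor_test_function[OF Cinf_bump _ assms(2)])
  show "bump r (a $ i) (b $ i) x = 0" if "x \<notin> {a $ i..b $ i}" for i x
    using that assms(1) by (auto simp: bump_eq_0_iff)
qed

lemma tensor_bump_bounds: "0 \<le> tensor (\<lambda>i. bump r (a $ i) (b $ i)) x" "tensor (\<lambda>i. bump r (a $ i) (b $ i)) x \<le> 1"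
  unfolding tensor_def by (auto intro!: prod_nonneg prod_le_1 simp: bump_bounds)

lemma smooth_continuous:
  assumes "smooth f"
  shows "continuous_on UNIV f" "continuous_on UNIV (partial_deriv i f)" "f differentiable (at x)"
proof -
  have "fold partial_deriv [] f differentiable_on UNIV" "fold partial_deriv [i] f differentiable_on UNIV"
    using assms unfolding smooth_def by blast+
  then show "continuous_on UNIV f" "continuous_on UNIV (partial_deriv i f)" "f differentiable (at x)"
    by (auto intro: differentiable_imp_continuous_on simp: differentiable_on_def)
qed

lemma test_function_compact_support:
  assumes "\<psi> \<in> test_functions \<Omega>"
  obtains C where "compact C" "C \<subseteq> \<Omega>" "\<And>x. x \<notin> C \<Longrightarrow> \<psi> x = 0" "\<And>x i. x \<notin> C \<Longrightarrow> partial_deriv i \<psi> x = 0"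
proof -
  define C where "C = closure {x. \<psi> x \<noteq> 0}"
  have C: "compact C" "C \<subseteq> \<Omega>" "closed C" using assms by (auto simp: test_functions_def C_def)
  have 0: "\<psi> x = 0" if "x \<notin> C" for x
    using that closure_subset[of "{x. \<psi> x \<noteq> 0}"] by (auto simp: C_def)
  have "partial_deriv i \<psi> x = 0" if x: "x \<notin> C" for x i
  proof -
    have "(\<psi> has_derivative (\<lambda>_. 0)) (at x)"
    proof (rule has_derivative_transform_within_open)
      show "((\<lambda>_. 0) has_derivative (\<lambda>_. 0)) (at x)" by simp
      show "open (- C)" using C(3) by auto
      show "x \<in> - C" using x by simp
    qed (simp add: 0)
    then show ?thesis by (simp add: partial_deriv_def frechet_derivative_at[symmetric])
  qed
  with C 0 show thesis using that by blast
qed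

lemma test_function_L2:
  assumes "\<psi> \<in> test_functions \<Omega>" "open \<Omega>'"
  shows "\<psi> \<in> L2 \<Omega>'" "partial_deriv i \<psi> \<in> L2 \<Omega>'"
proof -
  obtain C where C: "compact C" "\<And>x. x \<notin> C \<Longrightarrow> \<psi> x = 0" "\<And>x i. x \<notin> C \<Longrightarrow> partial_deriv i \<psi> x = 0"
    using test_function_compact_support[OF assms(1)] by metis
  have "smooth \<psi>" using assms by (simp add: test_functions_def)
  note cont = smooth_continuous[OF this]
  show "\<psi> \<in> L2 \<Omega>'"
    by (rule L2_continuous_compact_support[OF cont(1) C(1) C(2) assms(2)])
  show "partial_deriv i \<psi> \<in> L2 \<Omega>'"
    by (rule L2_continuous_compact_support[OF cont(2) C(1) C(3) assms(2)])
qed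

text \<open>Tensor products of ever steeper bumps converge to the indicator of a box with closure in
  \<open>\<Omega>\<close>, so the integral of \<open>g\<close> over that box vanishes. As
  \<open>g\<close> is only square-integrable, the argument runs inside one closed box at a time, and
  countably many of these exhaust \<open>\<Omega>\<close>.\<close>

lemma fundamental_lemma:
  fixes g :: "real^'n::finite \<Rightarrow> real"
  assumes \<Omega>: "open \<Omega>" and g: "g \<in> L2 \<Omega>"
    and orth: "\<And>\<psi>. \<psi> \<in> test_functions \<Omega> \<Longrightarrow> L2_inner \<Omega> g \<psi> = 0"
  shows "AE x in lebesgue_on \<Omega>. g x = 0"
proof -
  define G where "G = (\<lambda>x. indicator \<Omega> x * g x)"
  have Gm: "G \<in> borel_measurable lebesgue"
    using g \<Omega> L2_measurable[OF g] unfolding G_def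
    by (subst (asm) borel_measurable_restrict_space_iff) auto
  have "(\<lambda>x. (G x)\<^sup>2) = (\<lambda>x. indicator \<Omega> x * (g x)\<^sup>2)"
    by (auto simp: G_def indicator_def)
  then have Gsq: "integrable lebesgue (\<lambda>x. (G x)\<^sup>2)"
    using g \<Omega> by (auto simp: L2_def integrable_lebesgue_on_open)
  have Gind: "(\<lambda>x. indicator A x * G x) \<in> borel_measurable lebesgue" if "A \<in> sets lebesgue" for A
    using that Gm by (intro borel_measurable_times borel_measurable_indicator)
  have Gint: "integrable lebesgue (\<lambda>x. indicator (cbox a b) x * G x)" for a b
  proof (rule Bochner_Integration.integrable_bound)
    show "integrable lebesgue (\<lambda>x. indicator (cbox a b) x + (G x)\<^sup>2)"
      using Gsq borel_integrable_compact[OF compact_cbox, of a b "\<lambda>_. 1 :: real"]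
      by (intro Bochner_Integration.integrable_add) (auto simp: integrable_completion)
    show "(\<lambda>x. indicator (cbox a b) x * G x) \<in> borel_measurable lebesgue"
      by (rule Gind) simp
    \<comment> \<open>This is how square-integrability yields integrability on bounded sets.\<close>
    have "\<bar>t\<bar> \<le> 1 + t\<^sup>2" for t :: real
    proof -
      have "0 \<le> (\<bar>t\<bar> - 1 / 2)\<^sup>2" by simp
      then show ?thesis by (simp add: power2_eq_square algebra_simps)
    qed
    then show "AE x in lebesgue. norm (indicator (cbox a b) x * G x) \<le> norm (indicator (cbox a b) x + (G x)\<^sup>2)"
      by (auto simp: indicator_def)
  qed
  have box0: "(\<integral>x. indicator (box a b) x * G x \<partial>lebesgue) = 0" if "cbox a b \<subseteq> \<Omega>" for a b
  proof -
    let ?\<psi> = "\<lambda>n. tensor (\<lambda>i. bump (real (Suc n)) (a $ i) (b $ i))"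
    have test: "?\<psi> n \<in> test_functions \<Omega>" for n
      using that by (intro tensor_bump_test_function) auto
    have "(\<lambda>n. \<integral>x. ?\<psi> n x * G x \<partial>lebesgue) \<longlonglongrightarrow> (\<integral>x. indicator (box a b) x * G x \<partial>lebesgue)"
    proof (rule integral_dominated_convergence[where w = "\<lambda>x. \<bar>indicator (cbox a b) x * G x\<bar>"])
      show "(\<lambda>x. indicator (box a b) x * G x) \<in> borel_measurable lebesgue" by (rule Gind) simp
      have "?\<psi> n \<in> borel_measurable borel" for n
        using test[of n] smooth_continuous(1)
        by (intro borel_measurable_continuous_onI) (auto simp: test_functions_def)
      then have "?\<psi> n \<in> borel_measurable lebesgue" for n
        by (intro measurable_completion) simp
      then show "(\<lambda>x. ?\<psi> n x * G x) \<in> borel_measurable lebesgue" for n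
        using Gm by (intro borel_measurable_times)
      show "integrable lebesgue (\<lambda>x. \<bar>indicator (cbox a b) x * G x\<bar>)" using Gint by (rule integrable_abs)
      have "(\<lambda>n. ?\<psi> n x) \<longlonglongrightarrow> (\<Prod>i\<in>UNIV. indicator {a $ i<..<b $ i} (x $ i))" for x
        unfolding tensor_def by (intro tendsto_prod bump_tendsto_indicator)
      moreover have "(\<Prod>i\<in>UNIV. indicator {a $ i<..<b $ i} (x $ i)) = (indicator (box a b) x :: real)" for x
        by (auto simp: indicator_def mem_box_cart prod_eq_1_iff)
      ultimately show "AE x in lebesgue. (\<lambda>n. ?\<psi> n x * G x) \<longlonglongrightarrow> indicator (box a b) x * G x"
        by (auto intro!: tendsto_mult)
      have "\<bar>?\<psi> n x * G x\<bar> \<le> \<bar>indicator (cbox a b) x * G x\<bar>" for n x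
      proof (cases "?\<psi> n x = 0")
        case False
        then have "x \<in> cbox a b" using tensor_bump_nonzero[of "real (Suc n)" a b x] box_subset_cbox by auto
        then show ?thesis using tensor_bump_bounds[of "real (Suc n)" a b x]
          by (auto simp: abs_mult mult_left_le_one_le)
      qed simp
      then show "AE x in lebesgue. norm (?\<psi> n x * G x) \<le> \<bar>indicator (cbox a b) x * G x\<bar>" for n
        by simp
    qed
    moreover have "(\<integral>x. ?\<psi> n x * G x \<partial>lebesgue) = 0" for n
      using orth[OF test[of n]] \<Omega> by (simp add: L2_inner_def integral_lebesgue_on_open G_def mult_ac)
    ultimately show ?thesis by (simp add: LIMSEQ_const_iff)
  qed
  have cbox0: "AE x in lebesgue. x \<in> cbox a b \<longrightarrow> G x = 0" if ab: "cbox a b \<subseteq> \<Omega>" for a b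
  proof -
    have "AE x in lebesgue. indicator (cbox a b) x * G x = 0"
    proof (rule AE_zero_of_box_integrals[OF Gint])
      show "bounded {x. indicator (cbox a b) x * G x \<noteq> 0}"
        by (rule bounded_subset[OF bounded_cbox[of a b]]) (auto simp: indicator_def)
      fix c d :: "real^'n"
      \<comment> \<open>Corners of the intersection of the two open boxes, again a (possibly empty)
        box; replacing \<open>box a b\<close> by \<open>cbox a b\<close> changes only a null
        set.\<close>
      define a' b' where "a' = (\<chi> i. max (a $ i) (c $ i))" and "b' = (\<chi> i. min (b $ i) (d $ i))"
      have "cbox a' b' \<subseteq> cbox a b" by (auto simp: a'_def b'_def mem_box_cart)
      then have 1: "(\<integral>x. indicator (box a' b') x * G x \<partial>lebesgue) = 0"
        using ab by (intro box0) auto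
      have "negligible (cbox a b - box a b)" by (rule negligible_frontier_interval)
      then have "AE x in lebesgue. x \<notin> cbox a b - box a b"
        unfolding negligible_iff_null_sets by (rule AE_not_in)
      then have "AE x in lebesgue. indicator (box c d) x * (indicator (cbox a b) x * G x) =
          indicator (box a' b') x * G x"
      proof eventually_elim
        case (elim x)
        have "x \<in> box a' b' \<longleftrightarrow> x \<in> box a b \<and> x \<in> box c d"
          by (auto simp: a'_def b'_def mem_box_cart)
        then show ?case using elim box_subset_cbox[of a b] by (auto simp: indicator_def)
      qed
      then have "(\<integral>x. indicator (box c d) x * (indicator (cbox a b) x * G x) \<partial>lebesgue) =
          (\<integral>x. indicator (box a' b') x * G x \<partial>lebesgue)"
        by (intro integral_cong_AE borel_measurable_times[OF borel_measurable_indicator] Gind) auto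
      then show "(\<integral>x. indicator (box c d) x * (indicator (cbox a b) x * G x) \<partial>lebesgue) = 0"
        using 1 by simp
    qed
    then show ?thesis by eventually_elim (auto simp: indicator_def)
  qed
  obtain D where D: "countable D" "D \<subseteq> Pow \<Omega>" "\<And>X. X \<in> D \<Longrightarrow> \<exists>a b. X = cbox a b" "\<Union>D = \<Omega>"
    using open_countable_Union_open_cbox[OF \<Omega>] by metis
  have "AE x in lebesgue. \<forall>X\<in>D. x \<in> X \<longrightarrow> G x = 0"
  proof (subst AE_ball_countable[OF D(1)], intro ballI)
    fix X assume "X \<in> D"
    then obtain a b where "X = cbox a b" "cbox a b \<subseteq> \<Omega>" using D by (metis PowD subsetD)
    then show "AE x in lebesgue. x \<in> X \<longrightarrow> G x = 0" using cbox0 by simp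
  qed
  then have "AE x in lebesgue. x \<in> \<Omega> \<longrightarrow> g x = 0"
    by eventually_elim (metis D(4) G_def UnionE indicator_simps(1) mult_1)
  then show ?thesis using \<Omega> by (subst AE_restrict_space_iff) auto
qed

section \<open>Weak gradients: uniqueness, and the case of test functions\<close>

lemma weak_gradient_unique:
  assumes \<Omega>: "open \<Omega>" and g: "is_weak_gradient \<Omega> u g" "is_weak_gradient \<Omega> u h"
  shows "AE x in lebesgue_on \<Omega>. g x = h x"
proof -
  have "AE x in lebesgue_on \<Omega>. g x $ i = h x $ i" for i
  proof -
    have L: "(\<lambda>x. g x $ i) \<in> L2 \<Omega>" "(\<lambda>x. h x $ i) \<in> L2 \<Omega>"
      using g by (auto simp: is_weak_gradient_def)
    have "AE x in lebesgue_on \<Omega>. g x $ i - h x $ i = 0"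
    proof (rule fundamental_lemma[OF \<Omega> L2_diff[OF L]])
      fix \<psi> assume \<psi>: "\<psi> \<in> test_functions \<Omega>"
      then have "L2_inner \<Omega> u (partial_deriv i \<psi>) = - L2_inner \<Omega> (\<lambda>x. g x $ i) \<psi>"
        "L2_inner \<Omega> u (partial_deriv i \<psi>) = - L2_inner \<Omega> (\<lambda>x. h x $ i) \<psi>"
        using g by (auto simp: is_weak_gradient_def)
      then show "L2_inner \<Omega> (\<lambda>x. g x $ i - h x $ i) \<psi> = 0"
        using L test_function_L2(1)[OF \<psi> \<Omega>] by (simp add: L2_inner_diff_left)
    qed
    then show ?thesis by simp
  qed
  then have "AE x in lebesgue_on \<Omega>. \<forall>i\<in>UNIV. g x $ i = h x $ i"
    by (intro AE_finite_allI) auto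
  then show ?thesis by (simp add: vec_eq_iff)
qed

text \<open>Links the function picked by \<open>SOME\<close> to any gradient that can be computed
  explicitly.\<close>

lemma weak_gradient_eq_AE:
  assumes "open \<Omega>" "is_weak_gradient \<Omega> u g"
  shows "AE x in lebesgue_on \<Omega>. weak_gradient \<Omega> u x = g x"
  using someI[of "is_weak_gradient \<Omega> u", OF assms(2)] unfolding weak_gradient_def
  by (intro weak_gradient_unique[OF assms(1) _ assms(2)])

lemma has_real_derivative_partial:
  fixes F :: "real^'n::finite \<Rightarrow> real"
  assumes "F differentiable (at (x + t *\<^sub>R axis i 1))"
  shows "((\<lambda>t. F (x + t *\<^sub>R axis i 1)) has_real_derivative partial_deriv i F (x + t *\<^sub>R axis i 1)) (at t)"
proof -
  let ?y = "x + t *\<^sub>R axis i 1" and ?F' = "frechet_derivative F (at (x + t *\<^sub>R axis i 1))"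
  have F: "(F has_derivative ?F') (at ?y)" using assms frechet_derivative_works by blast
  have "((\<lambda>t. x + t *\<^sub>R axis i 1) has_derivative (\<lambda>h. h *\<^sub>R axis i 1)) (at t)"
    by (auto intro!: derivative_eq_intros)
  from has_derivative_compose[OF this F]
  have "((\<lambda>t. F (x + t *\<^sub>R axis i 1)) has_derivative (\<lambda>h. ?F' (h *\<^sub>R axis i 1))) (at t)" .
  moreover have "(\<lambda>h. ?F' (h *\<^sub>R axis i 1)) = (*) (partial_deriv i F ?y)"
    using linear_scale[OF has_derivative_linear[OF F]] by (auto simp: partial_deriv_def mult.commute)
  ultimately show ?thesis by (simp add: has_field_derivative_def)
qed

text \<open>The integral of a difference quotient vanishes by translation invariance, and the difference
  quotients are dominated because \<open>F\<close> is Lipschitz in direction \<open>i\<close>.\<close>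

lemma integral_partial_deriv_eq_0:
  fixes F :: "real^'n::finite \<Rightarrow> real"
  assumes F: "\<And>x. F differentiable (at x)" and cont: "continuous_on UNIV (partial_deriv i F)"
    and C: "compact C" "\<And>x. x \<notin> C \<Longrightarrow> F x = 0" "\<And>x. x \<notin> C \<Longrightarrow> partial_deriv i F x = 0"
  shows "(\<integral>x. partial_deriv i F x \<partial>lborel) = 0"
proof -
  let ?e = "axis i 1 :: real^'n" and ?D = "partial_deriv i F"
  have contF: "continuous_on UNIV F"
    using F by (intro differentiable_imp_continuous_on) (auto simp: differentiable_on_def)
  have Fint: "integrable lborel F"
    by (rule continuous_compact_support_integrable[OF contF C(1,2)])
  obtain M where M: "\<And>x. \<bar>?D x\<bar> \<le> M" "M \<ge> 0"
  proof -
    have "bounded (?D ` C)"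
      using compact_continuous_image[OF continuous_on_subset[OF cont] C(1)] compact_imp_bounded by auto
    then obtain B where "\<And>x. x \<in> C \<Longrightarrow> \<bar>?D x\<bar> \<le> B" unfolding bounded_iff by auto
    then have "\<bar>?D x\<bar> \<le> max B 0" for x using C(3) by (cases "x \<in> C") force+
    then show thesis using that[of "max B 0"] by simp
  qed
  obtain R where R: "C \<subseteq> cball 0 R"
  proof -
    obtain R where "\<And>x. x \<in> C \<Longrightarrow> norm x \<le> R"
      using compact_imp_bounded[OF C(1)] unfolding bounded_iff by auto
    then have "C \<subseteq> cball 0 R" by auto
    then show thesis by (rule that)
  qed
  let ?h = "\<lambda>n. inverse (real (Suc n))"
  define s where "s n x = (F (x + ?h n *\<^sub>R ?e) - F x) / ?h n" for n x
  have mvt: "\<exists>z. 0 < z \<and> z < h \<and> F (x + h *\<^sub>R ?e) - F x = h * ?D (x + z *\<^sub>R ?e)" if "h > 0" for h x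
    using MVT2[of 0 h "\<lambda>t. F (x + t *\<^sub>R ?e)" "\<lambda>t. ?D (x + t *\<^sub>R ?e)"] that
      has_real_derivative_partial[OF F] by auto
  \<comment> \<open>Since \<open>?h n\<close> is at most 1, all quotients vanish outside the ball of
    radius \<open>R + 1\<close>; inside it the mean value theorem bounds them by \<open>M\<close>.
    Hence one dominating function serves all \<open>n\<close>.\<close>
  have s_bound: "\<bar>s n x\<bar> \<le> indicator (cball 0 (R + 1)) x * M" for n x
  proof (cases "x \<in> cball 0 (R + 1)")
    case True
    obtain z where "F (x + ?h n *\<^sub>R ?e) - F x = ?h n * ?D (x + z *\<^sub>R ?e)"
      using mvt[of "?h n" x] by auto
    then have "s n x = ?D (x + z *\<^sub>R ?e)" by (simp add: s_def del: of_nat_Suc)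
    then show ?thesis using True M by simp
  next
    case False
    then have nx: "norm x > R + 1" by simp
    have "norm x \<le> norm (x + ?h n *\<^sub>R ?e) + norm (?h n *\<^sub>R ?e)"
      by (metis add_diff_cancel norm_triangle_ineq4)
    moreover have "norm (?h n *\<^sub>R ?e) \<le> 1" by (simp add: field_simps)
    ultimately have "x + ?h n *\<^sub>R ?e \<notin> C" "x \<notin> C" using nx R by auto
    then show ?thesis using C(2) False by (simp add: s_def)
  qed
  have s_lim: "(\<lambda>n. s n x) \<longlonglongrightarrow> ?D x" for x
  proof -
    have "((\<lambda>t. F (x + t *\<^sub>R ?e)) has_real_derivative ?D x) (at 0)"
      using has_real_derivative_partial[OF F, where x = x and t = 0] by simp
    then have "((\<lambda>h. (F (x + h *\<^sub>R ?e) - F x) / h) \<longlongrightarrow> ?D x) (at 0)"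
      by (simp add: DERIV_def)
    moreover have "filterlim ?h (at 0) sequentially"
      unfolding filterlim_at using LIMSEQ_inverse_real_of_nat by auto
    ultimately show ?thesis unfolding s_def by (rule filterlim_compose)
  qed
  have sm: "s n \<in> borel_measurable borel" for n
    unfolding s_def by (intro borel_measurable_continuous_onI continuous_intros
        continuous_on_compose2[OF contF]) auto
  have "(\<lambda>n. \<integral>x. s n x \<partial>lborel) \<longlonglongrightarrow> (\<integral>x. ?D x \<partial>lborel)"
  proof (rule integral_dominated_convergence[where w = "\<lambda>x. indicator (cball 0 (R + 1)) x * M"])
    show "?D \<in> borel_measurable lborel" using borel_measurable_continuous_onI[OF cont] by simp
    show "s n \<in> borel_measurable lborel" for n using sm by simp
    show "integrable lborel (\<lambda>x :: real^'n. indicator (cball 0 (R + 1)) x * M)"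
      using borel_integrable_compact[OF compact_cball, of "0::real^'n" "R + 1" "\<lambda>_. M"] by simp
  qed (use s_lim s_bound in auto)
  moreover have "(\<integral>x. s n x \<partial>lborel) = 0" for n
  proof -
    have "integrable (distr lborel borel ((+) (?h n *\<^sub>R ?e))) F"
      unfolding lborel_distr_plus by (rule Fint)
    then have i: "integrable lborel (\<lambda>x. F (?h n *\<^sub>R ?e + x))"
      by (subst (asm) integrable_distr_eq) (use borel_measurable_continuous_onI[OF contF] in auto)
    have "(\<integral>x. F x \<partial>lborel) = (\<integral>x. F x \<partial>distr lborel borel ((+) (?h n *\<^sub>R ?e)))"
      unfolding lborel_distr_plus ..
    also have "\<dots> = (\<integral>x. F (?h n *\<^sub>R ?e + x) \<partial>lborel)"
      using borel_measurable_continuous_onI[OF contF] by (intro integral_distr) auto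
    finally have "(\<integral>x. F (x + ?h n *\<^sub>R ?e) - F x \<partial>lborel) = 0"
      using i Fint by (simp add: add.commute)
    then show ?thesis by (simp add: s_def)
  qed
  ultimately show ?thesis by (simp add: LIMSEQ_const_iff)
qed

definition grad :: "(real^'n::finite \<Rightarrow> real) \<Rightarrow> real^'n \<Rightarrow> real^'n" where
  "grad f x = (\<chi> i. partial_deriv i f x)"

text \<open>Integration by parts: the product with another test function is differentiable with
  compact support in \<open>\<Omega>\<close>, so its partial derivative has integral 0 and no
  boundary term appears.\<close>

lemma test_function_weak_gradient:
  assumes \<Omega>: "open \<Omega>" and \<psi>: "\<psi> \<in> test_functions \<Omega>"
  shows "is_weak_gradient \<Omega> \<psi> (grad \<psi>)"
  unfolding is_weak_gradient_def
proof (intro allI conjI ballI)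
  fix i
  show "(\<lambda>x. grad \<psi> x $ i) \<in> L2 \<Omega>" using test_function_L2(2)[OF \<psi> \<Omega>] by (simp add: grad_def)
  fix \<eta> assume \<eta>: "\<eta> \<in> test_functions \<Omega>"
  have "smooth \<psi>" "smooth \<eta>" using \<psi> \<eta> by (auto simp: test_functions_def)
  note s\<psi> = smooth_continuous[OF \<open>smooth \<psi>\<close>] and s\<eta> = smooth_continuous[OF \<open>smooth \<eta>\<close>]
  obtain C where C: "compact C" "C \<subseteq> \<Omega>" "\<And>x. x \<notin> C \<Longrightarrow> \<psi> x = 0" "\<And>x i. x \<notin> C \<Longrightarrow> partial_deriv i \<psi> x = 0"
    using test_function_compact_support[OF \<psi>] by metis
  let ?F = "\<lambda>x. \<psi> x * \<eta> x"
  have D: "partial_deriv i ?F x = \<psi> x * partial_deriv i \<eta> x + partial_deriv i \<psi> x * \<eta> x" for x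
  proof -
    have "(?F has_derivative (\<lambda>h. \<psi> x * frechet_derivative \<eta> (at x) h + frechet_derivative \<psi> (at x) h * \<eta> x)) (at x)"
      using s\<psi>(3)[of x] s\<eta>(3)[of x] by (intro has_derivative_mult) (auto simp: frechet_derivative_works[symmetric])
    then show ?thesis by (simp add: partial_deriv_def frechet_derivative_at[symmetric])
  qed
  have D': "partial_deriv i ?F = (\<lambda>x. \<psi> x * partial_deriv i \<eta> x + partial_deriv i \<psi> x * \<eta> x)"
    using D by auto
  have cD: "continuous_on UNIV (partial_deriv i ?F)"
    unfolding D' by (intro continuous_intros s\<psi> s\<eta>)
  have "(\<integral>x. partial_deriv i ?F x \<partial>lborel) = 0"
  proof (rule integral_partial_deriv_eq_0[OF _ cD C(1)])
    show "?F differentiable (at x)" for x using s\<psi>(3) s\<eta>(3) by (intro differentiable_mult) auto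
  qed (use C in \<open>auto simp: D\<close>)
  then have "(\<integral>x. partial_deriv i ?F x \<partial>lebesgue) = 0"
    using borel_measurable_continuous_onI[OF cD] by (simp add: integral_completion)
  moreover have "(\<lambda>x. indicator \<Omega> x * partial_deriv i ?F x) = partial_deriv i ?F"
    unfolding D' using C by (force simp: indicator_def)
  ultimately have "(\<integral>x. partial_deriv i ?F x \<partial>lebesgue_on \<Omega>) = 0"
    by (simp add: integral_lebesgue_on_open[OF \<Omega>])
  then have "L2_inner \<Omega> \<psi> (partial_deriv i \<eta>) + L2_inner \<Omega> (partial_deriv i \<psi>) \<eta> = 0"
    unfolding D' L2_inner_def
    by (subst (asm) Bochner_Integration.integral_add)
       (intro L2_mult_integrable test_function_L2[OF \<psi> \<Omega>] test_function_L2[OF \<eta> \<Omega>])+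
  then show "L2_inner \<Omega> \<psi> (partial_deriv i \<eta>) = - L2_inner \<Omega> (\<lambda>x. grad \<psi> x $ i) \<eta>"
    by (simp add: grad_def)
qed

lemma grad_inner_cong_AE:
  assumes "AE x in lebesgue_on \<Omega>. weak_gradient \<Omega> u x = g x"
    and "AE x in lebesgue_on \<Omega>. weak_gradient \<Omega> v x = h x"
    and "\<And>i. (\<lambda>x. weak_gradient \<Omega> u x $ i) \<in> L2 \<Omega>" "\<And>i. (\<lambda>x. weak_gradient \<Omega> v x $ i) \<in> L2 \<Omega>"
    and "\<And>i. (\<lambda>x. g x $ i) \<in> L2 \<Omega>" "\<And>i. (\<lambda>x. h x $ i) \<in> L2 \<Omega>"
  shows "grad_inner \<Omega> u v = (\<integral>x. g x \<bullet> h x \<partial>lebesgue_on \<Omega>)"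
  unfolding grad_inner_def
proof (rule integral_cong_AE)
  show "AE x in lebesgue_on \<Omega>. weak_gradient \<Omega> u x \<bullet> weak_gradient \<Omega> v x = g x \<bullet> h x"
    using assms(1,2) by eventually_elim simp
qed (auto simp: inner_vec_def intro!: borel_measurable_sum borel_measurable_times L2_measurable[OF assms(3)]
    L2_measurable[OF assms(4)] L2_measurable[OF assms(5)] L2_measurable[OF assms(6)])

lemma weak_gradient_is_weak_gradient:
  "u \<in> H1 \<Omega> \<Longrightarrow> is_weak_gradient \<Omega> u (weak_gradient \<Omega> u)"
  unfolding weak_gradient_def H1_def using someI_ex[of "is_weak_gradient \<Omega> u"] by simp

lemma weak_gradient_L2: "u \<in> H1 \<Omega> \<Longrightarrow> (\<lambda>x. weak_gradient \<Omega> u x $ i) \<in> L2 \<Omega>"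
  using weak_gradient_is_weak_gradient unfolding is_weak_gradient_def by blast

lemma test_function_H1:
  assumes "open \<Omega>" "\<psi> \<in> test_functions \<Omega>"
  shows "\<psi> \<in> H1 \<Omega>"
  using test_function_weak_gradient[OF assms] test_function_L2(1)[OF assms(2,1)] by (auto simp: H1_def)

text \<open>The approximating sequence is constant. That its error is 0 still uses uniqueness,
  because the chosen \<open>weak_gradient\<close> of the zero function is only known to vanish
  almost everywhere.\<close>

lemma test_function_H10:
  assumes \<Omega>: "open \<Omega>" and \<psi>: "\<psi> \<in> test_functions \<Omega>"
  shows "\<psi> \<in> H10 \<Omega>"
proof -
  have 0: "is_weak_gradient \<Omega> (\<lambda>x. 0) (\<lambda>x. 0)"
    by (auto simp: is_weak_gradient_def L2_inner_def)
  have "(\<lambda>x. 0 :: real) \<in> H1 \<Omega>" using 0 by (auto simp: H1_def)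
  then have "grad_inner \<Omega> (\<lambda>x. 0) (\<lambda>x. 0) = (\<integral>x. (0 :: real^'a) \<bullet> 0 \<partial>lebesgue_on \<Omega>)"
    by (intro grad_inner_cong_AE weak_gradient_eq_AE[OF \<Omega> 0] weak_gradient_L2) auto
  then have "H1_norm \<Omega> (\<lambda>x. \<psi> x - \<psi> x) = 0"
    by (simp add: H1_norm_def L2_inner_def)
  then show ?thesis
    using \<psi> test_function_H1[OF assms] by (auto simp: H10_def intro!: exI[of _ "\<lambda>_. \<psi>"])
qed


section \<open>Eigenvalue bounds\<close>

text \<open>Gaussian elimination: \<open>p\<close> is the pivot in the last equation, and
  \<open>?b\<close> is the system that remains after eliminating the unknown at
  \<open>p\<close>.\<close>

lemma underdetermined_system:
  fixes a :: "nat \<Rightarrow> 'i \<Rightarrow> real"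
  assumes "finite I" "J < card I"
  shows "\<exists>c. (\<exists>m\<in>I. c m \<noteq> 0) \<and> (\<forall>i<J. (\<Sum>m\<in>I. c m * a i m) = 0)"
  using assms
proof (induction J arbitrary: I a)
  case 0
  then obtain m where "m \<in> I" by fastforce
  then show ?case by (intro exI[of _ "\<lambda>_. 1"]) auto
next
  case (Suc J)
  show ?case
  proof (cases "\<forall>m\<in>I. a J m = 0")
    case True
    obtain c where "\<exists>m\<in>I. c m \<noteq> 0" "\<forall>i<J. (\<Sum>m\<in>I. c m * a i m) = 0"
      using Suc.IH[of I a] Suc.prems by auto
    then show ?thesis using True by (intro exI[of _ c]) (auto simp: less_Suc_eq)
  next
    case False
    then obtain p where p: "p \<in> I" "a J p \<noteq> 0" by auto
    let ?I = "I - {p}"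
    let ?b = "\<lambda>i m. a i m - a i p * a J m / a J p"
    obtain c where c: "\<exists>m\<in>?I. c m \<noteq> 0" "\<forall>i<J. (\<Sum>m\<in>?I. c m * ?b i m) = 0"
    proof -
      have "J < card ?I" using Suc.prems p(1) by (simp add: less_diff_conv)
      then show thesis using Suc.IH[of ?I ?b] Suc.prems(1) that by blast
    qed
    \<comment> \<open>Back substitution: the value at \<open>p\<close> is the one that solves
      equation \<open>J\<close>.\<close>
    define c' where "c' m = (if m = p then - (\<Sum>m\<in>?I. c m * a J m) / a J p else c m)" for m
    have split: "(\<Sum>m\<in>I. c' m * a i m) =
        - (\<Sum>m\<in>?I. c m * a J m) / a J p * a i p + (\<Sum>m\<in>?I. c m * a i m)" for i
      by (subst sum.remove[OF Suc.prems(1) p(1)]) (auto simp: c'_def intro!: sum.cong)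
    have "(\<Sum>m\<in>I. c' m * a i m) = 0" if "i < Suc J" for i
    proof (cases "i = J")
      case True
      then show ?thesis using p unfolding split by simp
    next
      case False
      then have "(\<Sum>m\<in>?I. c m * ?b i m) = 0" using c(2) that by simp
      moreover have "(\<Sum>m\<in>?I. c m * ?b i m) =
          (\<Sum>m\<in>?I. c m * a i m) - (\<Sum>m\<in>?I. c m * a J m) / a J p * a i p"
      proof -
        have "c m * ?b i m = c m * a i m - c m * a J m * (a i p / a J p)" for m
          by (simp add: right_diff_distrib)
        then show ?thesis by (simp add: sum_subtractf sum_distrib_right[symmetric] sum_divide_distrib[symmetric])
      qed
      ultimately show ?thesis unfolding split by simp
    qed
    moreover have "\<exists>m\<in>I. c' m \<noteq> 0" using c(1) by (auto simp: c'_def)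
    ultimately show ?thesis by blast
  qed
qed

lemma eigensystem_orthonormal:
  assumes "dirichlet_eigensystem \<kappa> \<Omega> lam \<phi>"
  shows "orthonormal_on \<Omega> \<phi> I"
  using assms by (auto simp: dirichlet_eigensystem_def orthonormal_on_def dirichlet_operator_def H10_def H1_def)

text \<open>Vanishing pointwise products make the Gram matrix diagonal.\<close>

lemma L2_inner_disjoint_lincomb:
  assumes "finite I" "\<And>m. m \<in> I \<Longrightarrow> f m \<in> L2 \<Omega>"
    and "\<And>m m' x. m \<in> I \<Longrightarrow> m' \<in> I \<Longrightarrow> m \<noteq> m' \<Longrightarrow> f m x * f m' x = 0"
  shows "L2_inner \<Omega> (\<lambda>x. \<Sum>m\<in>I. c m * f m x) (\<lambda>x. \<Sum>m\<in>I. c m * f m x) =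
    (\<Sum>m\<in>I. (c m)\<^sup>2 * L2_inner \<Omega> (f m) (f m))"
proof -
  have orth: "L2_inner \<Omega> (f m) (f m') = 0" if "m \<in> I" "m' \<in> I" "m \<noteq> m'" for m m'
  proof -
    have "(\<lambda>x. f m x * f m' x) = (\<lambda>_. 0)" using assms(3)[OF that] by blast
    then show ?thesis by (simp add: L2_inner_def)
  qed
  have "L2_inner \<Omega> (\<lambda>x. \<Sum>m\<in>I. c m * f m x) (\<lambda>x. \<Sum>m\<in>I. c m * f m x) =
      (\<Sum>m\<in>I. c m * (\<Sum>m'\<in>I. c m' * L2_inner \<Omega> (f m') (f m)))"
    using assms(2) by (simp add: L2_inner_lincomb_right L2_inner_lincomb_left L2_lincomb)
  also have "\<dots> = (\<Sum>m\<in>I. c m * (\<Sum>m'\<in>I. if m' = m then c m * L2_inner \<Omega> (f m) (f m) else 0))"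
    using orth by (intro sum.cong arg_cong2[of _ _ _ _ "(*)"]) auto
  finally show ?thesis using assms(1) by (simp add: power2_eq_square mult_ac)
qed

text \<open>A nonzero combination \<open>V\<close> of the trial functions is orthogonal to the first
  \<open>J\<close> eigenfunctions, so its Dirichlet energy \<open>E\<close> is at least
  \<open>lam J - \<kappa>\<^sup>2\<close> times its squared norm. Disjointness turns the bounds
  \<open>A\<close>, \<open>B\<close> for single functions into bounds for \<open>V\<close>; the
  factor \<open>CARD('n)\<close> counts the partial derivatives. Eigenvalues are numbered from 0,
  hence more than \<open>J\<close> trial functions.\<close>

lemma eigenvalue_le_rayleigh:
  fixes \<psi> :: "'i \<Rightarrow> real^'n::finite \<Rightarrow> real"
  assumes \<Omega>: "open \<Omega>" and eig: "dirichlet_eigensystem \<kappa> \<Omega> lam \<phi>"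
    and I: "finite I" "J < card I"
    and \<psi>: "\<And>m. m \<in> I \<Longrightarrow> \<psi> m \<in> test_functions \<Omega>"
    and disj: "\<And>m m' x. m \<in> I \<Longrightarrow> m' \<in> I \<Longrightarrow> m \<noteq> m' \<Longrightarrow> \<psi> m x * \<psi> m' x = 0"
    and disj': "\<And>m m' k x. m \<in> I \<Longrightarrow> m' \<in> I \<Longrightarrow> m \<noteq> m' \<Longrightarrow> partial_deriv k (\<psi> m) x * partial_deriv k (\<psi> m') x = 0"
    and A: "\<And>m k. m \<in> I \<Longrightarrow> L2_inner \<Omega> (partial_deriv k (\<psi> m)) (partial_deriv k (\<psi> m)) \<le> A"
    and B: "\<And>m. m \<in> I \<Longrightarrow> B \<le> L2_inner \<Omega> (\<psi> m) (\<psi> m)" "B > 0"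
  shows "lam J \<le> \<kappa>\<^sup>2 + real CARD('n) * A / B"
proof (rule ccontr)
  assume neg: "\<not> ?thesis"
  have ortho: "orthonormal_on \<Omega> \<phi> N" for N by (rule eigensystem_orthonormal[OF eig])
  have \<phi>10: "\<phi> j \<in> H10 \<Omega>" and \<phi>1: "\<phi> j \<in> H1 \<Omega>" and \<phi>L: "\<phi> j \<in> L2 \<Omega>" for j
    using eig by (auto simp: dirichlet_eigensystem_def dirichlet_operator_def H10_def H1_def)
  have \<psi>L: "\<psi> m \<in> L2 \<Omega>" "partial_deriv k (\<psi> m) \<in> L2 \<Omega>" if "m \<in> I" for m k
    using test_function_L2[OF \<psi>[OF that] \<Omega>] by auto
  have weak: "grad_inner \<Omega> (\<phi> j) v = lam j * L2_inner \<Omega> (\<phi> j) v - \<kappa>\<^sup>2 * L2_inner \<Omega> (\<phi> j) v"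
    if "v \<in> H10 \<Omega>" for j v
  proof -
    have "energy_form \<kappa> \<Omega> (\<phi> j) v = L2_inner \<Omega> (\<lambda>x. lam j * \<phi> j x) v"
      using eig that by (auto simp: dirichlet_eigensystem_def dirichlet_operator_def)
    then show ?thesis by (simp add: energy_form_def L2_inner_cmult_left)
  qed
  define p where "p k j x = weak_gradient \<Omega> (\<phi> j) x $ k" for k j x
  have pL: "p k j \<in> L2 \<Omega>" for k j
    unfolding p_def[abs_def] by (rule weak_gradient_L2[OF \<phi>1])
  have comp: "(\<integral>x. g x \<bullet> h x \<partial>lebesgue_on \<Omega>) = (\<Sum>k\<in>UNIV. L2_inner \<Omega> (\<lambda>x. g x $ k) (\<lambda>x. h x $ k))"
    if "\<And>k. (\<lambda>x. g x $ k) \<in> L2 \<Omega>" "\<And>k. (\<lambda>x. h x $ k) \<in> L2 \<Omega>" for g h :: "real^'n \<Rightarrow> real^'n"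
    unfolding L2_inner_def inner_vec_def inner_real_def
    by (rule Bochner_Integration.integral_sum) (intro L2_mult_integrable that)
  \<comment> \<open>The gradients of the eigenfunctions are orthogonal too, with squared lengths
    \<open>lam i - \<kappa>\<^sup>2\<close>.\<close>
  have pp: "(\<Sum>k\<in>UNIV. L2_inner \<Omega> (p k i) (p k j)) = (if i = j then lam i - \<kappa>\<^sup>2 else 0)" for i j
  proof -
    have "(\<Sum>k\<in>UNIV. L2_inner \<Omega> (p k i) (p k j)) = grad_inner \<Omega> (\<phi> i) (\<phi> j)"
      unfolding grad_inner_def p_def[abs_def] by (rule comp[symmetric]) (rule weak_gradient_L2[OF \<phi>1])+
    also have "\<dots> = (if i = j then lam i - \<kappa>\<^sup>2 else 0)"
      using weak[OF \<phi>10] orthonormal_onD(2)[OF ortho[of UNIV]] by simp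
    finally show ?thesis .
  qed
  have p\<psi>: "(\<Sum>k\<in>UNIV. L2_inner \<Omega> (partial_deriv k (\<psi> m)) (p k i)) = (lam i - \<kappa>\<^sup>2) * L2_inner \<Omega> (\<psi> m) (\<phi> i)"
    if m: "m \<in> I" for m i
  proof -
    have w: "is_weak_gradient \<Omega> (\<psi> m) (grad (\<psi> m))"
      by (rule test_function_weak_gradient[OF \<Omega> \<psi>[OF m]])
    have "grad_inner \<Omega> (\<phi> i) (\<psi> m) = (\<integral>x. weak_gradient \<Omega> (\<phi> i) x \<bullet> grad (\<psi> m) x \<partial>lebesgue_on \<Omega>)"
      using weak_gradient_L2[OF \<phi>1] weak_gradient_L2[OF test_function_H1[OF \<Omega> \<psi>[OF m]]] \<psi>L(2)[OF m]
      by (intro grad_inner_cong_AE weak_gradient_eq_AE[OF \<Omega> w]) (auto simp: grad_def)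
    also have "\<dots> = (\<Sum>k\<in>UNIV. L2_inner \<Omega> (p k i) (partial_deriv k (\<psi> m)))"
      using weak_gradient_L2[OF \<phi>1] \<psi>L(2)[OF m] by (subst comp) (auto simp: grad_def p_def[abs_def])
    finally show ?thesis
      using weak[OF test_function_H10[OF \<Omega> \<psi>[OF m]], of i]
      by (simp add: L2_inner_commute[of \<Omega> "\<phi> i"] L2_inner_commute[of \<Omega> "p k i" for k] left_diff_distrib)
  qed
  \<comment> \<open>\<open>J\<close> orthogonality conditions on more than \<open>J\<close>
    coefficients.\<close>
  obtain c where c: "\<exists>m\<in>I. c m \<noteq> 0" "\<forall>i<J. (\<Sum>m\<in>I. c m * L2_inner \<Omega> (\<psi> m) (\<phi> i)) = 0"
    using underdetermined_system[OF I, of "\<lambda>i m. L2_inner \<Omega> (\<psi> m) (\<phi> i)"] by auto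
  define V where "V x = (\<Sum>m\<in>I. c m * \<psi> m x)" for x
  define G where "G k x = (\<Sum>m\<in>I. c m * partial_deriv k (\<psi> m) x)" for k x
  define a where "a i = L2_inner \<Omega> V (\<phi> i)" for i
  have VL: "V \<in> L2 \<Omega>" unfolding V_def[abs_def] by (intro L2_lincomb \<psi>L)
  have GL: "G k \<in> L2 \<Omega>" for k unfolding G_def[abs_def] by (intro L2_lincomb \<psi>L)
  have a_eq: "a i = (\<Sum>m\<in>I. c m * L2_inner \<Omega> (\<psi> m) (\<phi> i))" for i
    unfolding a_def V_def[abs_def] by (intro L2_inner_lincomb_left \<psi>L \<phi>L)
  have Gp: "(\<Sum>k\<in>UNIV. L2_inner \<Omega> (G k) (p k i)) = (lam i - \<kappa>\<^sup>2) * a i" for i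
  proof -
    have "(\<Sum>k\<in>UNIV. L2_inner \<Omega> (G k) (p k i)) =
        (\<Sum>k\<in>UNIV. \<Sum>m\<in>I. c m * L2_inner \<Omega> (partial_deriv k (\<psi> m)) (p k i))"
      unfolding G_def[abs_def] by (intro sum.cong L2_inner_lincomb_left \<psi>L pL refl)
    also have "\<dots> = (\<Sum>m\<in>I. c m * (\<Sum>k\<in>UNIV. L2_inner \<Omega> (partial_deriv k (\<psi> m)) (p k i)))"
      by (subst sum.swap) (simp add: sum_distrib_left)
    finally show ?thesis using p\<psi> by (simp add: a_eq sum_distrib_left mult_ac)
  qed
  define E where "E = (\<Sum>k\<in>UNIV. L2_inner \<Omega> (G k) (G k))"
  \<comment> \<open>Bessel's inequality for gradients, obtained by expanding the squared distance of
    the gradient of \<open>V\<close> from the combination of the \<open>p k i\<close> with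
    coefficients \<open>a i\<close>. In this form there is no division by
    \<open>lam i - \<kappa>\<^sup>2\<close>.\<close>
  have E_ge: "(\<Sum>i<n. (a i)\<^sup>2 * (lam i - \<kappa>\<^sup>2)) \<le> E" for n
  proof -
    let ?S = "\<lambda>k x. \<Sum>i<n. a i * p k i x"
    have SL: "?S k \<in> L2 \<Omega>" for k by (intro L2_lincomb pL)
    have "0 \<le> (\<Sum>k\<in>UNIV. L2_inner \<Omega> (\<lambda>x. G k x - ?S k x) (\<lambda>x. G k x - ?S k x))"
      by (intro sum_nonneg L2_inner_self_nonneg)
    also have "\<dots> = (\<Sum>k\<in>UNIV. L2_inner \<Omega> (G k) (G k) - 2 * (\<Sum>i<n. a i * L2_inner \<Omega> (G k) (p k i))
        + (\<Sum>j<n. a j * (\<Sum>i<n. a i * L2_inner \<Omega> (p k i) (p k j))))"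
      using SL by (intro sum.cong) (simp_all add: L2_inner_self_diff[OF GL SL] L2_inner_lincomb_right
          L2_inner_lincomb_left pL GL)
    also have "\<dots> = E - 2 * (\<Sum>i<n. a i * (\<Sum>k\<in>UNIV. L2_inner \<Omega> (G k) (p k i)))
        + (\<Sum>j<n. a j * (\<Sum>i<n. a i * (\<Sum>k\<in>UNIV. L2_inner \<Omega> (p k i) (p k j))))"
      unfolding E_def sum.distrib sum_subtractf sum_distrib_left
      by (simp add: sum.swap[of _ UNIV "{..<n}"])
    also have "\<dots> = E - (\<Sum>i<n. (a i)\<^sup>2 * (lam i - \<kappa>\<^sup>2))"
      by (simp add: Gp pp if_distrib power2_eq_square mult_ac cong: if_cong)
    finally show ?thesis by simp
  qed
  have V2: "(\<Sum>i<n. (lam J - \<kappa>\<^sup>2) * (a i)\<^sup>2) \<le> E" for n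
  proof -
    \<comment> \<open>Indices below \<open>J\<close> have \<open>a i = 0\<close> by the choice of
      \<open>c\<close>; for the others \<open>lam\<close> is monotone.\<close>
    have "(lam J - \<kappa>\<^sup>2) * (a i)\<^sup>2 \<le> (a i)\<^sup>2 * (lam i - \<kappa>\<^sup>2)" for i
    proof (cases "i < J")
      case True
      then have "a i = 0" using c(2) a_eq by simp
      then show ?thesis by simp
    next
      case False
      then have "lam J \<le> lam i" using eig by (auto simp: dirichlet_eigensystem_def monoD)
      then have "(a i)\<^sup>2 * (lam J - \<kappa>\<^sup>2) \<le> (a i)\<^sup>2 * (lam i - \<kappa>\<^sup>2)" by (intro mult_left_mono) auto
      then show ?thesis by (simp add: mult.commute)
    qed
    then have "(\<Sum>i<n. (lam J - \<kappa>\<^sup>2) * (a i)\<^sup>2) \<le> (\<Sum>i<n. (a i)\<^sup>2 * (lam i - \<kappa>\<^sup>2))"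
      by (intro sum_mono)
    then show ?thesis using E_ge[of n] by linarith
  qed
  have lim: "(\<lambda>n. (\<Sum>i<n. (a i)\<^sup>2)) \<longlonglongrightarrow> L2_inner \<Omega> V V"
    using parseval[OF ortho VL] eig VL by (simp add: dirichlet_eigensystem_def sums_def a_def)
  have VE: "(lam J - \<kappa>\<^sup>2) * L2_inner \<Omega> V V \<le> E"
    using V2 by (intro LIMSEQ_le_const2[OF tendsto_mult_left[OF lim]]) (auto simp: sum_distrib_left)
  define S where "S = (\<Sum>m\<in>I. (c m)\<^sup>2)"
  have "S > 0"
  proof -
    obtain m where "m \<in> I" "c m \<noteq> 0" using c(1) by auto
    then have "0 < (c m)\<^sup>2" "(c m)\<^sup>2 \<le> S" unfolding S_def using I(1) by (auto intro: member_le_sum)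
    then show ?thesis by linarith
  qed
  have BS: "B * S \<le> L2_inner \<Omega> V V"
  proof -
    have "L2_inner \<Omega> V V = (\<Sum>m\<in>I. (c m)\<^sup>2 * L2_inner \<Omega> (\<psi> m) (\<psi> m))"
      unfolding V_def[abs_def] by (intro L2_inner_disjoint_lincomb I \<psi>L disj)
    also have "\<dots> \<ge> (\<Sum>m\<in>I. (c m)\<^sup>2 * B)" using B by (intro sum_mono mult_left_mono) auto
    finally show ?thesis by (simp add: S_def sum_distrib_left mult_ac)
  qed
  have ES: "E \<le> real CARD('n) * A * S"
  proof -
    have "L2_inner \<Omega> (G k) (G k) \<le> A * S" for k
    proof -
      have "L2_inner \<Omega> (G k) (G k) =
          (\<Sum>m\<in>I. (c m)\<^sup>2 * L2_inner \<Omega> (partial_deriv k (\<psi> m)) (partial_deriv k (\<psi> m)))"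
        unfolding G_def[abs_def] by (intro L2_inner_disjoint_lincomb I \<psi>L disj')
      also have "\<dots> \<le> (\<Sum>m\<in>I. (c m)\<^sup>2 * A)" using A by (intro sum_mono mult_left_mono) auto
      finally show ?thesis by (simp add: S_def sum_distrib_left mult_ac)
    qed
    then have "E \<le> (\<Sum>k\<in>(UNIV::'n set). A * S)" unfolding E_def by (intro sum_mono)
    then show ?thesis by simp
  qed
  \<comment> \<open>\<open>A\<close> dominates a squared norm. The negated claim then forces
    \<open>lam J > \<kappa>\<^sup>2\<close>, so \<open>BS\<close> may be multiplied by that
    difference.\<close>
  have "0 \<le> A"
    using c(1) A L2_inner_self_nonneg order_trans by blast
  then have "0 \<le> real CARD('n) * A / B" using B(2) by simp
  then have "(lam J - \<kappa>\<^sup>2) * (B * S) \<le> (lam J - \<kappa>\<^sup>2) * L2_inner \<Omega> V V"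
    using neg BS by (intro mult_left_mono) auto
  then have "((lam J - \<kappa>\<^sup>2) * B) * S \<le> (real CARD('n) * A) * S"
    using VE ES by (simp only: mult.assoc)
  then have "(lam J - \<kappa>\<^sup>2) * B \<le> real CARD('n) * A" using \<open>S > 0\<close> by (rule mult_right_le_imp_le)
  then have "lam J - \<kappa>\<^sup>2 \<le> real CARD('n) * A / B" using B(2) by (simp add: field_simps)
  then show False using neg by simp
qed

section \<open>Quantitative bounds for the bump profile\<close>

lemma deriv_bump_eq_0:
  assumes "r > 0" "x \<le> a \<or> b \<le> x"
  shows "deriv (bump r a b) x = 0"
\<comment> \<open>Where the nonnegative bump vanishes it has a minimum, so no formula for the
  derivative is needed.\<close>
proof (rule DERIV_local_min[OF Cinf_derivative(1)[OF Cinf_bump]])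
  show "\<forall>y. \<bar>x - y\<bar> < 1 \<longrightarrow> bump r a b x \<le> bump r a b y"
    using assms bump_eq_0_iff[of r a b x] bump_bounds(1) by simp
qed simp

lemma bump_rescale: "s > 0 \<Longrightarrow> bump (1 / s) p (p + s) x = bump 1 0 1 ((x - p) / s)"
  by (simp add: bump_def field_simps)

lemma deriv_bump_rescale:
  assumes "s > 0"
  shows "deriv (bump (1 / s) p (p + s)) x = deriv (bump 1 0 1) ((x - p) / s) / s"
proof (rule DERIV_imp_deriv)
  have "((\<lambda>x. (x - p) / s) has_real_derivative 1 / s) (at x)"
    using assms by (auto intro!: derivative_eq_intros)
  from DERIV_chain2[OF Cinf_derivative(1)[OF Cinf_bump] this]
  have "((\<lambda>x. bump 1 0 1 ((x - p) / s)) has_real_derivative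
      deriv (bump 1 0 1) ((x - p) / s) * (1 / s)) (at x)" .
  moreover have "bump (1 / s) p (p + s) = (\<lambda>x. bump 1 0 1 ((x - p) / s))"
    using bump_rescale[OF assms] by blast
  ultimately show "(bump (1 / s) p (p + s) has_real_derivative deriv (bump 1 0 1) ((x - p) / s) / s) (at x)"
    by simp
qed

lemma deriv_bump_bounded: "\<exists>M>0. \<forall>x. \<bar>deriv (bump 1 0 1) x\<bar> \<le> M"
proof -
  let ?D = "deriv (bump 1 0 1)"
  have "continuous_on {0..1} ?D"
    by (rule DERIV_continuous_on[OF DERIV_subset[OF Cinf_derivative(1)[OF Cinf_derivative(2)[OF Cinf_bump]]]]) simp
  then have "bounded (?D ` {0..1})" by (intro compact_imp_bounded compact_continuous_image) auto
  then obtain M where "\<forall>y\<in>?D ` {0..1}. norm y \<le> M" unfolding bounded_iff by blast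
  then have M: "\<bar>?D x\<bar> \<le> M" if "x \<in> {0..1}" for x using that by simp
  have "\<bar>?D x\<bar> \<le> max M 1" for x
    using M[of x] deriv_bump_eq_0[of 1 x 0 1] by (cases "x \<in> {0..1}") (auto simp: not_le)
  then show ?thesis by (intro exI[of _ "max M 1"]) auto
qed

text \<open>On the middle half of the interval both arguments of \<open>flat_exp 1\<close> are at
  least 1/4, so each factor is at least exp(-4).\<close>

lemma bump_middle_ge:
  assumes "s > 0" "p + s / 4 \<le> x" "x \<le> p + 3 * s / 4"
  shows "exp (- 8) \<le> bump (1 / s) p (p + s) x"
proof -
  have flat: "exp (- 4) \<le> flat_exp 1 y" if "y \<ge> 1 / 4" for y
    using that by (auto simp: flat_exp_def field_simps)
  have "exp (- 4) * exp (- 4 :: real) \<le> bump (1 / s) p (p + s) x"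
    unfolding bump_def using assms
    by (intro mult_mono flat) (auto simp: flat_1_bounds field_simps)
  then show ?thesis by (simp add: exp_add[symmetric])
qed

section \<open>Volume bounds for squared norms over boxes\<close>

lemma L2_inner_self_le_content:
  assumes \<Omega>: "open \<Omega>" and f: "f \<in> L2 \<Omega>" and b: "\<And>x. \<bar>f x\<bar> \<le> K * indicator (cbox a b) x"
  shows "L2_inner \<Omega> f f \<le> K\<^sup>2 * measure lborel (cbox a b)"
proof -
  have "(\<integral>x. indicator \<Omega> x * (f x * f x) \<partial>lebesgue) \<le> (\<integral>x. K\<^sup>2 * indicator (cbox a b) x \<partial>lebesgue)"
  proof (rule integral_mono)
    show "integrable lebesgue (\<lambda>x. indicator \<Omega> x * (f x * f x))"
      using L2_mult_integrable[OF f f] by (simp add: integrable_lebesgue_on_open[OF \<Omega>])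
    show "integrable lebesgue (\<lambda>x. K\<^sup>2 * indicator (cbox a b) x)"
      using borel_integrable_compact[OF compact_cbox, of a b "\<lambda>_. K\<^sup>2"]
      by (simp add: integrable_completion mult.commute)
    fix x
    have "(f x)\<^sup>2 \<le> (K * indicator (cbox a b) x)\<^sup>2"
      using b[of x] by (metis abs_ge_zero power2_abs power_mono)
    then have "f x * f x \<le> K\<^sup>2 * indicator (cbox a b) x" 
      by (auto simp: power2_eq_square indicator_def split: if_splits)
    then show "indicator \<Omega> x * (f x * f x) \<le> K\<^sup>2 * indicator (cbox a b) x"
      by (auto simp: indicator_def split: if_splits)
  qed
  also have "\<dots> = K\<^sup>2 * measure lborel (cbox a b)" by simp
  finally show ?thesis by (simp add: L2_inner_def integral_lebesgue_on_open[OF \<Omega>])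
qed

lemma L2_inner_self_ge_content:
  assumes \<Omega>: "open \<Omega>" and f: "f \<in> L2 \<Omega>" and ab: "cbox a b \<subseteq> \<Omega>"
    and b: "\<And>x. x \<in> cbox a b \<Longrightarrow> K \<le> f x" "K \<ge> 0"
  shows "K\<^sup>2 * measure lborel (cbox a b) \<le> L2_inner \<Omega> f f"
proof -
  have "K\<^sup>2 * measure lborel (cbox a b) = (\<integral>x. K\<^sup>2 * indicator (cbox a b) x \<partial>lebesgue)" by simp
  also have "\<dots> \<le> (\<integral>x. indicator \<Omega> x * (f x * f x) \<partial>lebesgue)"
  proof (rule integral_mono)
    show "integrable lebesgue (\<lambda>x. indicator \<Omega> x * (f x * f x))"
      using L2_mult_integrable[OF f f] by (simp add: integrable_lebesgue_on_open[OF \<Omega>])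
    show "integrable lebesgue (\<lambda>x. K\<^sup>2 * indicator (cbox a b) x)"
      using borel_integrable_compact[OF compact_cbox, of a b "\<lambda>_. K\<^sup>2"]
      by (simp add: integrable_completion mult.commute)
    fix x
    have "x \<in> cbox a b \<Longrightarrow> K * K \<le> f x * f x" using b by (intro mult_mono) force+
    then show "K\<^sup>2 * indicator (cbox a b) x \<le> indicator \<Omega> x * (f x * f x)"
      using ab by (auto simp: indicator_def power2_eq_square)
  qed
  finally show ?thesis by (simp add: L2_inner_def integral_lebesgue_on_open[OF \<Omega>])
qed

lemma content_cube:
  fixes p :: "real^'n::finite"
  assumes "s \<ge> 0"
  shows "measure lborel (cbox p (\<chi> i. p $ i + s)) = s ^ CARD('n)"
proof -
  have "cbox p (\<chi> i. p $ i + s) \<noteq> {}"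
    using assms by (simp add: interval_ne_empty_cart)
  then show ?thesis by (simp add: content_cbox_cart)
qed

lemma open_contains_cube:
  fixes \<Omega> :: "(real^'n::finite) set"
  assumes "open \<Omega>" "\<Omega> \<noteq> {}"
  obtains a l where "l > 0" "cbox a (\<chi> i. a $ i + l) \<subseteq> \<Omega>"
proof -
  obtain x where "x \<in> \<Omega>" using assms by auto
  then obtain a b where ab: "cbox a b \<subseteq> \<Omega>" "x \<in> box a b"
    using open_contains_cbox[OF assms(1)] by metis
  let ?l = "Min (range (\<lambda>i. b $ i - a $ i))"
  have "?l > 0" using ab(2) by (subst Min_gr_iff) (auto simp: mem_box_cart intro: less_trans)
  moreover have "cbox a (\<chi> i. a $ i + ?l) \<subseteq> cbox a b"
  proof
    fix y assume y: "y \<in> cbox a (\<chi> i. a $ i + ?l)"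
    have "?l \<le> b $ i - a $ i" for i by (intro Min_le) auto
    moreover have "a $ i \<le> y $ i \<and> y $ i \<le> a $ i + ?l" for i using y by (auto simp: mem_box_cart)
    ultimately have "a $ i \<le> y $ i \<and> y $ i \<le> b $ i" for i by (smt (verit, best))
    then show "y \<in> cbox a b" by (auto simp: mem_box_cart)
  qed
  ultimately show thesis using that[of ?l a] ab(1) by blast
qed

text \<open>One bump function in each of \<open>m\<^sup>d\<close> congruent cubes; \<open>lam (m\<^sup>d - 1)\<close> is the eigenvalue with
  number \<open>m\<^sup>d\<close>, as the enumeration starts at 0.\<close>

lemma weyl_upper_bound:
  fixes \<Omega> :: "(real^'n::finite) set"
  assumes \<Omega>: "open \<Omega>" "\<Omega> \<noteq> {}" and eig: "dirichlet_eigensystem \<kappa> \<Omega> lam \<phi>"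
  shows "\<exists>C>0. \<forall>m\<ge>1. lam (m ^ CARD('n) - 1) \<le> C * (real m)\<^sup>2"
proof -
  let ?d = "CARD('n)"
  obtain a l where l: "l > 0" "cbox a (\<chi> i. a $ i + l) \<subseteq> \<Omega>" using open_contains_cube[OF \<Omega>] .
  obtain M where M: "M > 0" "\<And>x. \<bar>deriv (bump 1 0 1) x\<bar> \<le> M" using deriv_bump_bounded by auto
  \<comment> \<open>The value of \<open>?d * A / B * s\<^sup>2\<close> for the constants
    \<open>A\<close> and \<open>B\<close> below; the side length \<open>s\<close> cancels.\<close>
  define C0 where "C0 = real ?d * M\<^sup>2 * 2 ^ ?d / (exp (- 8) ^ ?d)\<^sup>2"
  have C0: "C0 > 0" using M(1) by (simp add: C0_def)
  have "lam (m ^ ?d - 1) \<le> (\<kappa>\<^sup>2 + C0 / l\<^sup>2) * (real m)\<^sup>2" if m: "m \<ge> 1" for m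
  proof -
    define s where "s = l / real m"
    have s: "s > 0" using l m by (simp add: s_def)
    define I where "I = PiE (UNIV :: 'n set) (\<lambda>_. {..<m})"
    have I: "finite I" "card I = m ^ ?d" by (auto simp: I_def finite_PiE card_PiE)
    \<comment> \<open>The multi-index \<open>\<alpha>\<close> labels a cube of the grid;
      \<open>p \<alpha>\<close> and \<open>q \<alpha>\<close> are its lower and upper
      corners.\<close>
    define p :: "('n \<Rightarrow> nat) \<Rightarrow> real^'n" where "p \<alpha> = (\<chi> i. a $ i + s * real (\<alpha> i))" for \<alpha>
    define q where "q \<alpha> = (\<chi> i. p \<alpha> $ i + s)" for \<alpha>
    define \<psi> where "\<psi> \<alpha> = tensor (\<lambda>i. bump (1 / s) (p \<alpha> $ i) (q \<alpha> $ i))" for \<alpha>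
    have pq: "cbox (p \<alpha>) (q \<alpha>) \<subseteq> \<Omega>" if "\<alpha> \<in> I" for \<alpha>
    proof (rule order_trans[OF _ l(2)], rule subsetI)
      fix x assume x: "x \<in> cbox (p \<alpha>) (q \<alpha>)"
      have "a $ i \<le> x $ i \<and> x $ i \<le> a $ i + l" for i
      proof -
        have "\<alpha> i < m" using that by (auto simp: I_def PiE_iff)
        then have "real (\<alpha> i) + 1 \<le> real m" by linarith
        then have "s * (real (\<alpha> i) + 1) \<le> l" 
          using s m mult_left_mono[of "real (\<alpha> i) + 1" "real m" s] by (simp add: s_def)
        moreover have "0 \<le> s * real (\<alpha> i)" using s by (intro mult_nonneg_nonneg) auto
        moreover have "p \<alpha> $ i \<le> x $ i \<and> x $ i \<le> q \<alpha> $ i" using x by (auto simp: mem_box_cart)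
        ultimately show ?thesis
          unfolding p_def q_def distrib_left vec_lambda_beta mult_1_right by linarith
      qed
      then show "x \<in> cbox a (\<chi> i. a $ i + l)" by (auto simp: mem_box_cart)
    qed
    have test: "\<psi> \<alpha> \<in> test_functions \<Omega>" if "\<alpha> \<in> I" for \<alpha>
      unfolding \<psi>_def using s pq[OF that] by (intro tensor_bump_test_function) auto
    have pd: "partial_deriv k (\<psi> \<alpha>) x =
        deriv (bump (1 / s) (p \<alpha> $ k) (q \<alpha> $ k)) (x $ k) *
        (\<Prod>i\<in>UNIV - {k}. bump (1 / s) (p \<alpha> $ i) (q \<alpha> $ i) (x $ i))" for k \<alpha> x
      unfolding \<psi>_def partial_deriv_tensor[OF Cinf_bump] tensor_def
      by (subst prod.remove[of UNIV k]) auto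
    have pd_zero: "partial_deriv k (\<psi> \<alpha>) x = 0" if x: "x \<notin> box (p \<alpha>) (q \<alpha>)" for k \<alpha> x
    proof -
      obtain i where i: "x $ i \<le> p \<alpha> $ i \<or> q \<alpha> $ i \<le> x $ i"
        using x by (auto simp: mem_box_cart not_less)
      show ?thesis
      proof (cases "i = k")
        case True
        then show ?thesis using i s by (simp add: pd deriv_bump_eq_0)
      next
        case False
        then have "(\<Prod>i\<in>UNIV - {k}. bump (1 / s) (p \<alpha> $ i) (q \<alpha> $ i) (x $ i)) = 0"
          using i s by (intro prod_zero) (auto simp: bump_eq_0_iff)
        then show ?thesis by (simp add: pd)
      qed
    qed
    have \<psi>_zero: "\<psi> \<alpha> x = 0" if "x \<notin> box (p \<alpha>) (q \<alpha>)" for \<alpha> x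
      using tensor_bump_nonzero[of "1 / s" "p \<alpha>" "q \<alpha>" x] s that by (auto simp: \<psi>_def)
    \<comment> \<open>Neighbouring closed cubes share faces, but the open ones are disjoint, and the
      bumps and their derivatives vanish off the open cubes.\<close>
    have box_disj: "x \<notin> box (p \<alpha>) (q \<alpha>) \<or> x \<notin> box (p \<beta>) (q \<beta>)" if ab: "\<alpha> \<noteq> \<beta>" for \<alpha> \<beta> x
    proof -
      have "\<not> (x \<in> box (p \<alpha>) (q \<alpha>) \<and> x \<in> box (p \<beta>) (q \<beta>))" if "\<alpha> i < \<beta> i" for \<alpha> \<beta> i
      proof
        assume "x \<in> box (p \<alpha>) (q \<alpha>) \<and> x \<in> box (p \<beta>) (q \<beta>)"
        then have "x $ i < q \<alpha> $ i" "p \<beta> $ i < x $ i" by (auto simp: mem_box_cart)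
        then have "s * real (\<beta> i) < s * (real (\<alpha> i) + 1)" by (simp add: p_def q_def distrib_left)
        then show False using s that by simp
      qed
      moreover obtain i where "\<alpha> i < \<beta> i \<or> \<beta> i < \<alpha> i" using ab by (meson ext linorder_neqE_nat)
      ultimately show ?thesis by blast
    qed
    \<comment> \<open>\<open>A\<close> is the squared derivative bound times the volume of a cube.
      \<open>B\<close> uses only the concentric cube of side \<open>s / 2\<close>, on which every
      factor of the bump is at least exp(-8).\<close>
    define A where "A = (M / s)\<^sup>2 * s ^ ?d"
    define B where "B = (exp (- 8) ^ ?d)\<^sup>2 * (s / 2) ^ ?d"
    have "lam (m ^ ?d - 1) \<le> \<kappa>\<^sup>2 + real ?d * A / B"
    proof (rule eigenvalue_le_rayleigh[OF \<Omega>(1) eig I(1) _ test])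
      show "m ^ ?d - 1 < card I" using m I(2) by simp
      show "\<psi> \<alpha> x * \<psi> \<beta> x = 0" if "\<alpha> \<noteq> \<beta>" for \<alpha> \<beta> x
        using box_disj[OF that, of x] \<psi>_zero by auto
      show "partial_deriv k (\<psi> \<alpha>) x * partial_deriv k (\<psi> \<beta>) x = 0" if "\<alpha> \<noteq> \<beta>" for \<alpha> \<beta> k x
        using box_disj[OF that, of x] pd_zero by auto
      show "B > 0" using s by (simp add: B_def)
      fix \<alpha> assume \<alpha>: "\<alpha> \<in> I"
      show "L2_inner \<Omega> (partial_deriv k (\<psi> \<alpha>)) (partial_deriv k (\<psi> \<alpha>)) \<le> A" for k
      proof -
        have "\<bar>partial_deriv k (\<psi> \<alpha>) x\<bar> \<le> M / s * indicator (cbox (p \<alpha>) (q \<alpha>)) x" for x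
        proof (cases "x \<in> cbox (p \<alpha>) (q \<alpha>)")
          case True
          have "\<bar>deriv (bump (1 / s) (p \<alpha> $ k) (q \<alpha> $ k)) (x $ k)\<bar> \<le> M / s"
            using s M(2) by (simp add: q_def deriv_bump_rescale divide_right_mono)
          moreover have "0 \<le> (\<Prod>i\<in>UNIV - {k}. bump (1 / s) (p \<alpha> $ i) (q \<alpha> $ i) (x $ i))"
            "(\<Prod>i\<in>UNIV - {k}. bump (1 / s) (p \<alpha> $ i) (q \<alpha> $ i) (x $ i)) \<le> 1"
            by (auto intro!: prod_nonneg prod_le_1 simp: bump_bounds)
          ultimately have "\<bar>partial_deriv k (\<psi> \<alpha>) x\<bar> \<le> M / s * 1"
            unfolding pd abs_mult by (intro mult_mono) auto
          then show ?thesis using True by simp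
        next
          case False
          then show ?thesis using pd_zero[of x \<alpha> k] box_subset_cbox[of "p \<alpha>" "q \<alpha>"] by auto
        qed
        then have "L2_inner \<Omega> (partial_deriv k (\<psi> \<alpha>)) (partial_deriv k (\<psi> \<alpha>)) \<le>
            (M / s)\<^sup>2 * measure lborel (cbox (p \<alpha>) (q \<alpha>))"
          by (intro L2_inner_self_le_content \<Omega> test_function_L2[OF test[OF \<alpha>] \<Omega>(1)])
        then show ?thesis using s by (simp add: A_def q_def content_cube)
      qed
      show "B \<le> L2_inner \<Omega> (\<psi> \<alpha>) (\<psi> \<alpha>)"
      proof -
        define u where "u = (\<chi> i. p \<alpha> $ i + s / 4)"
        define v where "v = (\<chi> i. u $ i + s / 2)"
        have "cbox u v \<subseteq> cbox (p \<alpha>) (q \<alpha>)"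
          using s by (intro subset_interval_imp_cart(1)) (auto simp: u_def v_def q_def)
        then have uv: "cbox u v \<subseteq> \<Omega>" using pq[OF \<alpha>] by blast
        have "exp (- 8) ^ ?d \<le> \<psi> \<alpha> x" if "x \<in> cbox u v" for x
        proof -
          have "u $ i \<le> x $ i \<and> x $ i \<le> v $ i" for i using that by (auto simp: mem_box_cart)
          then have "exp (- 8) \<le> bump (1 / s) (p \<alpha> $ i) (q \<alpha> $ i) (x $ i)" for i
            using bump_middle_ge[OF s, of "p \<alpha> $ i" "x $ i"] by (simp add: u_def v_def q_def field_simps)
          then have "(\<Prod>i\<in>(UNIV :: 'n set). exp (- 8 :: real)) \<le> \<psi> \<alpha> x"
            unfolding \<psi>_def tensor_def by (intro prod_mono) auto
          then show ?thesis by simp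
        qed
        then have "(exp (- 8) ^ ?d)\<^sup>2 * measure lborel (cbox u v) \<le> L2_inner \<Omega> (\<psi> \<alpha>) (\<psi> \<alpha>)"
          by (intro L2_inner_self_ge_content \<Omega> test_function_L2[OF test[OF \<alpha>] \<Omega>(1)] uv) auto
        then show ?thesis using s by (simp add: B_def v_def content_cube)
      qed
    qed
    also have "real ?d * A / B = C0 / s\<^sup>2"
      using s by (simp add: A_def B_def C0_def field_simps power_divide)
    also have "C0 / s\<^sup>2 = C0 / l\<^sup>2 * (real m)\<^sup>2" using l m by (simp add: s_def power_divide)
    \<comment> \<open>The zeroth-order term is absorbed because \<open>m \<ge> 1\<close>.\<close>
    also have "\<kappa>\<^sup>2 + C0 / l\<^sup>2 * (real m)\<^sup>2 \<le> (\<kappa>\<^sup>2 + C0 / l\<^sup>2) * (real m)\<^sup>2"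
      using m by (simp add: distrib_right mult_le_cancel_left1)
    finally show ?thesis .
  qed
  moreover have "\<kappa>\<^sup>2 + C0 / l\<^sup>2 > 0" using C0 l by (simp add: add_nonneg_pos)
  ultimately show ?thesis by blast
qed


section \<open>Piecewise polynomial spaces\<close>

text \<open>As the interior of the closure is \<open>K\<close>, the difference is the frontier of a
  finite union of convex polytopes, and frontiers of convex sets are null. Thus open cells fill the
  domain up to a null set.\<close>

lemma open_polytope_boundary_null:
  fixes K :: "(real^'n::finite) set"
  assumes "open_polytope K"
  shows "closure K - K \<in> null_sets lebesgue"
proof -
  obtain F where F: "finite F" "\<And>p. p \<in> F \<Longrightarrow> polytope p" "closure K = \<Union>F" "interior (closure K) = K"
    using assms unfolding open_polytope_def by blast
  have "closure K - K = frontier (closure K)"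
    using F(4) by (simp add: frontier_def)
  also have "\<dots> \<subseteq> (\<Union>p\<in>F. frontier p)" unfolding F(3) by (rule frontier_Union_subset[OF F(1)])
  finally have "negligible (closure K - K)"
    using F(1,2) by (elim negligible_subset[rotated])
      (auto intro!: negligible_Union negligible_convex_frontier polytope_imp_convex)
  then show ?thesis by (simp add: negligible_iff_null_sets)
qed

lemma finite_multi_indices: "finite {\<alpha> :: 'n::finite \<Rightarrow> nat. (\<Sum>i\<in>UNIV. \<alpha> i) \<le> k}"
proof (rule finite_subset)
  show "{\<alpha> :: 'n \<Rightarrow> nat. (\<Sum>i\<in>UNIV. \<alpha> i) \<le> k} \<subseteq> PiE UNIV (\<lambda>_. {..k})"
  proof
    fix \<alpha> :: "'n \<Rightarrow> nat" assume "\<alpha> \<in> {\<alpha>. (\<Sum>i\<in>UNIV. \<alpha> i) \<le> k}"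
    then have "\<alpha> i \<le> k" for i using member_le_sum[of i UNIV \<alpha>] by auto
    then show "\<alpha> \<in> PiE UNIV (\<lambda>_. {..k})" by (auto simp: PiE_iff)
  qed
qed (simp add: finite_PiE)

text \<open>The spanning family of \<open>dg_space\<close>, indexed by a cell and a multi-index; the
  number of such pairs takes the place of the dimension.\<close>

definition cell_monomial :: "(real^'n::finite) set \<times> ('n \<Rightarrow> nat) \<Rightarrow> real^'n \<Rightarrow> real" where
  "cell_monomial = (\<lambda>(K, \<alpha>) x. indicator K x * (\<Prod>i\<in>UNIV. (x $ i) ^ \<alpha> i))"

lemma cell_monomial_L2:
  fixes \<Omega> :: "(real^'n::finite) set"
  assumes "open K" "K \<subseteq> \<Omega>" "open \<Omega>" "bounded \<Omega>"
  shows "cell_monomial (K, \<alpha>) \<in> L2 \<Omega>"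
proof -
  obtain R where R: "\<forall>x\<in>\<Omega>. norm x \<le> R" using assms(4) unfolding bounded_iff by blast
  show ?thesis
  proof (rule L2_bounded_support[OF _ _ assms(4,3)])
    have "(\<lambda>x :: real^'n. \<Prod>i\<in>UNIV. (x $ i) ^ \<alpha> i) \<in> borel_measurable borel"
      by (intro borel_measurable_continuous_onI continuous_intros)
    then show "cell_monomial (K, \<alpha>) \<in> borel_measurable borel"
      using assms(1) unfolding cell_monomial_def prod.case
      by (intro borel_measurable_times borel_measurable_indicator) auto
    show "\<bar>cell_monomial (K, \<alpha>) x\<bar> \<le> (\<Prod>i\<in>UNIV. \<bar>R\<bar> ^ \<alpha> i)" for x
    proof (cases "x \<in> K")
      case True
      then have "norm x \<le> R" using R assms(2) by blast
      then have "\<bar>x $ i\<bar> \<le> \<bar>R\<bar>" for i using component_le_norm_cart[of x i] by linarith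
      then have "\<bar>\<Prod>i\<in>UNIV. (x $ i) ^ \<alpha> i\<bar> \<le> (\<Prod>i\<in>UNIV. \<bar>R\<bar> ^ \<alpha> i)"
        unfolding abs_prod by (intro prod_mono) (auto simp: power_abs intro!: power_mono)
      then show ?thesis using True by (simp add: cell_monomial_def)
    next
      case False
      then show ?thesis by (simp add: cell_monomial_def prod_nonneg)
    qed
  qed
qed

text \<open>Almost every point lies in exactly one open cell, so of the double sum only the
  monomials of that cell survive there.\<close>

lemma dg_space_lincomb:
  fixes \<Omega> :: "(real^'n::finite) set"
  assumes mesh: "polytopic_mesh \<Omega> \<T>" and \<Omega>: "open \<Omega>" and v: "v \<in> dg_space \<Omega> k \<T>"
  shows "\<exists>c. AE x in lebesgue_on \<Omega>. v x =
    (\<Sum>i\<in>\<T> \<times> {\<alpha>. (\<Sum>i\<in>UNIV. \<alpha> i) \<le> k}. c i * cell_monomial i x)"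
proof -
  let ?I = "{\<alpha> :: 'n \<Rightarrow> nat. (\<Sum>i\<in>UNIV. \<alpha> i) \<le> k}"
  have \<T>: "finite \<T>" "\<And>K. K \<in> \<T> \<Longrightarrow> open_polytope K" "pairwise disjnt \<T>" "closure \<Omega> = (\<Union>K\<in>\<T>. closure K)"
    using mesh by (auto simp: polytopic_mesh_def)
  have "\<forall>K\<in>\<T>. \<exists>c. AE x in lebesgue_on K. v x = (\<Sum>\<alpha>\<in>?I. c \<alpha> * (\<Prod>i\<in>UNIV. (x $ i) ^ \<alpha> i))"
  proof
    fix K assume K: "K \<in> \<T>"
    obtain p where p: "poly_le k p" "AE x in lebesgue_on K. v x = p x"
      using v K unfolding dg_space_def by blast
    obtain c where "\<And>x. p x = (\<Sum>\<alpha>\<in>?I. c \<alpha> * (\<Prod>i\<in>UNIV. (x $ i) ^ \<alpha> i))"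
      using p(1) unfolding poly_le_def by blast
    with p(2) show "\<exists>c. AE x in lebesgue_on K. v x = (\<Sum>\<alpha>\<in>?I. c \<alpha> * (\<Prod>i\<in>UNIV. (x $ i) ^ \<alpha> i))"
      by (intro exI[of _ c]) simp
  qed
  from bchoice[OF this] obtain c where c: "\<And>K. K \<in> \<T> \<Longrightarrow>
      AE x in lebesgue_on K. v x = (\<Sum>\<alpha>\<in>?I. c K \<alpha> * (\<Prod>i\<in>UNIV. (x $ i) ^ \<alpha> i))"
    by blast
  have "AE x in lebesgue. x \<in> K \<longrightarrow> v x = (\<Sum>\<alpha>\<in>?I. c K \<alpha> * (\<Prod>i\<in>UNIV. (x $ i) ^ \<alpha> i))"
    if "K \<in> \<T>" for K
    using c[OF that] \<T>(2)[OF that] by (subst (asm) AE_restrict_space_iff) (auto simp: open_polytope_def)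
  then have 1: "AE x in lebesgue. \<forall>K\<in>\<T>. x \<in> K \<longrightarrow> v x = (\<Sum>\<alpha>\<in>?I. c K \<alpha> * (\<Prod>i\<in>UNIV. (x $ i) ^ \<alpha> i))"
    using \<T>(1) by (intro AE_finite_allI)
  \<comment> \<open>Off these null sets a point of \<open>\<Omega>\<close>, which lies in some
    closed cell, lies in the open cell.\<close>
  have 2: "AE x in lebesgue. \<forall>K\<in>\<T>. x \<notin> closure K - K"
    using \<T>(1,2) by (intro AE_finite_allI AE_not_in open_polytope_boundary_null)
  have "AE x in lebesgue. x \<in> \<Omega> \<longrightarrow>
      v x = (\<Sum>i\<in>\<T> \<times> ?I. (\<lambda>(K, \<alpha>). c K \<alpha>) i * cell_monomial i x)"
    using 1 2
  proof eventually_elim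
    case (elim x)
    show ?case
    proof
      assume "x \<in> \<Omega>"
      then obtain K where K: "K \<in> \<T>" "x \<in> K" using \<T>(4) closure_subset elim(2) by blast
      have other: "x \<notin> K'" if "K' \<in> \<T>" "K' \<noteq> K" for K'
        using \<T>(3) K that unfolding pairwise_def disjnt_def by blast
      have "(\<Sum>i\<in>\<T> \<times> ?I. (\<lambda>(K, \<alpha>). c K \<alpha>) i * cell_monomial i x) =
          (\<Sum>K'\<in>\<T>. \<Sum>\<alpha>\<in>?I. c K' \<alpha> * cell_monomial (K', \<alpha>) x)"
        by (simp add: sum.cartesian_product case_prod_unfold)
      also have "\<dots> = (\<Sum>K'\<in>\<T>. if K' = K then \<Sum>\<alpha>\<in>?I. c K \<alpha> * (\<Prod>i\<in>UNIV. (x $ i) ^ \<alpha> i) else 0)"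
        using other K by (intro sum.cong) (auto simp: cell_monomial_def intro!: sum.cong sum.neutral)
      also have "\<dots> = v x" using K \<T>(1) elim(1) by simp
      finally show "v x = (\<Sum>i\<in>\<T> \<times> ?I. (\<lambda>(K, \<alpha>). c K \<alpha>) i * cell_monomial i x)" by simp
    qed
  qed
  then show ?thesis using \<Omega> by (subst AE_restrict_space_iff) auto
qed

section \<open>Mesh size and number of cells\<close>

lemma mesh_size_bounds:
  fixes \<Omega> :: "(real^'n::finite) set"
  assumes mesh: "polytopic_mesh \<Omega> \<T>" and \<Omega>: "\<Omega> \<noteq> {}" "bounded \<Omega>"
  shows "0 < mesh_size \<T>" "mesh_size \<T> \<le> diameter \<Omega>"
proof -
  \<comment> \<open>The mesh covers a nonempty set, so it is nonempty and the \<open>Max\<close> in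
    \<open>mesh_size\<close> is attained.\<close>
  have \<T>: "finite \<T>" "\<T> \<noteq> {}" "\<And>K. K \<in> \<T> \<Longrightarrow> open_polytope K \<and> K \<subseteq> \<Omega>"
    using mesh \<Omega> closure_subset[of \<Omega>] by (auto simp: polytopic_mesh_def)
  then obtain K where K: "K \<in> \<T>" "mesh_size \<T> = diameter K"
    unfolding mesh_size_def by (metis (no_types, lifting) Max_in finite_imageI image_iff image_is_empty)
  have bK: "bounded K" "K \<subseteq> \<Omega>" using \<T>(3)[OF K(1)] \<Omega>(2) bounded_subset by auto
  obtain x e where "e > 0" "ball x e \<subseteq> K"
    using \<T>(3)[OF K(1)] unfolding open_polytope_def by (metis open_contains_ball ex_in_conv)
  then have "2 * e \<le> diameter K" using diameter_subset[of "ball x e" K] bK(1) by simp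
  with \<open>e > 0\<close> show "0 < mesh_size \<T>" using K(2) by simp
  show "mesh_size \<T> \<le> diameter \<Omega>" using K(2) diameter_subset[OF bK(2) \<Omega>(2)] by simp
qed

lemma card_mesh_le:
  fixes \<Omega> :: "(real^'n::finite) set"
  assumes mesh: "polytopic_mesh \<Omega> \<T>" "regular_mesh \<theta> q \<T>" and \<Omega>: "\<Omega> \<noteq> {}" "bounded \<Omega>" "open \<Omega>"
    and pos: "0 < \<theta>" "0 < q"
  shows "real (card \<T>) * (unit_ball_vol (real CARD('n)) * (\<theta> * q * mesh_size \<T>) ^ CARD('n)) \<le> measure lborel \<Omega>"
proof -
  let ?h = "mesh_size \<T>" and ?d = "CARD('n)"
  have h: "?h > 0" by (rule mesh_size_bounds[OF mesh(1) \<Omega>(1,2)])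
  have \<T>: "finite \<T>" "\<And>K. K \<in> \<T> \<Longrightarrow> open K \<and> K \<subseteq> \<Omega>" "pairwise disjnt \<T>"
    using mesh(1) by (auto simp: polytopic_mesh_def open_polytope_def)
  have fin: "emeasure lborel A \<noteq> \<infinity>" if "A \<subseteq> \<Omega>" for A
    using emeasure_bounded_finite[OF bounded_subset[OF \<Omega>(2) that]] by simp
  have "unit_ball_vol (real ?d) * (\<theta> * q * ?h) ^ ?d \<le> measure lborel K" if K: "K \<in> \<T>" for K
  proof -
    obtain x \<rho> where \<rho>: "\<theta> * diameter K \<le> \<rho>" "ball x \<rho> \<subseteq> K" "q * ?h \<le> diameter K"
      using mesh(2) K unfolding regular_mesh_def by blast
    \<comment> \<open>Shape regularity bounds the ball radius below by the cell diameter,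
      quasi-uniformity bounds that below by \<open>?h\<close>: one radius fits into every
      cell.\<close>
    have "\<theta> * q * ?h \<le> \<theta> * diameter K" using \<rho>(3) pos by (simp add: mult.assoc)
    then have r: "\<theta> * q * ?h \<le> \<rho>" using \<rho>(1) by linarith
    have p: "0 < \<theta> * q * ?h" using pos h by simp
    have "unit_ball_vol (real ?d) * (\<theta> * q * ?h) ^ ?d \<le> unit_ball_vol (real ?d) * \<rho> ^ ?d"
      using r p by (intro mult_left_mono power_mono) auto
    also have "\<dots> = measure lborel (ball x \<rho>)" using r p by (simp add: content_ball)
    also have "\<dots> \<le> measure lborel K"
      using \<rho>(2) \<T>(2)[OF K] fin[of K] by (intro measure_mono_fmeasurable) (auto intro: fmeasurableI simp: less_top)
    finally show ?thesis .
  qed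
  then have "(\<Sum>K\<in>\<T>. unit_ball_vol (real ?d) * (\<theta> * q * ?h) ^ ?d) \<le> (\<Sum>K\<in>\<T>. measure lborel K)"
    by (rule sum_mono)
  also have "\<dots> = measure lborel (\<Union>K\<in>\<T>. K)"
    using \<T> fin by (intro measure_finite_Union[symmetric])
      (auto simp: disjoint_family_on_def pairwise_def disjnt_def)
  also have "\<dots> \<le> measure lborel \<Omega>"
    using \<T> \<Omega>(3) fin[of \<Omega>] by (intro measure_mono_fmeasurable) (auto intro!: fmeasurableI simp: less_top)
  finally show ?thesis by simp
qed

text \<open>All constants are fixed before the mesh; only \<open>m\<close> depends on it and
  satisfies \<open>C0 / h \<le> m \<le> (C0 + H) / h\<close>. The lower bound provides enough
  indices beyond \<open>N\<close>, the upper one keeps their eigenvalues small.\<close>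

lemma (in white_noise_series) mean_sq_dist_dg_space_ge:
  assumes \<Omega>: "open \<Omega>" "\<Omega> \<noteq> {}" "bounded \<Omega>" and eig: "dirichlet_eigensystem \<kappa> \<Omega> lam \<phi>"
    and mesh: "regular_mesh_family \<Omega> \<M>"
  shows "\<exists>c>0. \<forall>\<T>\<in>\<M>. \<forall>Z \<in> L2_rv P \<Omega> (dg_space \<Omega> k \<T>).
    c * mesh_size \<T> powr (2 - real CARD('n) / 2) \<le> sqrt (mean_sq_dist P \<Omega> Y Z)"
proof -
  let ?d = "CARD('n)" and ?I = "{\<alpha> :: 'n \<Rightarrow> nat. (\<Sum>i\<in>UNIV. \<alpha> i) \<le> k}"
  obtain C where C: "C > 0" "\<And>m. m \<ge> 1 \<Longrightarrow> lam (m ^ ?d - 1) \<le> C * (real m)\<^sup>2"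
    using weyl_upper_bound[OF \<Omega>(1,2) eig] by auto
  obtain \<theta> q where \<theta>: "0 < \<theta>" "0 < q" "\<And>\<T>. \<T> \<in> \<M> \<Longrightarrow> regular_mesh \<theta> q \<T>"
    using mesh unfolding regular_mesh_family_def by blast
  define H where "H = diameter \<Omega>"
  define D where "D = real (card ?I)"
  define b where "b = unit_ball_vol (real ?d) * (\<theta> * q) ^ ?d"
  \<comment> \<open>The factor 2 makes \<open>m ^ ?d\<close> at least twice \<open>N\<close>; the
    maximum with 1 ensures that \<open>C0\<close> is at most its power.\<close>
  define C0 where "C0 = max 1 (2 * (D * measure lborel \<Omega> / b))"
  have b: "b > 0" using \<theta> by (simp add: b_def)
  have C0: "C0 \<ge> 1" "C0 ^ ?d \<ge> 2 * (D * measure lborel \<Omega> / b)"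
    using self_le_power[of C0 ?d] by (auto simp: C0_def)
  \<comment> \<open>The square of \<open>c\<close> combines at least
    \<open>(C0 / h) ^ ?d / 2\<close> indices with eigenvalues of at most
    \<open>C * ((C0 + H) / h)\<^sup>2\<close>.\<close>
  define c where "c = sqrt (C0 ^ ?d / 2) / (C * (C0 + H)\<^sup>2)"
  have H: "H \<ge> 0" unfolding H_def by (rule diameter_ge_0[OF \<Omega>(3)])
  have c: "c > 0" using C C0(1) H by (simp add: c_def)
  have "c * mesh_size \<T> powr (2 - real ?d / 2) \<le> sqrt (mean_sq_dist P \<Omega> Y Z)"
    if T: "\<T> \<in> \<M>" and Z: "Z \<in> L2_rv P \<Omega> (dg_space \<Omega> k \<T>)" for \<T> Z
  proof -
    define h where "h = mesh_size \<T>"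
    have pm: "polytopic_mesh \<Omega> \<T>" using mesh T by (simp add: regular_mesh_family_def)
    have h: "0 < h" "h \<le> H" using mesh_size_bounds[OF pm \<Omega>(2,3)] by (auto simp: h_def H_def)
    define N where "N = card (\<T> \<times> ?I)"
    \<comment> \<open>Rounding up costs at most 1, which is at most \<open>H / h\<close> because
      \<open>h \<le> H\<close>.\<close>
    define m where "m = nat \<lceil>C0 / h\<rceil>"
    have m: "C0 / h \<le> real m" "real m \<le> (C0 + H) / h"
    proof -
      have pos: "0 < C0 / h" using C0(1) h by simp
      show "C0 / h \<le> real m" unfolding m_def by linarith
      have "real m \<le> C0 / h + 1" unfolding m_def using pos by linarith
      also have "\<dots> \<le> (C0 + H) / h" using h by (simp add: field_simps)
      finally show "real m \<le> (C0 + H) / h" .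
    qed
    have m1: "m \<ge> 1"
    proof -
      have "0 < C0 / h" using C0(1) h by simp
      then have "0 < real m" using m(1) by linarith
      then show ?thesis by simp
    qed
    have "real (card \<T>) * (b * h ^ ?d) \<le> measure lborel \<Omega>"
      using card_mesh_le[OF pm \<theta>(3)[OF T] \<Omega>(2,3,1) \<theta>(1,2)]
      by (simp add: b_def h_def power_mult_distrib mult_ac)
    then have "real (card \<T>) * h ^ ?d \<le> measure lborel \<Omega> / b" using b by (simp add: field_simps)
    then have "real N * h ^ ?d \<le> D * measure lborel \<Omega> / b"
      using mult_left_mono[of "real (card \<T>) * h ^ ?d" "measure lborel \<Omega> / b" D]
      by (simp add: N_def D_def card_cartesian_product mult_ac)
    then have "2 * real N * h ^ ?d \<le> C0 ^ ?d" using C0(2) by simp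
    then have "2 * real N \<le> (C0 / h) ^ ?d" using h by (simp add: power_divide field_simps)
    moreover have Cm: "(C0 / h) ^ ?d \<le> real m ^ ?d"
      using m(1) C0(1) h by (intro power_mono) auto
    ultimately have Nm: "2 * real N \<le> real (m ^ ?d)" by simp
    then have "N \<le> m ^ ?d" by linarith
    then have diff: "real (m ^ ?d - N) = real (m ^ ?d) - real N" by (rule of_nat_diff)
    have "(c * h powr (2 - real ?d / 2))\<^sup>2 \<le> real (m ^ ?d) / 2 * (1 / (C * (real m)\<^sup>2)\<^sup>2)"
    proof -
      have "(h powr (2 - real ?d / 2))\<^sup>2 = h powr (4 - real ?d)"
        using h by (simp add: power2_eq_square powr_add[symmetric])
      also have "\<dots> = h ^ 4 / h ^ ?d" using h by (simp add: powr_diff powr_realpow)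
      finally have "(c * h powr (2 - real ?d / 2))\<^sup>2 = (C0 ^ ?d / 2) / (C * (C0 + H)\<^sup>2)\<^sup>2 * (h ^ 4 / h ^ ?d)"
        using C0(1) by (simp add: c_def power_mult_distrib power_divide)
      also have "\<dots> = (C0 / h) ^ ?d / 2 * (1 / (C * ((C0 + H) / h)\<^sup>2)\<^sup>2)"
        using h by (simp add: power_divide power_mult_distrib field_simps)
      also have "\<dots> \<le> real (m ^ ?d) / 2 * (1 / (C * (real m)\<^sup>2)\<^sup>2)"
        using Cm C(1) C0(1) h m m1
        by (intro mult_mono divide_left_mono divide_right_mono power_mono mult_left_mono) auto
      finally show ?thesis .
    qed
    \<comment> \<open>At least half of the first \<open>m ^ ?d\<close> indices are not below
      \<open>N\<close>.\<close>
    also have "\<dots> \<le> real (m ^ ?d - N) * (1 / (C * (real m)\<^sup>2)\<^sup>2)"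
    proof (rule mult_right_mono)
      show "real (m ^ ?d) / 2 \<le> real (m ^ ?d - N)" using Nm unfolding diff by linarith
    qed simp
    also have "\<dots> = (\<Sum>j=N..<m ^ ?d. 1 / (C * (real m)\<^sup>2)\<^sup>2)" by simp
    also have "\<dots> \<le> (\<Sum>j=N..<m ^ ?d. 1 / (lam j)\<^sup>2)"
    proof (rule sum_mono)
      fix j assume "j \<in> {N..<m ^ ?d}"
      then have "lam j \<le> lam (m ^ ?d - 1)" by (intro monoD[OF lam_mono]) auto
      also have "\<dots> \<le> C * (real m)\<^sup>2" by (rule C(2)[OF m1])
      finally show "1 / (C * (real m)\<^sup>2)\<^sup>2 \<le> 1 / (lam j)\<^sup>2"
        using lam_pos[of j] C(1) m1 by (intro divide_left_mono power_mono) auto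
    qed
    also have "\<dots> \<le> mean_sq_dist P \<Omega> Y Z"
    proof (rule mean_sq_dist_ge_partial_sum[where I = "\<T> \<times> ?I" and e = cell_monomial])
      show "finite (\<T> \<times> ?I)"
        using pm finite_multi_indices by (auto simp: polytopic_mesh_def)
      show "card (\<T> \<times> ?I) \<le> N" by (simp add: N_def)
      show "cell_monomial i \<in> L2 \<Omega>" if "i \<in> \<T> \<times> ?I" for i
        using that pm \<Omega> by (auto intro!: cell_monomial_L2 simp: polytopic_mesh_def open_polytope_def)
      show "L2_process Z" by (rule L2_rv_process[OF Z])
      show "\<exists>c. AE x in lebesgue_on \<Omega>. Z \<omega> x = (\<Sum>i\<in>\<T> \<times> ?I. c i * cell_monomial i x)"
        if "\<omega> \<in> space P" for \<omega>
        using Z that by (intro dg_space_lincomb[OF pm \<Omega>(1)]) (simp add: L2_rv_def)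
    qed
    finally show ?thesis unfolding h_def by (rule real_le_rsqrt)
  qed
  then show ?thesis using c by blast
qed

theorem proposition3p6:
  fixes \<Omega> :: "(real^'n::finite) set"
    and \<kappa> :: real
    and lam :: "nat \<Rightarrow> real"
    and \<phi> :: "nat \<Rightarrow> real^'n \<Rightarrow> real"
    and P :: "'w measure"
    and W :: "(real^'n \<Rightarrow> real) \<Rightarrow> 'w \<Rightarrow> real"
    and Y :: "'w \<Rightarrow> real^'n \<Rightarrow> real"
  assumes "CARD('n) \<in> {2, 3}"
    and "0 < \<kappa>"
    and "bounded \<Omega>" and "lipschitz_domain \<Omega>" and "open_polytope \<Omega>"
    and "dirichlet_eigensystem \<kappa> \<Omega> lam \<phi>"
    and "prob_space P" and "complete_measure P"
    and "isonormal_process P \<Omega> W"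
    and "white_noise_solution P \<Omega> lam \<phi> W Y"
  shows "summable (\<lambda>j. 1 / (lam j)\<^sup>2) \<and>
    (\<forall>N S. L2_subspace_of_dim \<Omega> S N \<longrightarrow>
       (\<forall>Z \<in> L2_rv P \<Omega> S. mean_sq_dist P \<Omega> Y Z \<ge> (\<Sum>j. 1 / (lam (N + j))\<^sup>2))) \<and>
    (\<forall>N. L2_subspace_of_dim \<Omega> (L2_span \<Omega> \<phi> N) N \<and>
       (\<exists>Z \<in> L2_rv P \<Omega> (L2_span \<Omega> \<phi> N).
          AE \<omega> in P. L2_orth_proj \<Omega> (L2_span \<Omega> \<phi> N) (Y \<omega>) (Z \<omega>)) \<and>
       (\<forall>Z \<in> L2_rv P \<Omega> (L2_span \<Omega> \<phi> N).
          (AE \<omega> in P. L2_orth_proj \<Omega> (L2_span \<Omega> \<phi> N) (Y \<omega>) (Z \<omega>)) \<longrightarrow>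
          mean_sq_dist P \<Omega> Y Z = (\<Sum>j. 1 / (lam (N + j))\<^sup>2))) \<and>
    (\<forall>k \<M>. 1 \<le> k \<longrightarrow> regular_mesh_family \<Omega> \<M> \<longrightarrow>
       (\<exists>c>0. \<forall>\<T>\<in>\<M>. \<forall>Z \<in> L2_rv P \<Omega> (dg_space \<Omega> k \<T>).
          sqrt (mean_sq_dist P \<Omega> Y Z) \<ge> c * mesh_size \<T> powr (2 - real CARD('n) / 2)))"
proof -
  note eig = \<open>dirichlet_eigensystem \<kappa> \<Omega> lam \<phi>\<close>
  interpret white_noise_series P \<Omega> lam \<phi> W Y
    using assms eigensystem_orthonormal[OF eig]
    by unfold_locales (auto simp: dirichlet_eigensystem_def)
  have \<Omega>: "open \<Omega>" "\<Omega> \<noteq> {}" using \<open>open_polytope \<Omega>\<close> by (auto simp: open_polytope_def)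
  show ?thesis
    by (intro conjI allI impI ballI summable_inverse_sq mean_sq_dist_ge_tail span_\<phi>_dim
        projection_exists optimal_projection
        mean_sq_dist_dg_space_ge[OF \<Omega> \<open>bounded \<Omega>\<close> eig])
qed

end
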